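(* Let $d\ge3$ and let $C,C_1,C_2,\dots\in\mathcal{C}^d_{ar}$ have generators $\psi,\psi_1,\psi_2,\dots$ with pseudo-inverses $\varphi,\varphi_1,\varphi_2,\dots$. The following are equivalent: (1) $(C_n)$ converges uniformly to $C$; (2) for all $i\ne j$ in $\{1,\dots,d\}$, the bivariate marginals $(C_n^{ij})$ converge uniformly to $C^{ij}$; (3) $(\varphi_n)$ converges pointwise to $\varphi$ on $(0,1]$; (4) $(\psi_n)$ converges uniformly to $\psi$ on $[0,\infty)$; (5) $(\psi_n^{(m)})$ converges pointwise to $\psi^{(m)}$ on $(0,\infty)$ for every $m\in\{1,\dots,d-2\}$, and $(D^-\psi_n^{(d-2)})$ converges pointwise to $D^-\psi^{(d-2)}$ on $\mathrm{Cont}(D^-\psi^{(d-2)})$; (6) for every $m\in\{2,\dots,d-1\}$, $(c_n^{1:m})$ converges to $c^{1:m}$ $\lambda_m$-almost everywhere on $\mathbb{I}^m$. Moreover, any of these assertions implies that $(C_n)$ converges weakly conditional to $C$.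
   Context: $\mathbb{I}=[0,1]$. An Archimedean generator is a continuous non-increasing $\psi:[0,\infty)\to\mathbb{I}$ with $\psi(0)=1$, $\lim_{z\to\infty}\psi(z)=0$, strictly decreasing on $[0,\inf\{z:\psi(z)=0\}]$; pseudo-inverse $\varphi(y)=\inf\{z\in[0,\infty]:\psi(z)=y\}$. $\psi$ is $d$-monotone if $(-1)^{d-2}\psi^{(d-2)}$ exists on $(0,\infty)$ and is non-negative, non-increasing and convex. $\mathcal{C}^d_{ar}$: copulas $C(\mathbf{u})=\psi(\sum_i\varphi(u_i))$ with $d$-monotone generator normalized by $\psi(1)=1/2$. $D^-$ is the left-hand derivative, $\mathrm{Cont}(g)$ the set of continuity points of $g$. $C^{ij}$ is the bivariate marginal of coordinates $i,j$; $C^{1:m}(x_1,\dots,x_m)=C(x_1,\dots,x_m,1,\dots,1)$, which for $m<d$ is absolutely continuous with density $c^{1:m}$. For $C\in\mathcal{C}^d_{ar}$ let $K_C$ denote its $(d-1)$-Markov kernel (regular conditional distribution of the last coordinate given the first $d-1$ coordinates), in the version $K_C(\mathbf{x},[0,y])=1$ if $\min_i x_i=1$ or $\sum_{i\le d-1}\varphi(x_i)\ge\varphi(0)$; $=0$ if otherwise and $y<\psi(\varphi(0)-\sum_{i\le d-1}\varphi(x_i))$; and $=D^-\psi^{(d-2)}(\sum_{i\le d-1}\varphi(x_i)+\varphi(y))/D^-\psi^{(d-2)}(\sum_{i\le d-1}\varphi(x_i))$ otherwise (conventions $\psi(\infty)=0$, $\psi(u)=1$ for $u<0$, $D^-\psi^{(d-2)}(\infty)=0$).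 $(C_n)$ converges weakly conditional to $C$ if there is a Borel $\Lambda\subseteq\mathbb{I}^{d-1}$ with $\mu_{C^{1:d-1}}(\Lambda)=1$ such that $K_{C_n}(\mathbf{x},\cdot)\to K_C(\mathbf{x},\cdot)$ weakly for every $\mathbf{x}\in\Lambda$. *)

theory Defs
  imports "HOL-Probability.Probability"
begin

text \<open>Points of the unit cube in dimension m are extensional functions nat => real
  (coordinates 0,...,m-1, i.e. coordinate i of the paper is index i-1 here).\<close>

definition cube :: "nat \<Rightarrow> (nat \<Rightarrow> real) set" where
  "cube m = PiE {..<m} (\<lambda>_. {0..1})"

definition psi_ext :: "(real \<Rightarrow> real) \<Rightarrow> ereal \<Rightarrow> real" where
  "psi_ext \<psi> z = (if z = \<infinity> then 0 else if z < 0 then 1 else \<psi> (real_of_ereal z))"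

definition pinv :: "(real \<Rightarrow> real) \<Rightarrow> real \<Rightarrow> ereal" where
  "pinv \<psi> y = Inf {z::ereal. 0 \<le> z \<and> psi_ext \<psi> z = y}"

definition arch_generator :: "(real \<Rightarrow> real) \<Rightarrow> bool" where
  "arch_generator \<psi> \<longleftrightarrow>
     continuous_on {0..} \<psi> \<and> antimono_on {0..} \<psi> \<and> (\<forall>x\<ge>0. \<psi> x \<in> {0..1}) \<and>
     \<psi> 0 = 1 \<and> (\<psi> \<longlongrightarrow> 0) at_top \<and>
     strict_antimono_on {x. 0 \<le> x \<and> ereal x \<le> Inf {ereal z | z. 0 \<le> z \<and> \<psi> z = 0}} \<psi>"

definition nth_deriv :: "nat \<Rightarrow> (real \<Rightarrow> real) \<Rightarrow> real \<Rightarrow> real" where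
  "nth_deriv m \<psi> = (deriv ^^ m) \<psi>"

definition left_deriv :: "(real \<Rightarrow> real) \<Rightarrow> real \<Rightarrow> real" where
  "left_deriv g x = Lim (at_left x) (\<lambda>y. (g y - g x) / (y - x))"

definition d_monotone :: "nat \<Rightarrow> (real \<Rightarrow> real) \<Rightarrow> bool" where
  "d_monotone d \<psi> \<longleftrightarrow> arch_generator \<psi> \<and>
     (\<forall>k < d - 2. \<forall>x > 0. (nth_deriv k \<psi> has_real_derivative nth_deriv (Suc k) \<psi> x) (at x)) \<and>
     (\<forall>x > 0. 0 \<le> (-1) ^ (d - 2) * nth_deriv (d - 2) \<psi> x) \<and>
     antimono_on {0<..} (\<lambda>x. (-1) ^ (d - 2) * nth_deriv (d - 2) \<psi> x) \<and>
     convex_on {0<..} (\<lambda>x. (-1) ^ (d - 2) * nth_deriv (d - 2) \<psi> x)"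

definition ar_generator :: "nat \<Rightarrow> (real \<Rightarrow> real) \<Rightarrow> bool" where
  "ar_generator d \<psi> \<longleftrightarrow> d_monotone d \<psi> \<and> \<psi> 1 = 1/2"

definition arch_copula :: "nat \<Rightarrow> (real \<Rightarrow> real) \<Rightarrow> (nat \<Rightarrow> real) \<Rightarrow> real" where
  "arch_copula d \<psi> u = psi_ext \<psi> (\<Sum>i<d. pinv \<psi> (u i))"

definition marg2 :: "((nat \<Rightarrow> real) \<Rightarrow> real) \<Rightarrow> nat \<Rightarrow> nat \<Rightarrow> real \<times> real \<Rightarrow> real" where
  "marg2 C i j p = C (\<lambda>k. if k = i then fst p else if k = j then snd p else 1)"

definition marg :: "((nat \<Rightarrow> real) \<Rightarrow> real) \<Rightarrow> nat \<Rightarrow> (nat \<Rightarrow> real) \<Rightarrow> real" where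
  "marg C m x = C (\<lambda>k. if k < m then x k else 1)"

definition copula_measure :: "nat \<Rightarrow> ((nat \<Rightarrow> real) \<Rightarrow> real) \<Rightarrow> (nat \<Rightarrow> real) measure" where
  "copula_measure m F = (SOME M. sets M = sets (PiM {..<m} (\<lambda>_. lborel)) \<and> prob_space M \<and>
      (\<forall>x \<in> cube m. measure M (PiE {..<m} (\<lambda>i. {..x i})) = F x))"

definition marg_density :: "nat \<Rightarrow> ((nat \<Rightarrow> real) \<Rightarrow> real) \<Rightarrow> (nat \<Rightarrow> real) \<Rightarrow> ennreal" where
  "marg_density m C = RN_deriv (PiM {..<m} (\<lambda>_. lborel)) (copula_measure m (marg C m))"

definition ld_ext :: "nat \<Rightarrow> (real \<Rightarrow> real) \<Rightarrow> ereal \<Rightarrow> real" where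
  "ld_ext d \<psi> t = (if t = \<infinity> then 0 else left_deriv (nth_deriv (d - 2) \<psi>) (real_of_ereal t))"

text \<open>The (d-1)-Markov kernel K_C(x,[0,y]) in the stated version, as a distribution
  function in y, extended by 0 for y<0 and 1 for y>=1.\<close>

definition kernel_cdf :: "nat \<Rightarrow> (real \<Rightarrow> real) \<Rightarrow> (nat \<Rightarrow> real) \<Rightarrow> real \<Rightarrow> real" where
  "kernel_cdf d \<psi> x y =
     (let S = (\<Sum>i<d-1. pinv \<psi> (x i)) in
      if y < 0 then 0
      else if 1 \<le> y then 1
      else if Min (x ` {..<d-1}) = 1 \<or> pinv \<psi> 0 \<le> S then 1
      else if y < psi_ext \<psi> (pinv \<psi> 0 - S) then 0
      else ld_ext d \<psi> (S + pinv \<psi> y) / ld_ext d \<psi> S)"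

definition weak_cond_conv :: "nat \<Rightarrow> (nat \<Rightarrow> real \<Rightarrow> real) \<Rightarrow> (real \<Rightarrow> real) \<Rightarrow> bool" where
  "weak_cond_conv d \<psi>s \<psi> \<longleftrightarrow>
     (\<exists>\<Lambda> \<in> sets (PiM {..<d-1} (\<lambda>_. lborel)). \<Lambda> \<subseteq> cube (d-1) \<and>
        measure (copula_measure (d-1) (marg (arch_copula d \<psi>) (d-1))) \<Lambda> = 1 \<and>
        (\<forall>x \<in> \<Lambda>. weak_conv (\<lambda>n. kernel_cdf d (\<psi>s n) x) (kernel_cdf d \<psi> x)))"

end

theory Submission
  imports Defs
begin

text \<open>A copula determines its generator through the normalization \<open>\<psi> 1 = 1/2\<close>: since
  \<open>\<psi> (s + t) = C (\<psi> s, \<psi> t)\<close> for the bivariate marginal, the values of \<open>\<psi>\<close> at the dyadic rationals are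
  obtained from \<open>\<psi> 1\<close> by halving and adding. Hence pointwise convergence of one bivariate marginal
  already forces \<open>\<psi>\<^sub>n \<rightarrow> \<psi>\<close>, and monotonicity with continuous limit makes this uniform and carries it over
  to the inverses and to the copulas. Up to sign all derivatives of a generator are nonincreasing and
  convex, and for convex functions pointwise convergence passes to (left) derivatives wherever the
  limiting derivative is continuous. The density of the \<open>m\<close>-dimensional marginal is
  \<open>(- 1)\<^sup>m \<psi>\<^sup>m(\<Sum>i. \<phi> x\<^sub>i) * (\<Prod>i. \<bar>\<phi>' x\<^sub>i\<bar>)\<close>, where \<open>\<psi>\<^sup>m\<close> is the \<open>m\<close>-th derivative, and the level sets of
  \<open>\<Sum>i. \<phi> x\<^sub>i\<close> are null sets, which yields convergence of densities and kernels almost everywhere. Conversely,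
  almost everywhere convergence of probability densities implies convergence of the distribution functions
  by Fatou's lemma.\<close>

text \<open>Three obstacles shape the details. The derivative of order \<open>d - 1\<close> is only
  a left derivative and may jump: statements about it hold off a countable set of arguments, and its
  integral is computed from convexity instead of from differentiability. A generator may reach 0 at
  a finite point, where this left derivative need not vanish, or stay positive, where
  \<open>pinv\<close> is infinite at 0; levels are therefore inverted on \<open>(0,1]\<close> only,
  and positivity of \<open>\<psi>\<close> is carried along wherever a point is recovered from its
  level. Finally, a bivariate marginal gives \<open>\<psi>s n\<close> at sums of \<open>n\<close>-th
  inverses, never at a prescribed point, and equicontinuity of the \<open>\<psi>s n\<close> is not
  at hand. A prescribed point is therefore bracketed by the inverses of slightly shifted levels, and
  monotonicity does the comparison.\<close>

section \<open>Monotone and convex functions of a real variable\<close>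

text \<open>Dini's second theorem. The \<open>fs n\<close> may jump: uniform continuity of the limit
  supplies a grid, convergence is uniform on its finitely many nodes, and monotonicity traps the
  values between neighbouring nodes.\<close>

lemma uniform_limit_antimono_Icc:
  fixes f :: "real \<Rightarrow> real" and fs :: "nat \<Rightarrow> real \<Rightarrow> real"
  assumes anti: "\<And>n. antimono_on {a..b} (fs n)"
    and cont: "continuous_on {a..b} f"
    and lim: "\<And>x. x \<in> {a..b} \<Longrightarrow> (\<lambda>n. fs n x) \<longlonglongrightarrow> f x"
  shows "uniform_limit {a..b} fs f sequentially"
proof (cases "a < b")
  case False
  then have "{a..b} = {} \<or> {a..b} = {a}" by auto
  then show ?thesis
  proof
    assume eq: "{a..b} = {a}"
    then have "a \<in> {a..b}" by blast
    then have "(\<lambda>n. fs n a) \<longlonglongrightarrow> f a" by (rule lim)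
    then show ?thesis unfolding eq uniform_limit_iff tendsto_iff by simp
  qed (simp add: uniform_limit_iff)
next
  case True
  show ?thesis
  proof (rule uniform_limitI)
    fix e :: real assume "e > 0"
    have "uniformly_continuous_on {a..b} f"
      using cont compact_uniformly_continuous by blast
    then obtain r where "r > 0"
      and r: "\<And>x y. x \<in> {a..b} \<Longrightarrow> y \<in> {a..b} \<Longrightarrow> dist y x < r \<Longrightarrow> dist (f y) (f x) < e/2"
      unfolding uniformly_continuous_on_def using \<open>e > 0\<close> half_gt_zero by metis
    obtain N :: nat where N: "(b - a) / r < real N" using reals_Archimedean2 by blast
    have "(b - a) / r > 0" using True \<open>r > 0\<close> by simp
    then have "N > 0" using N by (cases N) auto
    define w where "w = (b - a) / real N"
    have step: "w < r" "0 < w" "real N * w = b - a"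
      using N \<open>N > 0\<close> \<open>r > 0\<close> True by (auto simp: w_def field_simps)
    define p where "p i = a + real i * w" for i
    have p_in: "p i \<in> {a..b}" if "i \<le> N" for i
    proof -
      have "real i * w \<le> real N * w" "0 \<le> real i * w"
        using that step(2) by (auto intro: mult_right_mono)
      then show ?thesis using step(3) by (simp add: p_def)
    qed
    have "\<forall>\<^sub>F n in sequentially. \<forall>i\<in>{..N}. dist (fs n (p i)) (f (p i)) < e/2"
      using tendstoD[OF lim[OF p_in], of _ "e/2"] \<open>e > 0\<close>
      by (intro eventually_ball_finite) auto
    then show "\<forall>\<^sub>F n in sequentially. \<forall>x\<in>{a..b}. dist (fs n x) (f x) < e"
    proof eventually_elim
      case (elim n)
      show ?case
      proof
        fix x assume x: "x \<in> {a..b}"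
        show "dist (fs n x) (f x) < e"
        \<comment> \<open>At \<open>b\<close> the floor below would give the index \<open>N\<close>,
          whose successor is no node.\<close>
        proof (cases "x = b")
          case True
          have "p N = b" using step(3) by (simp add: p_def)
          then show ?thesis using elim True \<open>e > 0\<close> by force
        next
          case False
          define i where "i = nat \<lfloor>(x - a) / w\<rfloor>"
          have nn: "(x - a) / w \<ge> 0" using x step by simp
          have i: "real i \<le> (x - a) / w" "(x - a) / w < real i + 1"
            using nn unfolding i_def by linarith+
          have "(x - a) / w < real N"
            using x False step by (auto simp: pos_divide_less_eq)
          then have "i < N" using i by linarith
          have px: "p i \<le> x" "x < p (Suc i)"
            using i step(2) by (auto simp: p_def pos_le_divide_eq pos_divide_less_eq algebra_simps)
          have psuc: "p (Suc i) - p i < r" using step by (simp add: p_def algebra_simps)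
          have in1: "p i \<in> {a..b}" "p (Suc i) \<in> {a..b}" using p_in \<open>i < N\<close> by auto
          have "fs n x \<le> fs n (p i)" "fs n (p (Suc i)) \<le> fs n x"
            using anti[of n] in1 x px unfolding monotone_on_def by (auto simp: less_imp_le)
          moreover have "dist (f (p i)) (f x) < e/2" "dist (f (p (Suc i))) (f x) < e/2"
            using r[OF x in1(1)] r[OF x in1(2)] px psuc by (auto simp: dist_real_def)
          moreover have "dist (fs n (p i)) (f (p i)) < e/2"
            "dist (fs n (p (Suc i))) (f (p (Suc i))) < e/2" using elim \<open>i < N\<close> by auto
          ultimately show ?thesis by (auto simp: dist_real_def abs_if split: if_splits)
        qed
      qed
    qed
  qed
qed

text \<open>Beyond the cut-off \<open>c\<close> both functions lie in \<open>[0, e)\<close>, because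
  a value below \<open>e\<close> at \<open>c\<close> bounds a nonincreasing tail; the part before
  \<open>c\<close> is compact.\<close>

lemma uniform_limit_antimono_atLeast:
  fixes f :: "real \<Rightarrow> real" and fs :: "nat \<Rightarrow> real \<Rightarrow> real"
  assumes anti: "\<And>n. antimono_on {a..} (fs n)" "antimono_on {a..} f"
    and nonneg: "\<And>n x. a \<le> x \<Longrightarrow> 0 \<le> fs n x" "\<And>x. a \<le> x \<Longrightarrow> 0 \<le> f x"
    and cont: "continuous_on {a..} f" and zero: "(f \<longlongrightarrow> 0) at_top"
    and lim: "\<And>x. a \<le> x \<Longrightarrow> (\<lambda>n. fs n x) \<longlonglongrightarrow> f x"
  shows "uniform_limit {a..} fs f sequentially"
proof (rule uniform_limitI)
  fix e :: real assume "e > 0"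
  have "\<forall>\<^sub>F x in at_top. f x < e" using zero \<open>e > 0\<close> by (rule order_tendstoD)
  then obtain b where b: "\<And>x. x \<ge> b \<Longrightarrow> f x < e" by (auto simp: eventually_at_top_linorder)
  define c where "c = max a b"
  have "uniform_limit {a..c} fs f sequentially"
    using cont lim
    by (intro uniform_limit_antimono_Icc monotone_on_subset[OF anti(1)])
       (auto intro: continuous_on_subset)
  then have "\<forall>\<^sub>F n in sequentially. \<forall>x\<in>{a..c}. dist (fs n x) (f x) < e"
    using \<open>e > 0\<close> by (rule uniform_limitD)
  moreover have "\<forall>\<^sub>F n in sequentially. fs n c < e"
    using lim[of c] b[of c] by (intro order_tendstoD) (auto simp: c_def)
  ultimately show "\<forall>\<^sub>F n in sequentially. \<forall>x\<in>{a..}. dist (fs n x) (f x) < e"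
  proof eventually_elim
    case (elim n)
    show ?case
    proof
      fix x assume "x \<in> {a..}"
      show "dist (fs n x) (f x) < e"
      proof (cases "x \<le> c")
        case True
        then show ?thesis using elim \<open>x \<in> {a..}\<close> by auto
      next
        case False
        then have "c \<in> {a..}" "c \<le> x" by (auto simp: c_def)
        then have "fs n x \<le> fs n c" "f x \<le> f c"
          using anti(1)[of n] anti(2) \<open>x \<in> {a..}\<close> unfolding monotone_on_def by blast+
        moreover have "f c < e" using b by (simp add: c_def)
        moreover have "0 \<le> fs n x" "0 \<le> f x" using nonneg \<open>x \<in> {a..}\<close> by auto
        ultimately show ?thesis using elim by (auto simp: dist_real_def abs_if)
      qed
    qed
  qed
qed

lemma isCont_minus_iff:
  fixes f :: "real \<Rightarrow> real"
  shows "isCont (\<lambda>x. - f x) x \<longleftrightarrow> isCont f x"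
  using continuous_minus[of "at x" "\<lambda>x. - f x"] continuous_minus[of "at x" f] by auto

lemma countable_discont_antimono:
  fixes f :: "real \<Rightarrow> real"
  assumes "antimono_on {0<..} f"
  shows "countable {x. 0 < x \<and> \<not> isCont f x}"
proof -
  have "mono_on {0<..} (\<lambda>x. - f x)" using assms by (auto simp: monotone_on_def)
  then have "countable {x\<in>{0<..}. \<not> isCont (\<lambda>x. - f x) x}"
    by (intro mono_on_ctble_discont_open) auto
  then show ?thesis by (simp add: isCont_minus_iff)
qed

lemma obtain_isCont_antimono:
  fixes f :: "real \<Rightarrow> real"
  assumes "antimono_on {0<..} f" "0 \<le> a" "a < b"
  obtains y where "a < y" "y < b" "isCont f y"
proof -
  have "uncountable ({a<..<b} - {x. 0 < x \<and> \<not> isCont f x})"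
    using assms countable_discont_antimono uncountable_minus_countable uncountable_open_interval
    by blast
  then have "{a<..<b} - {x. 0 < x \<and> \<not> isCont f x} \<noteq> {}" by (metis countable_empty)
  then obtain y where "y \<in> {a<..<b}" "0 < y \<longrightarrow> isCont f y" by blast
  then show ?thesis using that assms by auto
qed

text \<open>Arguments such as inverses of \<open>\<psi>s n\<close> move with \<open>n\<close>, while
  convergence is known only at continuity points. These are dense, so two of them close to
  \<open>x\<close> eventually enclose \<open>xs n\<close>, and monotonicity transfers the
  bounds.\<close>

lemma tendsto_antimono_moving:
  fixes f :: "real \<Rightarrow> real" and fs :: "nat \<Rightarrow> real \<Rightarrow> real"
  assumes anti: "\<And>n. antimono_on {0<..} (fs n)" "antimono_on {0<..} f"
    and lim: "\<And>x. 0 < x \<Longrightarrow> isCont f x \<Longrightarrow> (\<lambda>n. fs n x) \<longlonglongrightarrow> f x"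
    and x: "0 < x" "isCont f x" "xs \<longlonglongrightarrow> x"
  shows "(\<lambda>n. fs n (xs n)) \<longlonglongrightarrow> f x"
proof (rule tendstoI)
  fix e :: real assume "e > 0"
  obtain r where "r > 0" and r: "\<And>y. dist y x < r \<Longrightarrow> dist (f y) (f x) < e"
    using x(2) \<open>e > 0\<close> by (auto simp: continuous_at_eps_delta dist_commute)
  obtain y where y: "max 0 (x - r) < y" "y < x" "isCont f y"
    using obtain_isCont_antimono[OF anti(2), of "max 0 (x - r)" x] x(1) \<open>r > 0\<close> by auto
  obtain z where z: "x < z" "z < x + r" "isCont f z"
    using obtain_isCont_antimono[OF anti(2), of x "x + r"] x(1) \<open>r > 0\<close> by auto
  have "f y < f x + e" "f z > f x - e"
    using r[of y] r[of z] y z by (auto simp: dist_real_def abs_if split: if_splits)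
  then have "\<forall>\<^sub>F n in sequentially. fs n y < f x + e" "\<forall>\<^sub>F n in sequentially. fs n z > f x - e"
    using lim[of y] lim[of z] y z x(1) by (auto intro: order_tendstoD)
  moreover have "\<forall>\<^sub>F n in sequentially. xs n > y" "\<forall>\<^sub>F n in sequentially. xs n < z"
    using x(3) y z by (auto intro: order_tendstoD)
  ultimately show "\<forall>\<^sub>F n in sequentially. dist (fs n (xs n)) (f x) < e"
  proof eventually_elim
    case (elim n)
    have "fs n (xs n) \<le> fs n y" "fs n z \<le> fs n (xs n)"
      using anti(1)[of n] elim y(1) by (auto simp: monotone_on_def)
    then show ?case using elim by (auto simp: dist_real_def abs_if)
  qed
qed

section \<open>One-sided derivatives of convex functions\<close>

lemma left_deriv_eq:
  assumes "(g has_real_derivative D) (at x)"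
  shows "left_deriv g x = D"
proof -
  have "((\<lambda>y. (g y - g x) / (y - x)) \<longlongrightarrow> D) (at_left x)"
    using assms[THEN has_field_derivative_at_within] by (simp add: has_field_derivative_iff)
  then show ?thesis unfolding left_deriv_def by (intro tendsto_Lim) auto
qed

context
  fixes f :: "real \<Rightarrow> real"
  assumes convex: "convex_on {0<..} f"
begin

lemma convex_slope_le_left:
  assumes "0 < y" "y < z" "z < x"
  shows "(f y - f x) / (y - x) \<le> (f z - f x) / (z - x)"
  using convex_on_slope_le(2)[OF convex, of y x z] assms by simp

lemma convex_slope_le_across:
  assumes "0 < y" "y < x" "x < z"
  shows "(f y - f x) / (y - x) \<le> (f z - f x) / (z - x)"
proof -
  have "(f y - f x) / (y - x) \<le> (f x - f z) / (x - z)"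
    using convex_on_slope_le[OF convex, of y z x] assms by force
  also have "\<dots> = (f z - f x) / (z - x)"
    by (metis minus_diff_eq minus_divide_divide)
  finally show ?thesis .
qed

text \<open>\<open>left_deriv\<close> is a \<open>Lim\<close> and says nothing until the limit is
  known to exist. By convexity the quotient increases as \<open>y\<close> approaches
  \<open>x\<close> and is bounded by a chord to the right, so its supremum is the limit.\<close>

lemma tendsto_left_deriv:
  assumes x: "0 < x"
  shows "((\<lambda>y. (f y - f x) / (y - x)) \<longlongrightarrow> left_deriv f x) (at_left x)"
proof -
  define q where "q y = (f y - f x) / (y - x)" for y
  have bdd: "bdd_above (q ` {0<..<x})"
    using convex_slope_le_across[of _ x "x + 1"] x
    by (intro bdd_aboveI2[where M = "q (x + 1)"]) (auto simp: q_def)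
  define L where "L = Sup (q ` {0<..<x})"
  have "(q \<longlongrightarrow> L) (at_left x)"
  proof (rule order_tendstoI)
    fix a assume "a < L"
    then obtain z where z: "0 < z" "z < x" "a < q z"
      unfolding L_def using bdd x by (subst (asm) less_cSUP_iff) auto
    then have "a < q y" if "z < y" "y < x" for y
      using convex_slope_le_left[of z y x] that unfolding q_def by linarith
    then show "\<forall>\<^sub>F y in at_left x. a < q y"
      unfolding eventually_at_left_field using z by blast
  next
    fix a assume "L < a"
    then have "q y < a" if "0 < y" "y < x" for y
      using cSUP_upper[OF _ bdd, of y] that unfolding L_def by auto
    then show "\<forall>\<^sub>F y in at_left x. q y < a"
      unfolding eventually_at_left_field using x by blast
  qed
  moreover from this have "left_deriv f x = L"
    unfolding left_deriv_def q_def by (intro tendsto_Lim) auto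
  ultimately show ?thesis by (simp add: q_def[abs_def])
qed

lemma slope_le_left_deriv:
  assumes "0 < y" "y < x"
  shows "(f y - f x) / (y - x) \<le> left_deriv f x"
proof (rule tendsto_lowerbound)
  show "((\<lambda>y. (f y - f x) / (y - x)) \<longlongrightarrow> left_deriv f x) (at_left x)"
    using assms by (intro tendsto_left_deriv) auto
  show "\<forall>\<^sub>F z in at_left x. (f y - f x) / (y - x) \<le> (f z - f x) / (z - x)"
    unfolding eventually_at_left_field using assms convex_slope_le_left by blast
qed simp

lemma left_deriv_le_slope:
  assumes "0 < x" "x < z"
  shows "left_deriv f x \<le> (f z - f x) / (z - x)"
proof (rule tendsto_upperbound)
  show "((\<lambda>y. (f y - f x) / (y - x)) \<longlongrightarrow> left_deriv f x) (at_left x)"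
    using assms by (intro tendsto_left_deriv) auto
  show "\<forall>\<^sub>F y in at_left x. (f y - f x) / (y - x) \<le> (f z - f x) / (z - x)"
    unfolding eventually_at_left_field using assms convex_slope_le_across by blast
qed simp

lemma left_deriv_bounds:
  assumes "0 < x" "x \<le> z"
  shows "left_deriv f x * (z - x) \<le> f z - f x" "f z - f x \<le> left_deriv f z * (z - x)"
proof -
  show "left_deriv f x * (z - x) \<le> f z - f x"
    using left_deriv_le_slope[of x z] assms by (cases "x = z") (auto simp: field_simps)
  show "f z - f x \<le> left_deriv f z * (z - x)"
    using slope_le_left_deriv[of x z] assms
    by (cases "x = z") (auto simp: divide_le_eq algebra_simps)
qed

lemma mono_left_deriv: "mono_on {0<..} (left_deriv f)"
proof (rule mono_onI)
  fix x z :: real assume "x \<in> {0<..}" "x \<le> z"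
  then have "left_deriv f x * (z - x) \<le> left_deriv f z * (z - x)"
    using left_deriv_bounds[of x z] by simp
  then show "left_deriv f x \<le> left_deriv f z"
    using \<open>x \<le> z\<close> by (cases "x = z") auto
qed

end

text \<open>The slope of a chord to the left of \<open>x\<close> bounds the left derivative from
  below, that of a chord to the right bounds it from above, and slopes of chords converge because
  the functions do.\<close>

lemma tendsto_left_deriv_convex:
  fixes f :: "real \<Rightarrow> real" and fs :: "nat \<Rightarrow> real \<Rightarrow> real"
  assumes conv: "\<And>n. convex_on {0<..} (fs n)" "convex_on {0<..} f"
    and lim: "\<And>x. 0 < x \<Longrightarrow> (\<lambda>n. fs n x) \<longlonglongrightarrow> f x"
    and x: "0 < x" "isCont (left_deriv f) x"
  shows "(\<lambda>n. left_deriv (fs n) x) \<longlonglongrightarrow> left_deriv f x"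
proof (rule order_tendstoI)
  fix a assume "a < left_deriv f x"
  with tendsto_left_deriv[OF conv(2) x(1)]
  have "\<forall>\<^sub>F y in at_left x. a < (f y - f x) / (y - x)" by (rule order_tendstoD)
  moreover have "\<forall>\<^sub>F y in at_left x. 0 < y \<and> y < x"
    unfolding eventually_at_left_field using x(1) by blast
  ultimately have "\<forall>\<^sub>F y in at_left x. a < (f y - f x) / (y - x) \<and> 0 < y \<and> y < x"
    by eventually_elim auto
  then obtain y where y: "a < (f y - f x) / (y - x)" "0 < y" "y < x"
    using eventually_happens'[of "at_left x"] by (metis (mono_tags, lifting) trivial_limit_at_left_real)
  have "(\<lambda>n. (fs n y - fs n x) / (y - x)) \<longlonglongrightarrow> (f y - f x) / (y - x)"
    using lim y x(1) by (intro tendsto_intros) auto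
  then have "\<forall>\<^sub>F n in sequentially. a < (fs n y - fs n x) / (y - x)"
    using y(1) by (rule order_tendstoD)
  then show "\<forall>\<^sub>F n in sequentially. a < left_deriv (fs n) x"
    by eventually_elim (use slope_le_left_deriv[OF conv(1)] y in \<open>blast intro: less_le_trans\<close>)
next
  \<comment> \<open>A chord to the right may be as steep as \<open>left_deriv f z\<close> with
    \<open>z > x\<close>; continuity at \<open>x\<close> yields a \<open>z\<close> for which this is
    still below \<open>a\<close>.\<close>
  fix a assume "left_deriv f x < a"
  with x(2) have "\<forall>\<^sub>F z in at x. left_deriv f z < a"
    unfolding isCont_def by (rule order_tendstoD)
  then have "\<forall>\<^sub>F z in at_right x. left_deriv f z < a" by (simp add: eventually_at_split)
  moreover have "\<forall>\<^sub>F z in at_right x. x < z" by (simp add: eventually_at_right_less)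
  ultimately have "\<forall>\<^sub>F z in at_right x. left_deriv f z < a \<and> x < z"
    by eventually_elim auto
  then obtain z where z: "left_deriv f z < a" "x < z"
    using eventually_happens'[of "at_right x"] by (metis (mono_tags, lifting) trivial_limit_at_right_real)
  have "(f z - f x) / (z - x) \<le> left_deriv f z"
    using left_deriv_bounds(2)[OF conv(2) x(1), of z] z by (simp add: pos_divide_le_eq)
  then have less: "(f z - f x) / (z - x) < a" using z by linarith
  have "(\<lambda>n. (fs n z - fs n x) / (z - x)) \<longlonglongrightarrow> (f z - f x) / (z - x)"
    using lim z x(1) by (intro tendsto_intros) auto
  then have "\<forall>\<^sub>F n in sequentially. (fs n z - fs n x) / (z - x) < a"
    using less by (rule order_tendstoD)
  then show "\<forall>\<^sub>F n in sequentially. left_deriv (fs n) x < a"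
    by eventually_elim (use left_deriv_le_slope[OF conv(1)] z x in \<open>blast intro: le_less_trans\<close>)
qed

section \<open>The fundamental theorem of calculus for left derivatives\<close>

text \<open>On \<open>N\<close> equal pieces the bounds telescope to
  \<open>(D b - D a) * (b - a) / N\<close>, which tends to 0. This replaces differentiating
  \<open>h\<close>, which may fail at the jumps of a merely monotone \<open>D\<close>.\<close>

lemma eq_if_increments_small:
  fixes h D :: "real \<Rightarrow> real"
  assumes "a \<le> b"
    and small: "\<And>u v. a \<le> u \<Longrightarrow> u \<le> v \<Longrightarrow> v \<le> b \<Longrightarrow> \<bar>h v - h u\<bar> \<le> (D v - D u) * (v - u)"
  shows "h a = h b"
proof -
  have bound: "\<bar>h b - h a\<bar> \<le> (D b - D a) * (b - a) / real N" if "N > 0" for N :: nat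
  proof -
    define p where "p i = a + real i * ((b - a) / real N)" for i
    have pN: "p 0 = a" "p N = b" using that by (auto simp: p_def)
    have st: "(b - a) / real N \<ge> 0" using assms(1) by simp
    have mono: "p i \<le> p j" if "i \<le> j" for i j
      unfolding p_def using that st by (intro add_left_mono mult_right_mono) auto
    have "\<bar>h b - h a\<bar> = \<bar>\<Sum>i<N. h (p (Suc i)) - h (p i)\<bar>"
      using sum_lessThan_telescope[of "\<lambda>i. h (p i)" N] pN by simp
    also have "\<dots> \<le> (\<Sum>i<N. \<bar>h (p (Suc i)) - h (p i)\<bar>)" by (rule sum_abs)
    also have "\<dots> \<le> (\<Sum>i<N. (D (p (Suc i)) - D (p i)) * ((b - a) / real N))"
    proof (rule sum_mono)
      fix i assume "i \<in> {..<N}"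
      then have "a \<le> p i" "p i \<le> p (Suc i)" "p (Suc i) \<le> b"
        using mono[of 0 i] mono[of i "Suc i"] mono[of "Suc i" N] pN by auto
      moreover have "p (Suc i) - p i = (b - a) / real N"
        by (simp add: p_def distrib_right del: times_divide_eq_right)
      ultimately show "\<bar>h (p (Suc i)) - h (p i)\<bar> \<le> (D (p (Suc i)) - D (p i)) * ((b - a) / real N)"
        using small[of "p i" "p (Suc i)"] by simp
    qed
    also have "\<dots> = (D b - D a) * (b - a) / real N"
      using sum_lessThan_telescope[of "\<lambda>i. D (p i)" N] pN
      unfolding sum_distrib_right[symmetric] by simp
    finally show ?thesis .
  qed
  have "(\<lambda>N. (D b - D a) * (b - a) / real N) \<longlonglongrightarrow> 0"
    by (rule lim_const_over_n)
  then have "\<bar>h b - h a\<bar> \<le> 0"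
    by (rule tendsto_lowerbound) (auto intro!: eventually_sequentiallyI[of 1] bound)
  then show ?thesis by simp
qed

lemma borel_measurable_antimono_Ioi:
  fixes f :: "real \<Rightarrow> real"
  assumes "antimono_on {0<..} f"
  shows "(\<lambda>x. indicator {0<..} x * f x) \<in> borel_measurable borel"
proof -
  have "mono_on {0<..} (\<lambda>x. - f x)" using assms by (auto simp: monotone_on_def)
  then have "(\<lambda>x. - f x) \<in> borel_measurable (restrict_space borel {0<..})"
    by (rule borel_measurable_mono_on_fnc)
  then have "(\<lambda>x. - (- f x)) \<in> borel_measurable (restrict_space borel {0<..})"
    by (rule borel_measurable_uminus)
  then show ?thesis
    by (subst (asm) borel_measurable_restrict_space_iff) (auto simp: mult.commute)
qed

text \<open>Over \<open>[u, v]\<close> both the integral of \<open>- left_deriv g\<close> and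
  \<open>g u - g v\<close> lie between the two end values of \<open>- left_deriv g\<close> times
  \<open>v - u\<close>. They differ by at most oscillation times length, so
  \<open>eq_if_increments_small\<close> applies.\<close>

lemma nn_integral_left_deriv_Icc:
  fixes g :: "real \<Rightarrow> real"
  assumes convex: "convex_on {0<..} g" and anti: "antimono_on {0<..} g"
    and ab: "0 < a" "a \<le> b"
  shows "(\<integral>\<^sup>+x. ennreal (- left_deriv g x) * indicator {a..b} x \<partial>lborel) = ennreal (g a - g b)"
proof -
  define D where "D x = - left_deriv g x" for x
  have D_anti: "antimono_on {0<..} D"
    using mono_left_deriv[OF convex] by (auto simp: D_def monotone_on_def)
  have D_nonneg: "D x \<ge> 0" if "x > 0" for x
  proof -
    have "left_deriv g x * 1 \<le> g (x + 1) - g x"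
      using left_deriv_bounds(1)[OF convex that, of "x + 1"] by simp
    moreover have "g (x + 1) \<le> g x" using anti that by (auto simp: monotone_on_def)
    ultimately show ?thesis by (simp add: D_def)
  qed
  have int: "D integrable_on {u..v}" if "a \<le> u" "v \<le> b" for u v
  proof -
    have "mono_on {u..v} (\<lambda>x. - D x)" using D_anti that ab by (auto simp: monotone_on_def)
    then have "(\<lambda>x. - (- D x)) integrable_on {u..v}"
      by (intro integrable_neg integrable_on_mono_on)
    then show ?thesis by simp
  qed
  define h where "h v = integral {a..v} D + g v" for v
  have "h a = h b"
  proof (rule eq_if_increments_small[OF ab(2), where D = "\<lambda>x. - D x"])
    fix u v assume uv: "a \<le> u" "u \<le> v" "v \<le> b"
    have split: "integral {a..v} D = integral {a..u} D + integral {u..v} D"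
      using Henstock_Kurzweil_Integration.integral_combine[of a u v D] int uv by simp
    have ge: "integral {u..v} (\<lambda>_. D v) \<le> integral {u..v} D"
      using int[of u v] D_anti uv ab by (intro integral_le) (auto simp: monotone_on_def)
    have le: "integral {u..v} D \<le> integral {u..v} (\<lambda>_. D u)"
      using int[of u v] D_anti uv ab by (intro integral_le) (auto simp: monotone_on_def)
    have "D v * (v - u) \<le> integral {u..v} D" "integral {u..v} D \<le> D u * (v - u)"
      using ge le uv by (simp_all add: mult.commute)
    moreover have "- D u * (v - u) \<le> g v - g u" "g v - g u \<le> - D v * (v - u)"
      using left_deriv_bounds[OF convex, of u v] uv ab by (auto simp: D_def)
    ultimately show "\<bar>h v - h u\<bar> \<le> (- D v - - D u) * (v - u)"
      unfolding h_def split by (auto simp: abs_if algebra_simps)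
  qed
  then have eq: "integral {a..b} D = g a - g b" by (simp add: h_def)
  have meas: "(\<lambda>x. D x * indicator {a..b} x) \<in> borel_measurable borel"
  proof -
    have "(\<lambda>x. indicator {0<..} x * D x) \<in> borel_measurable borel"
      by (rule borel_measurable_antimono_Ioi[OF D_anti])
    then have "(\<lambda>x. (indicator {0<..} x * D x) * indicator {a..b} x) \<in> borel_measurable borel"
      by measurable
    also have "(\<lambda>x. (indicator {0<..} x * D x) * indicator {a..b} x) = (\<lambda>x. D x * indicator {a..b} x)"
      using ab by (auto simp: fun_eq_iff indicator_def)
    finally show ?thesis .
  qed
  have "(D has_integral (g a - g b)) {a..b}"
    using int[of a b] eq by (metis integrable_integral order_refl)
  then have "((\<lambda>x. if x \<in> {a..b} then D x else 0) has_integral (g a - g b)) UNIV"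
    by (simp only: has_integral_restrict_UNIV)
  also have "(\<lambda>x. if x \<in> {a..b} then D x else 0) = (\<lambda>x. D x * indicator {a..b} x)"
    by (auto simp: fun_eq_iff indicator_def)
  finally have "integral\<^sup>N lborel (\<lambda>x. ennreal (D x * indicator {a..b} x)) = ennreal (g a - g b)"
    using D_nonneg ab
    by (intro nn_integral_has_integral_lborel[OF meas]) (auto simp: indicator_def)
  also have "integral\<^sup>N lborel (\<lambda>x. ennreal (D x * indicator {a..b} x))
      = (\<integral>\<^sup>+x. ennreal (D x) * indicator {a..b} x \<partial>lborel)"
    by (intro nn_integral_cong) (auto simp: indicator_def)
  finally show ?thesis by (simp add: D_def)
qed

text \<open>The right limit at \<open>b\<close> is assumed because \<open>b = 0\<close> is allowed,
  where convexity on the open half line gives no continuity.\<close>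

lemma nn_integral_left_deriv_Ioi:
  fixes g :: "real \<Rightarrow> real"
  assumes convex: "convex_on {0<..} g" and anti: "antimono_on {0<..} g"
    and zero: "(g \<longlongrightarrow> 0) at_top" and b: "0 \<le> b" "(g \<longlongrightarrow> g b) (at_right b)"
  shows "(\<integral>\<^sup>+x. ennreal (- left_deriv g x) * indicator {b<..} x \<partial>lborel) = ennreal (g b)"
proof -
  define l where "l n = b + inverse (real (Suc n))" for n
  define r where "r n = l n + real n" for n
  define F where "F n x = ennreal (- left_deriv g x) * indicator {l n..r n} x" for n x
  have l_gt: "l n > b" for n by (simp add: l_def)
  have l_dec: "l n \<le> l m" if "m \<le> n" for m n
    using that by (simp add: l_def le_imp_inverse_le)
  have l_lim: "l \<longlonglongrightarrow> b"
    unfolding l_def using LIMSEQ_inverse_real_of_nat_add by simp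
  have r_ge: "r n \<ge> real n" for n using l_gt[of n] b by (simp add: r_def)
  have r_lim: "filterlim r at_top sequentially"
    by (rule filterlim_at_top_mono[OF filterlim_real_sequentially]) (use r_ge in auto)
  \<comment> \<open>\<open>l\<close> decreases, but by at most 1 in total, and the summand
    \<open>real n\<close> outweighs that.\<close>
  have r_inc: "r m \<le> r n" if "m \<le> n" for m n
  proof (cases "m = n")
    case False
    then have "real m + 1 \<le> real n" using that by linarith
    moreover have "inverse (real (Suc m)) \<le> 1" "inverse (real (Suc n)) \<ge> 0"
      by (simp_all add: inverse_le_1_iff del: of_nat_Suc)
    ultimately show ?thesis unfolding r_def l_def by linarith
  qed simp
  have meas: "F n \<in> borel_measurable lborel" for n
  proof -
    have "antimono_on {0<..} (\<lambda>x. - left_deriv g x)"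
      using mono_left_deriv[OF convex] by (auto simp: monotone_on_def)
    from borel_measurable_antimono_Ioi[OF this]
    have "(\<lambda>x. ennreal (indicator {0<..} x * - left_deriv g x) * indicator {l n..r n} x)
        \<in> borel_measurable lborel" by measurable
    also have "(\<lambda>x. ennreal (indicator {0<..} x * - left_deriv g x) * indicator {l n..r n} x) = F n"
    proof
      fix x show "ennreal (indicator {0<..} x * - left_deriv g x) * indicator {l n..r n} x = F n x"
        using l_gt[of n] b by (cases "x > 0") (auto simp: F_def indicator_def)
    qed
    finally show ?thesis .
  qed
  have inc: "incseq F"
  proof (rule incseq_SucI, rule le_funI)
    fix n x
    show "F n x \<le> F (Suc n) x"
      using l_dec[of n "Suc n"] r_inc[of n "Suc n"] by (auto simp: F_def indicator_def)
  qed
  have sup: "(SUP n. F n x) = ennreal (- left_deriv g x) * indicator {b<..} x" for x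
  proof (cases "x > b")
    case True
    have "\<forall>\<^sub>F n in sequentially. l n < x" using l_lim True by (rule order_tendstoD)
    moreover have "\<forall>\<^sub>F n in sequentially. x \<le> r n"
      using r_lim by (simp add: filterlim_at_top)
    ultimately have "\<forall>\<^sub>F n in sequentially. F n x = ennreal (- left_deriv g x)"
      by eventually_elim (auto simp: F_def)
    then have "(\<lambda>n. F n x) \<longlonglongrightarrow> ennreal (- left_deriv g x)"
      by (rule tendsto_eventually)
    moreover have "(\<lambda>n. F n x) \<longlonglongrightarrow> (SUP n. F n x)"
      using inc by (intro LIMSEQ_SUP) (auto simp: incseq_def le_fun_def)
    ultimately show ?thesis using True LIMSEQ_unique by fastforce
  next
    case False
    then have "F n x = 0" for n using l_gt[of n] by (simp add: F_def)
    then show ?thesis using False by simp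
  qed
  have "(\<integral>\<^sup>+x. ennreal (- left_deriv g x) * indicator {b<..} x \<partial>lborel) = (\<integral>\<^sup>+x. (SUP n. F n x) \<partial>lborel)"
    unfolding sup ..
  also have "\<dots> = (SUP n. integral\<^sup>N lborel (F n))"
    using inc meas by (rule nn_integral_monotone_convergence_SUP)
  also have "\<dots> = (SUP n. ennreal (g (l n) - g (r n)))"
    unfolding F_def using l_gt b
    by (subst nn_integral_left_deriv_Icc[OF convex anti]) (auto simp: r_def intro: le_less_trans)
  also have "\<dots> = ennreal (g b)"
  proof (rule LIMSEQ_unique[OF LIMSEQ_SUP])
    have "(\<lambda>n. g (l n)) \<longlonglongrightarrow> g b"
      using b(2) by (rule filterlim_compose) (use l_lim l_gt in \<open>auto simp: filterlim_at less_imp_neq[THEN not_sym]\<close>)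
    moreover have "(\<lambda>n. g (r n)) \<longlonglongrightarrow> 0" using zero r_lim by (rule filterlim_compose)
    ultimately show "(\<lambda>n. ennreal (g (l n) - g (r n))) \<longlonglongrightarrow> ennreal (g b)"
      by (intro tendsto_ennrealI) (use tendsto_diff in fastforce)
    show "incseq (\<lambda>n. ennreal (g (l n) - g (r n)))"
    proof (rule incseq_SucI, rule ennreal_leI, rule diff_mono)
      fix n
      have pos: "l n > 0" "l (Suc n) > 0" using l_gt[of n] l_gt[of "Suc n"] b by linarith+
      then show "g (l n) \<le> g (l (Suc n))" using anti l_dec[of n "Suc n"] by (auto simp: monotone_on_def)
      have "0 < r n" using pos by (simp add: r_def add_pos_nonneg)
      then show "g (r (Suc n)) \<le> g (r n)"
        using anti r_inc[of n "Suc n"] by (auto simp: monotone_on_def)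
    qed
  qed
  finally show ?thesis .
qed

section \<open>Archimedean generators\<close>

text \<open>For a generator this is \<open>pinv\<close> as a real number on \<open>(0,1]\<close>. At
  0 it is the first zero, or the default 0 if there is none, since \<open>pinv\<close> is then
  infinite.\<close>

definition gen_inv :: "(real \<Rightarrow> real) \<Rightarrow> real \<Rightarrow> real" where
  "gen_inv \<psi> y = real_of_ereal (pinv \<psi> y)"

lemma pinv_nonneg: "0 \<le> pinv \<psi> y"
  unfolding pinv_def by (rule Inf_greatest) simp

context
  fixes \<psi> :: "real \<Rightarrow> real"
  assumes gen: "arch_generator \<psi>"
begin

lemma gen_continuous: "continuous_on {0..} \<psi>"
  and gen_antimono: "antimono_on {0..} \<psi>"
  and gen_0: "\<psi> 0 = 1"
  and gen_lim: "(\<psi> \<longlongrightarrow> 0) at_top"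
  using gen by (auto simp: arch_generator_def)

lemma gen_nonneg: "0 \<le> x \<Longrightarrow> 0 \<le> \<psi> x"
  and gen_le_1: "0 \<le> x \<Longrightarrow> \<psi> x \<le> 1"
  using gen by (auto simp: arch_generator_def)

lemma gen_le: "0 \<le> s \<Longrightarrow> s \<le> t \<Longrightarrow> \<psi> t \<le> \<psi> s"
  using gen_antimono by (auto simp: monotone_on_def)

lemma gen_isCont: "0 < x \<Longrightarrow> isCont \<psi> x"
  using gen_continuous continuous_on_interior[of "{0..}" \<psi> x] by (simp add: interior_Ici[of "- 1"])

text \<open>Strictness is given up to the first zero, an extended real; positivity of
  \<open>\<psi> s\<close> is the form that can be checked. If \<open>\<psi> t\<close> is positive
  too, every zero lies beyond \<open>t\<close>.\<close>

lemma gen_less: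
  assumes "0 \<le> s" "s < t" "0 < \<psi> s"
  shows "\<psi> t < \<psi> s"
proof (cases "\<psi> t = 0")
  case False
  then have pos: "0 < \<psi> t" using gen_nonneg[of t] assms by linarith
  define I where "I = Inf {ereal z | z. 0 \<le> z \<and> \<psi> z = 0}"
  have "ereal t \<le> I"
    unfolding I_def
  proof (rule Inf_greatest, clarsimp)
    fix z assume "0 \<le> z" "\<psi> z = 0"
    then show "t \<le> z" using gen_le[of z t] pos by linarith
  qed
  moreover from this have "ereal s \<le> I" using assms(2) by (meson ereal_less_eq(3) less_imp_le order_trans)
  ultimately show ?thesis
    using gen assms unfolding arch_generator_def I_def[symmetric] by (auto simp: monotone_on_def)
qed (use assms in auto)

lemma gen_inj: "0 \<le> s \<Longrightarrow> 0 \<le> t \<Longrightarrow> 0 < \<psi> s \<Longrightarrow> \<psi> s = \<psi> t \<Longrightarrow> s = t"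
  using gen_less[of s t] gen_less[of t s] by (metis less_irrefl linorder_cases)

lemma pinv_gen:
  assumes "0 \<le> t" "0 < \<psi> t"
  shows "pinv \<psi> (\<psi> t) = ereal t"
proof -
  have "{z. 0 \<le> z \<and> psi_ext \<psi> z = \<psi> t} = {ereal t}"
  proof (intro set_eqI iffI)
    fix z assume "z \<in> {z. 0 \<le> z \<and> psi_ext \<psi> z = \<psi> t}"
    then have z: "0 \<le> z" "psi_ext \<psi> z = \<psi> t" by blast+
    show "z \<in> {ereal t}"
    proof (cases z)
      case (real r)
      then have "0 \<le> r" "\<psi> t = \<psi> r" using z by (simp_all add: psi_ext_def)
      then have "t = r" using gen_inj[of t r] assms by blast
      then show ?thesis using real by simp
    qed (use z assms in \<open>auto simp: psi_ext_def\<close>)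
  qed (use assms in \<open>simp add: psi_ext_def\<close>)
  then show ?thesis unfolding pinv_def by simp
qed

lemma gen_inv_gen [simp]: "0 \<le> t \<Longrightarrow> 0 < \<psi> t \<Longrightarrow> gen_inv \<psi> (\<psi> t) = t"
  by (simp add: gen_inv_def pinv_gen)

lemma gen_surj:
  assumes "0 < y" "y \<le> 1"
  obtains t where "0 \<le> t" "\<psi> t = y"
proof -
  have "\<forall>\<^sub>F x in at_top. \<psi> x < y" using gen_lim assms by (intro order_tendstoD)
  moreover have "\<forall>\<^sub>F x in at_top. (0::real) \<le> x" by (rule eventually_ge_at_top)
  ultimately have "\<forall>\<^sub>F x in at_top. \<psi> x < y \<and> 0 \<le> x" by eventually_elim auto
  then obtain b where b: "\<psi> b < y" "0 \<le> b"
    by (metis (mono_tags, lifting) eventually_happens' trivial_limit_at_top_linorder)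
  have "\<exists>x\<ge>0. x \<le> b \<and> \<psi> x = y"
    using b assms gen_0 by (intro IVT2') (auto intro: continuous_on_subset[OF gen_continuous])
  then show ?thesis using that by blast
qed

context
  fixes y :: real
  assumes y: "0 < y" "y \<le> 1"
begin

lemma gen_gen_inv [simp]: "\<psi> (gen_inv \<psi> y) = y"
  and gen_inv_nonneg [simp]: "0 \<le> gen_inv \<psi> y"
  and pinv_eq: "pinv \<psi> y = ereal (gen_inv \<psi> y)"
proof -
  obtain t where "0 \<le> t" "\<psi> t = y" using gen_surj[OF y] .
  then show "\<psi> (gen_inv \<psi> y) = y" "0 \<le> gen_inv \<psi> y" "pinv \<psi> y = ereal (gen_inv \<psi> y)"
    using gen_inv_gen[of t] pinv_gen[of t] y by auto
qed

lemma gen_inv_le_iff: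
  assumes "0 \<le> t"
  shows "gen_inv \<psi> y \<le> t \<longleftrightarrow> \<psi> t \<le> y"
proof
  assume "gen_inv \<psi> y \<le> t"
  then show "\<psi> t \<le> y" using gen_le[of "gen_inv \<psi> y" t] by simp
next
  assume le: "\<psi> t \<le> y"
  show "gen_inv \<psi> y \<le> t"
  proof (rule ccontr)
    assume *: "\<not> gen_inv \<psi> y \<le> t"
    then have "y \<le> \<psi> t" using gen_le[of t "gen_inv \<psi> y"] assms by simp
    then have "\<psi> t = y" using le by simp
    then show False using gen_less[of t "gen_inv \<psi> y"] * assms y by simp
  qed
qed

lemma gen_inv_less_iff:
  assumes "0 \<le> t"
  shows "gen_inv \<psi> y < t \<longleftrightarrow> \<psi> t < y"
proof
  assume "gen_inv \<psi> y < t"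
  then show "\<psi> t < y" using gen_less[of "gen_inv \<psi> y" t] y by simp
next
  assume less: "\<psi> t < y"
  show "gen_inv \<psi> y < t"
  proof (rule ccontr)
    assume "\<not> gen_inv \<psi> y < t"
    then show False using gen_le[of t "gen_inv \<psi> y"] less assms by simp
  qed
qed

end

lemma gen_inv_1 [simp]: "gen_inv \<psi> 1 = 0"
  using gen_inv_gen[of 0] gen_0 by simp

lemma pinv_1 [simp]: "pinv \<psi> 1 = 0"
  using pinv_eq[of 1] by (simp add: zero_ereal_def)

lemma gen_inv_pos: "0 < y \<Longrightarrow> y < 1 \<Longrightarrow> 0 < gen_inv \<psi> y"
  using gen_inv_le_iff[of y 0] gen_0 by auto

lemma gen_inv_antimono: "0 < y \<Longrightarrow> y \<le> z \<Longrightarrow> z \<le> 1 \<Longrightarrow> gen_inv \<psi> z \<le> gen_inv \<psi> y"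
  by (subst gen_inv_le_iff) auto

text \<open>By continuity the infimum defining \<open>pinv \<psi> 0\<close> is attained when it is
  finite, so the zeros are exactly the points from it on.\<close>

lemma pinv_0_le_iff:
  assumes "0 \<le> t"
  shows "pinv \<psi> 0 \<le> ereal t \<longleftrightarrow> \<psi> t = 0"
proof
  assume "\<psi> t = 0"
  then show "pinv \<psi> 0 \<le> ereal t"
    unfolding pinv_def using assms by (intro Inf_lower) (auto simp: psi_ext_def)
next
  assume le: "pinv \<psi> 0 \<le> ereal t"
  show "\<psi> t = 0"
  proof (rule ccontr)
    assume "\<psi> t \<noteq> 0"
    then have "0 < \<psi> t" using gen_nonneg[OF assms] by simp
    moreover have "\<psi> t \<le> 1" using gen_le_1[OF assms] .
    \<comment> \<open>Half the value is taken at a point strictly beyond \<open>t\<close>;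
      \<open>\<psi>\<close> is still positive there, so this point bounds all zeros from below and
      exceeds \<open>t\<close>.\<close>
    ultimately have half: "0 < \<psi> t / 2" "\<psi> t / 2 \<le> 1" "\<psi> t / 2 < \<psi> t" by auto
    define s where "s = gen_inv \<psi> (\<psi> t / 2)"
    have s: "0 \<le> s" "\<psi> s = \<psi> t / 2" using half by (auto simp: s_def)
    then have "t < s" using gen_le[of s t] half by linarith
    have "ereal s \<le> pinv \<psi> 0"
      unfolding pinv_def
    proof (rule Inf_greatest, clarsimp)
      fix z :: ereal assume z: "0 \<le> z" "psi_ext \<psi> z = 0"
      show "ereal s \<le> z"
      proof (cases z)
        case (real r)
        then have "0 \<le> r" "\<psi> r = 0" using z by (auto simp: psi_ext_def)
        then have "s \<le> r" using gen_le[of r s] s half by linarith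
        then show ?thesis using real by simp
      qed (use z in auto)
    qed
    then show False using le \<open>t < s\<close> by (meson ereal_less_eq(3) leD order_trans)
  qed
qed

lemma psi_ext_nonneg_le_1: "0 \<le> psi_ext \<psi> z" "psi_ext \<psi> z \<le> 1"
  using gen_nonneg gen_le_1 by (cases z; auto simp: psi_ext_def)+

lemma psi_ext_ge_pinv_0:
  assumes "pinv \<psi> 0 \<le> z"
  shows "psi_ext \<psi> z = 0"
proof (cases z)
  case (real r)
  have "0 \<le> z" using pinv_nonneg[of \<psi> 0] assms by (rule order_trans)
  then show ?thesis using pinv_0_le_iff[of r] assms real by (auto simp: psi_ext_def)
qed (use assms pinv_nonneg[of \<psi> 0] in \<open>auto simp: psi_ext_def\<close>)

section \<open>Archimedean copulas and their marginals\<close>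

lemma sum_pinv:
  assumes "\<And>i. i \<in> I \<Longrightarrow> 0 < u i \<and> u i \<le> 1"
  shows "(\<Sum>i\<in>I. pinv \<psi> (u i)) = ereal (\<Sum>i\<in>I. gen_inv \<psi> (u i))"
  using assms by (simp add: pinv_eq)

lemma arch_copula_pos:
  assumes "\<And>i. i < d \<Longrightarrow> 0 < u i \<and> u i \<le> 1"
  shows "arch_copula d \<psi> u = \<psi> (\<Sum>i<d. gen_inv \<psi> (u i))"
proof -
  have "0 \<le> (\<Sum>i<d. gen_inv \<psi> (u i))" using assms by (intro sum_nonneg) auto
  then show ?thesis
    unfolding arch_copula_def using assms by (subst sum_pinv) (auto simp: psi_ext_def)
qed

lemma arch_copula_zero:
  assumes "i < d" "u i = 0"
  shows "arch_copula d \<psi> u = 0"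
proof -
  have "pinv \<psi> (u i) \<le> (\<Sum>i<d. pinv \<psi> (u i))"
    using sum_mono2[of "{..<d}" "{i}" "\<lambda>i. pinv \<psi> (u i)"] assms by (simp add: pinv_nonneg)
  then show ?thesis
    unfolding arch_copula_def using assms by (intro psi_ext_ge_pinv_0) simp
qed

lemma arch_copula_nonneg: "0 \<le> arch_copula d \<psi> u"
  unfolding arch_copula_def by (rule psi_ext_nonneg_le_1)

text \<open>The upper Frechet bound. It controls the copulas near the lower faces of the cube, where
  the inverses may be unbounded.\<close>

lemma arch_copula_le:
  assumes "i < d" "\<And>i. i < d \<Longrightarrow> 0 \<le> u i \<and> u i \<le> 1"
  shows "arch_copula d \<psi> u \<le> u i"
proof (cases "\<exists>j<d. u j = 0")
  case True
  then show ?thesis using arch_copula_zero assms by force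
next
  case False
  then have pos: "0 < u j \<and> u j \<le> 1" if "j < d" for j using assms(2) that by fastforce
  have "gen_inv \<psi> (u i) \<le> (\<Sum>i<d. gen_inv \<psi> (u i))"
    using assms(1) pos by (intro member_le_sum) auto
  then have "\<psi> (\<Sum>i<d. gen_inv \<psi> (u i)) \<le> \<psi> (gen_inv \<psi> (u i))"
    using pos assms(1) by (intro gen_le) auto
  then show ?thesis using pos assms(1) by (simp add: arch_copula_pos)
qed

lemma marg_arch_copula:
  assumes "m \<le> d"
  shows "marg (arch_copula d \<psi>) m x = arch_copula m \<psi> x"
proof -
  have "(\<Sum>i<d. pinv \<psi> (if i < m then x i else 1)) = (\<Sum>i<m. pinv \<psi> (x i))"
    using assms by (intro sum.mono_neutral_cong_right) auto
  then show ?thesis by (simp add: marg_def arch_copula_def)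
qed

lemma marg2_arch_copula:
  assumes "i < d" "j < d" "i \<noteq> j"
  shows "marg2 (arch_copula d \<psi>) i j p = psi_ext \<psi> (pinv \<psi> (fst p) + pinv \<psi> (snd p))"
proof -
  have "(\<Sum>k<d. pinv \<psi> (if k = i then fst p else if k = j then snd p else 1))
      = (\<Sum>k\<in>{i,j}. pinv \<psi> (if k = i then fst p else if k = j then snd p else 1))"
    using assms by (intro sum.mono_neutral_right) auto
  also have "\<dots> = pinv \<psi> (fst p) + pinv \<psi> (snd p)" using assms by auto
  finally show ?thesis by (simp add: marg2_def arch_copula_def)
qed

end

text \<open>The levels \<open>ys n\<close> may move as well, so that the constant sequence
  \<open>\<psi>s n = \<psi>\<close> gives continuity of the inverse.\<close>

lemma tendsto_gen_inv:
  assumes gen: "arch_generator \<psi>" "\<And>n. arch_generator (\<psi>s n)"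
    and lim: "\<And>x. 0 \<le> x \<Longrightarrow> (\<lambda>n. \<psi>s n x) \<longlonglongrightarrow> \<psi> x"
    and y: "0 < y" "y \<le> 1" and ys: "ys \<longlonglongrightarrow> y" "\<And>n. 0 < ys n" "\<And>n. ys n \<le> 1"
  shows "(\<lambda>n. gen_inv (\<psi>s n) (ys n)) \<longlonglongrightarrow> gen_inv \<psi> y"
proof (rule order_tendstoI)
  fix a assume a: "a < gen_inv \<psi> y"
  show "\<forall>\<^sub>F n in sequentially. a < gen_inv (\<psi>s n) (ys n)"
  proof (cases "a < 0")
    case True
    then show ?thesis using gen_inv_nonneg[OF gen(2) ys(2,3)] by (intro always_eventually) (auto intro: less_le_trans)
  next
    case False
    then have "0 < \<psi> a - y" using a gen_inv_le_iff[OF gen(1) y, of a] by simp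
    moreover have "(\<lambda>n. \<psi>s n a - ys n) \<longlonglongrightarrow> \<psi> a - y" using False lim ys by (intro tendsto_diff) auto
    ultimately have "\<forall>\<^sub>F n in sequentially. 0 < \<psi>s n a - ys n" by (metis order_tendstoD(1))
    then show ?thesis
      by eventually_elim (use gen_inv_le_iff[OF gen(2) ys(2,3)] False in \<open>simp add: not_le[symmetric]\<close>)
  qed
next
  fix a assume a: "gen_inv \<psi> y < a"
  then have "0 \<le> a" using gen_inv_nonneg[OF gen(1) y] by linarith
  then have "\<psi> a - y < 0" using a gen_inv_less_iff[OF gen(1) y] by simp
  moreover have "(\<lambda>n. \<psi>s n a - ys n) \<longlonglongrightarrow> \<psi> a - y" using \<open>0 \<le> a\<close> lim ys by (intro tendsto_diff) auto
  ultimately have "\<forall>\<^sub>F n in sequentially. \<psi>s n a - ys n < 0" by (metis order_tendstoD(2))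
  then show "\<forall>\<^sub>F n in sequentially. gen_inv (\<psi>s n) (ys n) < a"
    by eventually_elim (use gen_inv_less_iff[OF gen(2) ys(2,3)] \<open>0 \<le> a\<close> in simp)
qed

lemma continuous_gen_inv:
  assumes "arch_generator \<psi>"
  shows "continuous_on {0<..1} (gen_inv \<psi>)"
  unfolding continuous_on_sequentially comp_def
  using assms by (auto intro!: tendsto_gen_inv)

section \<open>Convergence of copulas and of generators\<close>

lemma arch_copula_restrict: "arch_copula d \<psi> (restrict u {..<d}) = arch_copula d \<psi> u"
  unfolding arch_copula_def by simp

lemma uniform_limit_marg2:
  assumes lim: "uniform_limit (cube d) (\<lambda>n. arch_copula d (\<psi>s n)) (arch_copula d \<psi>) sequentially"
  shows "uniform_limit ({0..1} \<times> {0..1}) (\<lambda>n. marg2 (arch_copula d (\<psi>s n)) i j)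
    (marg2 (arch_copula d \<psi>) i j) sequentially"
proof (rule uniform_limitI)
  fix e :: real assume "e > 0"
  \<comment> \<open>\<open>cube d\<close> consists of extensional functions, hence the restriction;
    the copula ignores coordinates outside \<open>{..<d}\<close>.\<close>
  define E where "E p = restrict (\<lambda>k. if k = i then fst p else if k = j then snd p else 1) {..<d}"
    for p :: "real \<times> real"
  have E: "E p \<in> cube d" if "p \<in> {0..1} \<times> {0..1}" for p
    using that by (auto simp: E_def cube_def)
  have eq: "marg2 (arch_copula d \<phi>) i j p = arch_copula d \<phi> (E p)" for \<phi> p
    unfolding marg2_def E_def arch_copula_restrict ..
  have "\<forall>\<^sub>F n in sequentially. \<forall>u\<in>cube d. dist (arch_copula d (\<psi>s n) u) (arch_copula d \<psi> u) < e"
    using lim \<open>e > 0\<close> by (rule uniform_limitD)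
  then show "\<forall>\<^sub>F n in sequentially. \<forall>p\<in>{0..1} \<times> {0..1}.
      dist (marg2 (arch_copula d (\<psi>s n)) i j p) (marg2 (arch_copula d \<psi>) i j p) < e"
    unfolding eq by eventually_elim (use E in blast)
qed

context
  fixes \<psi> :: "real \<Rightarrow> real" and \<psi>s :: "nat \<Rightarrow> real \<Rightarrow> real"
  assumes gen: "arch_generator \<psi>" and gens: "\<And>n. arch_generator (\<psi>s n)"
begin

lemma gen_uniform_limit_iff:
  "uniform_limit {0..} \<psi>s \<psi> sequentially \<longleftrightarrow> (\<forall>x\<ge>0. (\<lambda>n. \<psi>s n x) \<longlonglongrightarrow> \<psi> x)"
proof
  assume "\<forall>x\<ge>0. (\<lambda>n. \<psi>s n x) \<longlonglongrightarrow> \<psi> x"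
  then show "uniform_limit {0..} \<psi>s \<psi> sequentially"
    using gen_antimono[OF gens] gen_antimono[OF gen] gen_nonneg[OF gens] gen_nonneg[OF gen]
      gen_continuous[OF gen] gen_lim[OF gen]
    by (intro uniform_limit_antimono_atLeast) auto
qed (auto intro: tendsto_uniform_limitI)

lemma gen_tendsto_iff_pinv:
  "(\<forall>x\<ge>0. (\<lambda>n. \<psi>s n x) \<longlonglongrightarrow> \<psi> x) \<longleftrightarrow> (\<forall>y\<in>{0<..1}. (\<lambda>n. pinv (\<psi>s n) y) \<longlonglongrightarrow> pinv \<psi> y)"
proof -
  have "(\<lambda>n. pinv (\<psi>s n) y) \<longlonglongrightarrow> pinv \<psi> y \<longleftrightarrow> (\<lambda>n. gen_inv (\<psi>s n) y) \<longlonglongrightarrow> gen_inv \<psi> y"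
    if "y \<in> {0<..1}" for y
    using that by (simp add: pinv_eq[OF gen] pinv_eq[OF gens])
  moreover have "(\<lambda>n. gen_inv (\<psi>s n) y) \<longlonglongrightarrow> gen_inv \<psi> y"
    if "\<forall>x\<ge>0. (\<lambda>n. \<psi>s n x) \<longlonglongrightarrow> \<psi> x" "y \<in> {0<..1}" for y
    using that by (intro tendsto_gen_inv[OF gen gens]) auto
  moreover have "(\<lambda>n. \<psi>s n x) \<longlonglongrightarrow> \<psi> x"
    if lim: "\<And>y. y \<in> {0<..1} \<Longrightarrow> (\<lambda>n. gen_inv (\<psi>s n) y) \<longlonglongrightarrow> gen_inv \<psi> y" and x: "x \<ge> 0" for x
  proof (rule order_tendstoI)
    fix a assume a: "a < \<psi> x"
    show "\<forall>\<^sub>F n in sequentially. a < \<psi>s n x"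
    proof (cases "a < 0")
      case True
      then show ?thesis using gen_nonneg[OF gens x] by (intro always_eventually allI) (rule less_le_trans)
    next
      case False
      \<comment> \<open>A level strictly between \<open>a\<close> and \<open>\<psi> x\<close> turns
        the claim into a comparison of \<open>x\<close> with the inverses of that level, which
        converge.\<close>
      define y where "y = (a + \<psi> x) / 2"
      have y: "0 < y" "y \<le> 1" "a < y" "y < \<psi> x"
        using a False gen_le_1[OF gen x] by (auto simp: y_def)
      then have "x < gen_inv \<psi> y" using gen_inv_le_iff[OF gen y(1,2) x] by simp
      with lim[of y] y have "\<forall>\<^sub>F n in sequentially. x < gen_inv (\<psi>s n) y"
        by (auto intro: order_tendstoD)
      then show ?thesis
      proof eventually_elim
        case (elim n)
        then show ?case using gen_inv_le_iff[OF gens y(1,2) x, of n] y by linarith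
      qed
    qed
  next
    fix a assume a: "\<psi> x < a"
    \<comment> \<open>The cap keeps the level in \<open>(0,1]\<close>. For
      \<open>\<psi> x = 1\<close> there is no such level above \<open>\<psi> x\<close>, but then
      \<open>\<psi>s n x \<le> 1 < a\<close>.\<close>
    define y where "y = min ((a + \<psi> x) / 2) 1"
    show "\<forall>\<^sub>F n in sequentially. \<psi>s n x < a"
    proof (cases "\<psi> x = 1")
      case True
      then show ?thesis
        using gen_le_1[OF gens x] a by (intro always_eventually allI) (rule le_less_trans, auto)
    next
      case False
      then have y: "0 < y" "y \<le> 1" "\<psi> x < y" "y < a"
        using a gen_le_1[OF gen x] gen_nonneg[OF gen x] by (auto simp: y_def min_def)
      then have "gen_inv \<psi> y < x" using gen_inv_less_iff[OF gen y(1,2) x] by simp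
      with lim[of y] y have "\<forall>\<^sub>F n in sequentially. gen_inv (\<psi>s n) y < x"
        by (auto intro: order_tendstoD)
      then show ?thesis
      proof eventually_elim
        case (elim n)
        then show ?case using gen_inv_less_iff[OF gens y(1,2) x, of n] y by linarith
      qed
    qed
  qed
  ultimately show ?thesis by blast
qed

text \<open>Uniform convergence of the inverses is available on \<open>[r,1]\<close>, not up to 0.
  If a coordinate falls below \<open>r\<close>, both copulas are below \<open>r < e\<close> by
  \<open>arch_copula_le\<close>; otherwise the sums of inverses stay in a compact interval, on which
  \<open>\<psi>\<close> is uniformly continuous.\<close>

lemma uniform_limit_arch_copula:
  assumes lim: "\<And>x. 0 \<le> x \<Longrightarrow> (\<lambda>n. \<psi>s n x) \<longlonglongrightarrow> \<psi> x"
  shows "uniform_limit (cube d) (\<lambda>n. arch_copula d (\<psi>s n)) (arch_copula d \<psi>) sequentially"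
proof (rule uniform_limitI)
  fix e :: real assume "e > 0"
  define r where "r = min (e/2) 1"
  have r: "0 < r" "r \<le> 1" "r < e" using \<open>e > 0\<close> by (auto simp: r_def min_def)
  have inv_le: "gen_inv \<psi> y \<le> gen_inv \<psi> r" if "y \<in> {r..1}" for y
    using that r by (intro gen_inv_antimono[OF gen]) auto
  \<comment> \<open>Sums of \<open>d\<close> inverses at levels in \<open>[r,1]\<close> are at most
    \<open>M - 1\<close>; the extra 1 leaves room for the perturbed sum.\<close>
  define M where "M = real d * gen_inv \<psi> r + 1"
  have M: "1 \<le> M" using gen_inv_nonneg[OF gen r(1,2)] by (simp add: M_def)
  have "uniformly_continuous_on {0..M} \<psi>"
    using continuous_on_subset[OF gen_continuous[OF gen], of "{0..M}"]
    by (auto intro: compact_uniformly_continuous)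
  then obtain q where "q > 0"
    and q: "\<And>x y. x \<in> {0..M} \<Longrightarrow> y \<in> {0..M} \<Longrightarrow> dist y x < q \<Longrightarrow> dist (\<psi> y) (\<psi> x) < e/2"
    unfolding uniformly_continuous_on_def using \<open>e > 0\<close> half_gt_zero by metis
  \<comment> \<open>\<open>d\<close> errors of size \<open>h\<close> add up to less than
    \<open>q\<close> and less than 1.\<close>
  define h where "h = min q 1 / (real d + 1)"
  have h: "h > 0" "real d * h < q" "real d * h < 1"
  proof -
    show "h > 0" using \<open>q > 0\<close> by (simp add: h_def)
    moreover have "h * (real d + 1) = min q 1" by (simp add: h_def)
    ultimately show "real d * h < q" "real d * h < 1" by (auto simp: algebra_simps)
  qed
  have "uniform_limit {r..1} (\<lambda>n. gen_inv (\<psi>s n)) (gen_inv \<psi>) sequentially"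
  proof (rule uniform_limit_antimono_Icc)
    show "antimono_on {r..1} (gen_inv (\<psi>s n))" for n
      using gen_inv_antimono[OF gens] r by (auto simp: monotone_on_def)
    show "continuous_on {r..1} (gen_inv \<psi>)"
      using r by (intro continuous_on_subset[OF continuous_gen_inv[OF gen]]) auto
    show "(\<lambda>n. gen_inv (\<psi>s n) x) \<longlonglongrightarrow> gen_inv \<psi> x" if "x \<in> {r..1}" for x
      using that r by (intro tendsto_gen_inv[OF gen gens] lim) auto
  qed
  then have "\<forall>\<^sub>F n in sequentially. \<forall>y\<in>{r..1}. dist (gen_inv (\<psi>s n) y) (gen_inv \<psi> y) < h"
    using h(1) by (rule uniform_limitD)
  moreover have "uniform_limit {0..} \<psi>s \<psi> sequentially" using lim gen_uniform_limit_iff by blast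
  then have "\<forall>\<^sub>F n in sequentially. \<forall>x\<in>{0..}. dist (\<psi>s n x) (\<psi> x) < e/2"
    using \<open>e > 0\<close> by (intro uniform_limitD) auto
  ultimately show "\<forall>\<^sub>F n in sequentially. \<forall>u\<in>cube d.
      dist (arch_copula d (\<psi>s n) u) (arch_copula d \<psi> u) < e"
  proof eventually_elim
    case (elim n)
    show ?case
    proof
      fix u assume "u \<in> cube d"
      then have u: "0 \<le> u i \<and> u i \<le> 1" if "i < d" for i
        using that by (auto simp: cube_def PiE_iff)
      show "dist (arch_copula d (\<psi>s n) u) (arch_copula d \<psi> u) < e"
      proof (cases "\<exists>i<d. u i < r")
        case True
        then obtain i where i: "i < d" "u i < r" by blast
        have "arch_copula d (\<psi>s n) u \<le> u i" "arch_copula d \<psi> u \<le> u i"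
          using arch_copula_le[OF gens i(1), of u] arch_copula_le[OF gen i(1), of u] u by auto
        moreover have "0 \<le> arch_copula d (\<psi>s n) u" "0 \<le> arch_copula d \<psi> u"
          using arch_copula_nonneg[OF gens] arch_copula_nonneg[OF gen] by auto
        ultimately show ?thesis using i r by (auto simp: dist_real_def abs_if)
      next
        case False
        then have ur: "u i \<in> {r..1}" if "i < d" for i using u that by force
        then have up: "0 < u i \<and> u i \<le> 1" if "i < d" for i using that r by force
        define S where "S = (\<Sum>i<d. gen_inv \<psi> (u i))"
        define Sn where "Sn = (\<Sum>i<d. gen_inv (\<psi>s n) (u i))"
        have S0: "0 \<le> S" "0 \<le> Sn"
          using up gen_inv_nonneg[OF gen] gen_inv_nonneg[OF gens] by (auto simp: S_def Sn_def intro!: sum_nonneg)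
        have "S \<le> (\<Sum>i<d. gen_inv \<psi> r)"
          unfolding S_def using ur inv_le by (intro sum_mono) auto
        then have S1: "S \<le> M - 1" by (simp add: M_def)
        have "\<bar>Sn - S\<bar> \<le> (\<Sum>i<d. \<bar>gen_inv (\<psi>s n) (u i) - gen_inv \<psi> (u i)\<bar>)"
          unfolding S_def Sn_def sum_subtractf[symmetric] by (rule sum_abs)
        also have "\<dots> \<le> (\<Sum>i<d. h)"
          using elim(1) ur by (intro sum_mono) (force simp: dist_real_def)
        finally have dS: "\<bar>Sn - S\<bar> \<le> real d * h" by simp
        then have "dist (\<psi> Sn) (\<psi> S) < e/2"
          using S0 S1 h by (intro q) (auto simp: dist_real_def)
        moreover have "dist (\<psi>s n Sn) (\<psi> Sn) < e/2" using elim(2) S0 by auto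
        ultimately have "dist (\<psi>s n Sn) (\<psi> S) < e"
          using dist_triangle_half_r[of "\<psi> Sn" "\<psi>s n Sn" e "\<psi> S"] by (simp add: dist_commute)
        then show ?thesis
          unfolding S_def Sn_def using up by (simp add: arch_copula_pos[OF gen] arch_copula_pos[OF gens])
      qed
    qed
  qed
qed

section \<open>Recovering the generator from bivariate marginals\<close>

context
  assumes half: "\<psi> 1 = 1/2" "\<And>n. \<psi>s n 1 = 1/2"
    and biv: "\<And>x y. x \<in> {0<..1} \<Longrightarrow> y \<in> {0<..1} \<Longrightarrow>
      (\<lambda>n. \<psi>s n (gen_inv (\<psi>s n) x + gen_inv (\<psi>s n) y)) \<longlonglongrightarrow> \<psi> (gen_inv \<psi> x + gen_inv \<psi> y)"
begin

lemma biv_gen: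
  assumes "0 \<le> s" "0 < \<psi> s" "0 \<le> t" "0 < \<psi> t"
  shows "(\<lambda>n. \<psi>s n (gen_inv (\<psi>s n) (\<psi> s) + gen_inv (\<psi>s n) (\<psi> t))) \<longlonglongrightarrow> \<psi> (s + t)"
  using biv[of "\<psi> s" "\<psi> t"] assms gen_le_1[OF gen] by (simp add: gen_inv_gen[OF gen])

lemma obtain_gen_less_left:
  assumes s: "0 < s" and a: "\<psi> s < a"
  obtains s' where "0 < s'" "s' < s" "\<psi> s' < a"
proof -
  have "\<forall>\<^sub>F x in at s. \<psi> x < a"
    using gen_isCont[OF gen s] a unfolding isCont_def by (rule order_tendstoD)
  then have "\<forall>\<^sub>F x in at_left s. \<psi> x < a" by (simp add: eventually_at_split)
  moreover have "\<forall>\<^sub>F x in at_left s. 0 < x \<and> x < s"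
    unfolding eventually_at_left_field using s by blast
  ultimately have "\<forall>\<^sub>F x in at_left s. \<psi> x < a \<and> 0 < x \<and> x < s" by eventually_elim auto
  then show ?thesis using that
    by (metis (mono_tags, lifting) eventually_happens' trivial_limit_at_left_real)
qed

lemma obtain_gen_greater_right:
  assumes s: "0 < s" and a: "a < \<psi> s"
  obtains s' where "s < s'" "a < \<psi> s'"
proof -
  have "\<forall>\<^sub>F x in at s. a < \<psi> x"
    using gen_isCont[OF gen s] a unfolding isCont_def by (rule order_tendstoD)
  then have "\<forall>\<^sub>F x in at_right s. a < \<psi> x" by (simp add: eventually_at_split)
  moreover have "\<forall>\<^sub>F x in at_right s. s < x" by (simp add: eventually_at_right_less)
  ultimately have "\<forall>\<^sub>F x in at_right s. a < \<psi> x \<and> s < x" by eventually_elim auto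
  then show ?thesis using that
    by (metis (mono_tags, lifting) eventually_happens' trivial_limit_at_right_real)
qed

text \<open>A strict gap between \<open>s'\<close> and \<open>s\<close> survives the passage to the
  \<open>n\<close>-th inverse. With the mirror image below, this brackets a fixed point by
  inverses.\<close>

lemma eventually_gen_inv_less:
  assumes s: "0 \<le> s'" "s' < s" "0 < \<psi> s'" and lim: "(\<lambda>n. \<psi>s n s) \<longlonglongrightarrow> \<psi> s"
  shows "\<forall>\<^sub>F n in sequentially. gen_inv (\<psi>s n) (\<psi> s') < s"
proof -
  have "\<psi> s < \<psi> s'" using gen_less[OF gen s] .
  with lim have "\<forall>\<^sub>F n in sequentially. \<psi>s n s < \<psi> s'" by (rule order_tendstoD)
  then show ?thesis
    by eventually_elim (use gen_inv_less_iff[OF gens s(3) gen_le_1[OF gen s(1)]] s in simp)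
qed

lemma eventually_less_gen_inv:
  assumes s: "0 \<le> s" "s < s'" "0 < \<psi> s'" and lim: "(\<lambda>n. \<psi>s n s) \<longlonglongrightarrow> \<psi> s"
  shows "\<forall>\<^sub>F n in sequentially. s < gen_inv (\<psi>s n) (\<psi> s')"
proof -
  have pos: "0 < \<psi> s" using gen_le[OF gen, of s s'] s by linarith
  have "\<psi> s' < \<psi> s" using gen_less[OF gen s(1,2) pos] .
  with lim have "\<forall>\<^sub>F n in sequentially. \<psi> s' < \<psi>s n s" by (rule order_tendstoD)
  moreover have "\<psi> s' \<le> 1" using gen_le_1[OF gen, of s'] s by simp
  ultimately show ?thesis
    by (elim eventually_mono) (use gen_inv_le_iff[OF gens s(3)] s in \<open>simp add: not_le[symmetric]\<close>)
qed

text \<open>The bivariate limit concerns sums of \<open>n\<close>-th inverses and not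
  \<open>s + t\<close>. Shifting both points by \<open>h\<close> puts the inverses on a definite
  side of \<open>s\<close> and \<open>t\<close>, and monotonicity of \<open>\<psi>s n\<close>
  compares the two values.\<close>

lemma gen_tendsto_add:
  assumes s: "0 < s" "(\<lambda>n. \<psi>s n s) \<longlonglongrightarrow> \<psi> s" and t: "0 < t" "(\<lambda>n. \<psi>s n t) \<longlonglongrightarrow> \<psi> t"
  shows "(\<lambda>n. \<psi>s n (s + t)) \<longlonglongrightarrow> \<psi> (s + t)"
proof (rule order_tendstoI)
  fix a assume a: "a < \<psi> (s + t)"
  show "\<forall>\<^sub>F n in sequentially. a < \<psi>s n (s + t)"
  proof (cases "a < 0")
    case True
    then show ?thesis
      using gen_nonneg[OF gens, of "s + t"] s t by (intro always_eventually allI) (rule less_le_trans, auto)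
  next
    case False
    obtain z where z: "s + t < z" "a < \<psi> z"
      using obtain_gen_greater_right[of "s + t" a] s t a by auto
    define h where "h = (z - (s + t)) / 2"
    have h: "0 < h" "(s + h) + (t + h) = z" using z by (auto simp: h_def field_simps)
    have "\<psi> z \<le> \<psi> (s + h)" "\<psi> z \<le> \<psi> (t + h)" using s t h by (auto intro!: gen_le[OF gen])
    then have pos: "0 < \<psi> (s + h)" "0 < \<psi> (t + h)" using z False by auto
    have "\<forall>\<^sub>F n in sequentially. a < \<psi>s n (gen_inv (\<psi>s n) (\<psi> (s + h)) + gen_inv (\<psi>s n) (\<psi> (t + h)))"
      using biv_gen[of "s + h" "t + h"] pos s t h z by (auto intro: order_tendstoD)
    moreover have "\<forall>\<^sub>F n in sequentially. s < gen_inv (\<psi>s n) (\<psi> (s + h))"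
      using s h pos by (intro eventually_less_gen_inv) auto
    moreover have "\<forall>\<^sub>F n in sequentially. t < gen_inv (\<psi>s n) (\<psi> (t + h))"
      using t h pos by (intro eventually_less_gen_inv) auto
    ultimately show ?thesis
    proof eventually_elim
      case (elim n)
      then show ?case
        using gen_le[OF gens, of "s + t" "gen_inv (\<psi>s n) (\<psi> (s + h)) + gen_inv (\<psi>s n) (\<psi> (t + h))" n] s t
        by linarith
    qed
  qed
next
  fix a assume a: "\<psi> (s + t) < a"
  show "\<forall>\<^sub>F n in sequentially. \<psi>s n (s + t) < a"
  proof (cases "\<psi> s < a \<or> \<psi> t < a")
    case True
    then have "(\<forall>\<^sub>F n in sequentially. \<psi>s n s < a) \<or> (\<forall>\<^sub>F n in sequentially. \<psi>s n t < a)"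
      using s t by (auto intro: order_tendstoD)
    moreover have "\<psi>s n (s + t) \<le> \<psi>s n s" "\<psi>s n (s + t) \<le> \<psi>s n t" for n
      using s t by (auto intro!: gen_le[OF gens])
    ultimately show ?thesis by (auto elim!: eventually_mono intro: le_less_trans)
  next
    case False
    obtain z where z: "0 < z" "z < s + t" "\<psi> z < a"
      using obtain_gen_less_left[of "s + t" a] s t a by auto
    \<comment> \<open>The entries \<open>s\<close> and \<open>t\<close> keep \<open>s - h\<close>
      and \<open>t - h\<close> nonnegative.\<close>
    define h where "h = Min {(s + t - z) / 2, s, t}"
    have h: "0 < h" "h \<le> s" "h \<le> t" "z \<le> (s - h) + (t - h)" using z s t by (auto simp: h_def min_def field_simps)
    have less: "\<psi> ((s - h) + (t - h)) < a" using gen_le[OF gen, of z "(s - h) + (t - h)"] z h by linarith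
    \<comment> \<open>In this case \<open>\<psi> s\<close> and \<open>\<psi> t\<close> are at least
      \<open>a\<close>, which exceeds \<open>\<psi> z \<ge> 0\<close>; hence both shifted levels are
      positive and can be inverted.\<close>
    have "\<psi> s \<le> \<psi> (s - h)" "\<psi> t \<le> \<psi> (t - h)" using h by (auto intro!: gen_le[OF gen])
    moreover have "0 \<le> \<psi> z" using z by (intro gen_nonneg[OF gen]) auto
    ultimately have pos: "0 < \<psi> (s - h)" "0 < \<psi> (t - h)" using False z by linarith+
    have "\<forall>\<^sub>F n in sequentially. \<psi>s n (gen_inv (\<psi>s n) (\<psi> (s - h)) + gen_inv (\<psi>s n) (\<psi> (t - h))) < a"
      using biv_gen[of "s - h" "t - h"] pos h less by (auto intro: order_tendstoD)
    moreover have "\<forall>\<^sub>F n in sequentially. gen_inv (\<psi>s n) (\<psi> (s - h)) < s"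
      using s h pos by (intro eventually_gen_inv_less) auto
    moreover have "\<forall>\<^sub>F n in sequentially. gen_inv (\<psi>s n) (\<psi> (t - h)) < t"
      using t h pos by (intro eventually_gen_inv_less) auto
    ultimately show ?thesis
    proof eventually_elim
      case (elim n)
      have "0 \<le> gen_inv (\<psi>s n) (\<psi> (s - h))" "0 \<le> gen_inv (\<psi>s n) (\<psi> (t - h))"
        using pos h gen_le_1[OF gen] by (auto intro!: gen_inv_nonneg[OF gens])
      then show ?case
        using gen_le[OF gens, of "gen_inv (\<psi>s n) (\<psi> (s - h)) + gen_inv (\<psi>s n) (\<psi> (t - h))" "s + t" n] elim
        by linarith
    qed
  qed
qed

text \<open>For \<open>s < z\<close> the inequality \<open>\<psi> (2 * z) < \<psi> (2 * s)\<close>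
  is strict because \<open>\<psi> (2 * s)\<close> is positive. So twice the \<open>n\<close>-th
  inverse of the level \<open>\<psi> z\<close> eventually exceeds \<open>2 * s\<close>, and halving
  gives \<open>\<psi> z \<le> \<psi>s n s\<close>. The other side is symmetric.\<close>

lemma gen_tendsto_half:
  assumes s: "0 < s" "0 < \<psi> (2 * s)" "(\<lambda>n. \<psi>s n (2 * s)) \<longlonglongrightarrow> \<psi> (2 * s)"
  shows "(\<lambda>n. \<psi>s n s) \<longlonglongrightarrow> \<psi> s"
proof (rule order_tendstoI)
  have pos: "0 < \<psi> s" using gen_le[OF gen, of s "2 * s"] s by linarith
  fix a assume "a < \<psi> s"
  then obtain z where z: "s < z" "max a 0 < \<psi> z"
    using obtain_gen_greater_right[of s "max a 0"] s pos by auto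
  have "\<psi> (2 * z) < \<psi> (2 * s)" using gen_less[OF gen, of "2 * s" "2 * z"] s z by auto
  moreover have "(\<lambda>n. \<psi>s n (2 * s) - \<psi>s n (gen_inv (\<psi>s n) (\<psi> z) + gen_inv (\<psi>s n) (\<psi> z)))
      \<longlonglongrightarrow> \<psi> (2 * s) - \<psi> (z + z)"
    using s z by (intro tendsto_diff biv_gen) auto
  ultimately have "\<forall>\<^sub>F n in sequentially.
      0 < \<psi>s n (2 * s) - \<psi>s n (gen_inv (\<psi>s n) (\<psi> z) + gen_inv (\<psi>s n) (\<psi> z))"
    by (intro order_tendstoD(1)) auto
  then show "\<forall>\<^sub>F n in sequentially. a < \<psi>s n s"
  proof eventually_elim
    case (elim n)
    have z1: "0 < \<psi> z" "\<psi> z \<le> 1" using z s gen_le_1[OF gen, of z] by auto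
    have "0 \<le> gen_inv (\<psi>s n) (\<psi> z)" using z1 by (rule gen_inv_nonneg[OF gens])
    then have "s < gen_inv (\<psi>s n) (\<psi> z)"
      using gen_le[OF gens, of "gen_inv (\<psi>s n) (\<psi> z) + gen_inv (\<psi>s n) (\<psi> z)" "2 * s" n] elim by force
    then show ?case using gen_inv_less_iff[OF gens z1, of s n] z s by auto
  qed
next
  fix a assume "\<psi> s < a"
  then obtain z where z: "0 < z" "z < s" "\<psi> z < a"
    using obtain_gen_less_left[of s a] s by auto
  have z1: "0 < \<psi> (2 * z)" "0 < \<psi> z" "\<psi> z \<le> 1"
    using gen_le[OF gen, of "2 * z" "2 * s"] gen_le[OF gen, of z "2 * s"] gen_le_1[OF gen, of z] s z by auto
  have "\<psi> (2 * s) < \<psi> (2 * z)" using gen_less[OF gen, of "2 * z" "2 * s"] z1 z by auto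
  moreover have "(\<lambda>n. \<psi>s n (2 * s) - \<psi>s n (gen_inv (\<psi>s n) (\<psi> z) + gen_inv (\<psi>s n) (\<psi> z)))
      \<longlonglongrightarrow> \<psi> (2 * s) - \<psi> (z + z)"
    using s z z1 by (intro tendsto_diff biv_gen) auto
  ultimately have "\<forall>\<^sub>F n in sequentially.
      \<psi>s n (2 * s) - \<psi>s n (gen_inv (\<psi>s n) (\<psi> z) + gen_inv (\<psi>s n) (\<psi> z)) < 0"
    by (intro order_tendstoD(2)) auto
  then show "\<forall>\<^sub>F n in sequentially. \<psi>s n s < a"
  proof eventually_elim
    case (elim n)
    have "gen_inv (\<psi>s n) (\<psi> z) \<le> s"
      using gen_le[OF gens, of "2 * s" "gen_inv (\<psi>s n) (\<psi> z) + gen_inv (\<psi>s n) (\<psi> z)" n] elim s by force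
    then show ?case using gen_inv_le_iff[OF gens z1(2,3), of s n] z s by auto
  qed
qed

lemma gen_tendsto_dyadic:
  "(\<lambda>n. \<psi>s n (real (Suc j) / 2 ^ k)) \<longlonglongrightarrow> \<psi> (real (Suc j) / 2 ^ k)"
proof -
  have "(\<lambda>n. \<psi>s n (1 / 2 ^ k)) \<longlonglongrightarrow> \<psi> (1 / 2 ^ k)"
  proof (induction k)
    case 0
    have "(\<lambda>n. \<psi>s n 1) = (\<lambda>n. \<psi> 1)" unfolding half ..
    then show ?case by simp
  next
    case (Suc k)
    \<comment> \<open>Halving requires a positive value: the points \<open>1 / 2 ^ k\<close> stay in
      \<open>(0,1]\<close>, where the normalization gives at least \<open>1/2\<close>.\<close>
    have "1 / 2 ^ k \<le> (1::real)" by simp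
    then have "\<psi> 1 \<le> \<psi> (1 / 2 ^ k)" by (intro gen_le[OF gen]) auto
    then have "0 < \<psi> (1 / 2 ^ k)" unfolding half(1) by linarith
    with Suc show ?case by - (rule gen_tendsto_half, simp_all)
  qed
  then show ?thesis
  proof (induction j)
    case (Suc j)
    have "(\<lambda>n. \<psi>s n (real (Suc j) / 2 ^ k + 1 / 2 ^ k)) \<longlonglongrightarrow> \<psi> (real (Suc j) / 2 ^ k + 1 / 2 ^ k)"
      using Suc by - (rule gen_tendsto_add, simp_all)
    moreover have "real (Suc j) / 2 ^ k + 1 / 2 ^ k = real (Suc (Suc j)) / 2 ^ k"
      by (simp add: add_divide_distrib)
    ultimately show ?case by simp
  qed simp
qed

lemma gen_tendsto_if_bivariate:
  assumes x: "0 \<le> x"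
  shows "(\<lambda>n. \<psi>s n x) \<longlonglongrightarrow> \<psi> x"
proof (cases "x = 0")
  case True
  then show ?thesis using gen_0[OF gen] gen_0[OF gens] by simp
next
  case False
  with x have x: "0 < x" by simp
  have dyadic: "\<exists>j k. l < real (Suc j) / 2 ^ k \<and> real (Suc j) / 2 ^ k < r"
    if lr: "0 < l" "l < r" for l r :: real
  proof -
    \<comment> \<open>A dyadic number less than half the gap below the midpoint lies strictly
      between \<open>l\<close> and \<open>r\<close>; as \<open>l > 0\<close>, its numerator is
      positive.\<close>
    obtain k q p where *: "real q / 2 ^ k < (l + r) / 2" "(l + r) / 2 < real p / 2 ^ k"
      "\<bar>real q / 2 ^ k - real p / 2 ^ k\<bar> < (r - l) / 2"
      by (rule padic_rational_approximation_straddle_pos[of "(r - l) / 2" 2 "(l + r) / 2"])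
         (use lr in auto)
    then have "l < real q / 2 ^ k" "real q / 2 ^ k < r" using lr by (auto simp: field_simps abs_if split: if_splits)
    moreover from this have "q > 0" using lr by (cases q) auto
    ultimately show ?thesis by (metis gr0_implies_Suc)
  qed
  show ?thesis
  proof (rule order_tendstoI)
    fix a assume "a < \<psi> x"
    then obtain z where z: "x < z" "a < \<psi> z" using obtain_gen_greater_right x by blast
    then obtain j k where jk: "x < real (Suc j) / 2 ^ k" "real (Suc j) / 2 ^ k < z" using dyadic x by blast
    have "a < \<psi> (real (Suc j) / 2 ^ k)"
      using gen_le[OF gen, of "real (Suc j) / 2 ^ k" z] jk z by auto
    with gen_tendsto_dyadic have "\<forall>\<^sub>F n in sequentially. a < \<psi>s n (real (Suc j) / 2 ^ k)"
      by (rule order_tendstoD)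
    then show "\<forall>\<^sub>F n in sequentially. a < \<psi>s n x"
      by eventually_elim (use gen_le[OF gens, of x "real (Suc j) / 2 ^ k"] jk x in \<open>force intro: less_le_trans\<close>)
  next
    fix a assume "\<psi> x < a"
    then obtain z where z: "0 < z" "z < x" "\<psi> z < a" using obtain_gen_less_left x by blast
    then obtain j k where jk: "z < real (Suc j) / 2 ^ k" "real (Suc j) / 2 ^ k < x" using dyadic by blast
    have "\<psi> (real (Suc j) / 2 ^ k) < a"
      using gen_le[OF gen, of z "real (Suc j) / 2 ^ k"] jk z by auto
    with gen_tendsto_dyadic have "\<forall>\<^sub>F n in sequentially. \<psi>s n (real (Suc j) / 2 ^ k) < a"
      by (rule order_tendstoD)
    then show "\<forall>\<^sub>F n in sequentially. \<psi>s n x < a"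
      by eventually_elim (use gen_le[OF gens, of "real (Suc j) / 2 ^ k" x] jk in \<open>force intro: le_less_trans\<close>)
  qed
qed

end

end

section \<open>Signed derivatives of d-monotone generators\<close>

text \<open>\<open>sderiv d \<psi> k\<close> is \<open>(- 1)\<^sup>k\<close> times the \<open>k\<close>-th derivative; in the last order \<open>k = d - 1\<close> the left
  derivative takes the place of the derivative.\<close>

definition sderiv :: "nat \<Rightarrow> (real \<Rightarrow> real) \<Rightarrow> nat \<Rightarrow> real \<Rightarrow> real" where
  "sderiv d \<psi> k x = (if k \<le> d - 2 then (- 1) ^ k * nth_deriv k \<psi> x
     else - left_deriv (\<lambda>x. (- 1) ^ (d - 2) * nth_deriv (d - 2) \<psi> x) x)"

text \<open>Antiderivatives inherit this property, since a slope bounded away from 0 forces linear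
  growth or decay. As \<open>\<psi>\<close> tends to 0 it lacks the property, hence so do its
  derivatives up to order \<open>d - 2\<close>; this yields their signs and their limits at
  infinity.\<close>

definition bounded_away :: "(real \<Rightarrow> real) \<Rightarrow> bool" where
  "bounded_away f \<longleftrightarrow> (\<exists>c>0. (\<forall>\<^sub>F x in at_top. c \<le> f x) \<or> (\<forall>\<^sub>F x in at_top. f x \<le> - c))"

lemma eventually_ge_antiderivative:
  assumes deriv: "\<forall>\<^sub>F x in at_top. (f has_real_derivative g x) (at x)"
    and away: "\<forall>\<^sub>F x in at_top. c \<le> g x" and c: "0 < c"
  shows "\<forall>\<^sub>F x in at_top. 1 \<le> f x"
proof -
  from deriv away have "\<forall>\<^sub>F x in at_top. (f has_real_derivative g x) (at x) \<and> c \<le> g x"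
    by eventually_elim auto
  then obtain a where a: "\<And>x. a \<le> x \<Longrightarrow> (f has_real_derivative g x) (at x)" "\<And>x. a \<le> x \<Longrightarrow> c \<le> g x"
    by (auto simp: eventually_at_top_linorder)
  have grow: "f a + c * (x - a) \<le> f x" if "a \<le> x" for x
  proof -
    have "f a - c * a \<le> f x - c * x"
    proof (rule DERIV_nonneg_imp_nondecreasing[OF that])
      fix y assume "a \<le> y"
      then have "((\<lambda>x. f x - c * x) has_real_derivative g y - c) (at y)"
        by (auto intro!: derivative_eq_intros a)
      then show "\<exists>D. ((\<lambda>x. f x - c * x) has_real_derivative D) (at y) \<and> 0 \<le> D"
        using a(2)[OF \<open>a \<le> y\<close>] by (intro exI[of _ "g y - c"]) auto
    qed
    then show ?thesis by (simp add: algebra_simps)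
  qed
  \<comment> \<open>The threshold solves \<open>f a + c * (x - a) \<ge> 1\<close> for
    \<open>x\<close>.\<close>
  have "1 \<le> f x" if x: "max a (a + (1 - f a) / c) \<le> x" for x
  proof -
    have "(1 - f a) / c \<le> x - a" using x by auto
    then have "1 - f a \<le> c * (x - a)" using c by (simp add: pos_divide_le_eq mult.commute)
    then show ?thesis using grow[of x] x by auto
  qed
  then show ?thesis unfolding eventually_at_top_linorder by blast
qed

lemma bounded_away_antiderivative:
  assumes deriv: "\<And>x. 0 < x \<Longrightarrow> (f has_real_derivative - g x) (at x)" and away: "bounded_away g"
  shows "bounded_away f"
proof -
  have ev: "\<forall>\<^sub>F x in at_top. (f has_real_derivative - g x) (at x)"
    "\<forall>\<^sub>F x in at_top. ((\<lambda>x. - f x) has_real_derivative g x) (at x)"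
    using eventually_gt_at_top[of 0]
    by (eventually_elim, use deriv DERIV_minus in fastforce)+
  obtain c where c: "c > 0" "(\<forall>\<^sub>F x in at_top. c \<le> g x) \<or> (\<forall>\<^sub>F x in at_top. g x \<le> - c)"
    using away unfolding bounded_away_def by blast
  from c(2) show ?thesis
  proof
    assume "\<forall>\<^sub>F x in at_top. c \<le> g x"
    from eventually_ge_antiderivative[OF ev(2) this c(1)]
    have "\<forall>\<^sub>F x in at_top. f x \<le> - 1" by (auto elim: eventually_mono)
    then show ?thesis unfolding bounded_away_def by (intro exI[of _ 1]) auto
  next
    assume "\<forall>\<^sub>F x in at_top. g x \<le> - c"
    then have "\<forall>\<^sub>F x in at_top. c \<le> - g x" by (auto elim: eventually_mono)
    from eventually_ge_antiderivative[OF ev(1) this c(1)]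
    show ?thesis unfolding bounded_away_def by (intro exI[of _ 1]) auto
  qed
qed

context
  fixes d :: nat and \<psi> :: "real \<Rightarrow> real"
  assumes d: "3 \<le> d" and mon: "d_monotone d \<psi>"
begin

lemma d_monotone_gen: "arch_generator \<psi>"
  using mon by (simp add: d_monotone_def)

lemma sderiv_0 [simp]: "sderiv d \<psi> 0 = \<psi>"
  by (auto simp: sderiv_def nth_deriv_def)

lemma sderiv_DERIV:
  assumes "k < d - 2" "0 < x"
  shows "(sderiv d \<psi> k has_real_derivative - sderiv d \<psi> (Suc k) x) (at x)"
proof -
  have "(nth_deriv k \<psi> has_real_derivative nth_deriv (Suc k) \<psi> x) (at x)"
    using mon assms by (auto simp: d_monotone_def)
  then have "((\<lambda>x. (- 1) ^ k * nth_deriv k \<psi> x) has_real_derivative (- 1) ^ k * nth_deriv (Suc k) \<psi> x) (at x)"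
    by (rule DERIV_cmult)
  moreover have "sderiv d \<psi> k = (\<lambda>x. (- 1) ^ k * nth_deriv k \<psi> x)"
    using assms by (auto simp: sderiv_def)
  ultimately show ?thesis using assms by (simp add: sderiv_def)
qed

lemma sderiv_not_bounded_away: "k \<le> d - 2 \<Longrightarrow> \<not> bounded_away (sderiv d \<psi> k)"
proof (induction k)
  case 0
  show ?case
  proof
    assume "bounded_away (sderiv d \<psi> 0)"
    then obtain c where c: "c > 0" "(\<forall>\<^sub>F x in at_top. c \<le> \<psi> x) \<or> (\<forall>\<^sub>F x in at_top. \<psi> x \<le> - c)"
      by (auto simp: bounded_away_def)
    have ev: "\<forall>\<^sub>F x in at_top. \<psi> x < c" "\<forall>\<^sub>F x in at_top. - c < \<psi> x"
      using gen_lim[OF d_monotone_gen] c(1) by (auto intro: order_tendstoD)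
    from c(2) have "\<forall>\<^sub>F x in (at_top :: real filter). False"
    proof
      assume "\<forall>\<^sub>F x in at_top. c \<le> \<psi> x"
      with ev(1) show ?thesis by eventually_elim simp
    next
      assume "\<forall>\<^sub>F x in at_top. \<psi> x \<le> - c"
      with ev(2) show ?thesis by eventually_elim simp
    qed
    then show False by simp
  qed
next
  case (Suc k)
  then show ?case using bounded_away_antiderivative[OF sderiv_DERIV, of k] by auto
qed

text \<open>\<open>d_monotone\<close> prescribes the shape at order \<open>d - 2\<close>, so the
  induction descends: the sign of the next order gives monotonicity, its monotonicity gives
  convexity. A negative value would persist by monotonicity, against
  \<open>sderiv_not_bounded_away\<close>.\<close>

lemma sderiv_shape:
  assumes "k \<le> d - 2"
  shows "antimono_on {0<..} (sderiv d \<psi> k) \<and> convex_on {0<..} (sderiv d \<psi> k) \<and> (\<forall>x>0. 0 \<le> sderiv d \<psi> k x)"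
  using assms
proof (induction k rule: inc_induct)
  case base
  have "sderiv d \<psi> (d - 2) = (\<lambda>x. (- 1) ^ (d - 2) * nth_deriv (d - 2) \<psi> x)"
    by (auto simp: sderiv_def)
  then show ?case using mon by (simp add: d_monotone_def)
next
  case (step k)
  let ?f = "sderiv d \<psi> k" and ?g = "sderiv d \<psi> (Suc k)"
  have deriv: "(?f has_real_derivative - ?g x) (at x)" if "0 < x" for x
    using sderiv_DERIV[of k x] step.hyps that by simp
  have g: "antimono_on {0<..} ?g" "\<And>x. 0 < x \<Longrightarrow> 0 \<le> ?g x" using step.IH by blast+
  have anti: "?f y \<le> ?f x" if "0 < x" "x \<le> y" for x y
  proof (rule DERIV_nonpos_imp_nonincreasing[OF that(2)])
    fix z assume "x \<le> z"
    then have "0 < z" using that by simp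
    then show "\<exists>D. (?f has_real_derivative D) (at z) \<and> D \<le> 0"
      using deriv[of z] g(2)[of z] by (intro exI[of _ "- ?g z"]) simp
  qed
  moreover have "convex_on {0<..} ?f"
    by (rule convex_on_realI[where f' = "\<lambda>x. - ?g x"])
       (use deriv g(1) in \<open>auto simp: monotone_on_def\<close>)
  moreover have "0 \<le> ?f x" if "0 < x" for x
  proof (rule ccontr)
    assume neg: "\<not> 0 \<le> ?f x"
    have "?f y \<le> - (- ?f x)" if "x \<le> y" for y using anti[OF \<open>0 < x\<close> that] by simp
    then have "\<forall>\<^sub>F y in at_top. ?f y \<le> - (- ?f x)"
      unfolding eventually_at_top_linorder by blast
    then have "bounded_away ?f"
      unfolding bounded_away_def using neg by (intro exI[of _ "- ?f x"]) simp
    then show False using sderiv_not_bounded_away[of k] step.hyps by simp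
  qed
  ultimately show ?case by (auto simp: monotone_on_def)
qed

lemma sderiv_convex: "k \<le> d - 2 \<Longrightarrow> convex_on {0<..} (sderiv d \<psi> k)"
  using sderiv_shape by blast

lemma sderiv_Suc:
  assumes "k \<le> d - 2" "0 < x"
  shows "sderiv d \<psi> (Suc k) x = - left_deriv (sderiv d \<psi> k) x"
proof (cases "k = d - 2")
  case True
  have "sderiv d \<psi> (d - 2) = (\<lambda>x. (- 1) ^ (d - 2) * nth_deriv (d - 2) \<psi> x)"
    by (auto simp: sderiv_def)
  then show ?thesis using True by (simp add: sderiv_def)
next
  case False
  then show ?thesis using left_deriv_eq[OF sderiv_DERIV, of k x] assms by simp
qed

lemma sderiv_antimono:
  assumes "k \<le> d - 1"
  shows "antimono_on {0<..} (sderiv d \<psi> k)"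
proof (cases "k \<le> d - 2")
  case False
  then have k: "k = Suc (d - 2)" using assms by simp
  show ?thesis
    unfolding k using mono_left_deriv[OF sderiv_convex[OF order_refl]] by (auto simp: monotone_on_def sderiv_Suc)
qed (use sderiv_shape in blast)

lemma sderiv_nonneg:
  assumes "k \<le> d - 1" "0 < x"
  shows "0 \<le> sderiv d \<psi> k x"
proof (cases "k \<le> d - 2")
  case False
  then have k: "k = Suc (d - 2)" using assms by simp
  have "left_deriv (sderiv d \<psi> (d - 2)) x * 1 \<le> sderiv d \<psi> (d - 2) (x + 1) - sderiv d \<psi> (d - 2) x"
    using left_deriv_bounds(1)[OF sderiv_convex[OF order_refl] assms(2), of "x + 1"] by simp
  also have "\<dots> \<le> 0" using sderiv_antimono[of "d - 2"] assms(2) by (auto simp: monotone_on_def)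
  finally show ?thesis using sderiv_Suc[OF order_refl assms(2)] by (simp add: k)
next
  case True
  show ?thesis using sderiv_shape[OF True] assms(2) by simp
qed

lemma sderiv_tendsto_0:
  assumes "k \<le> d - 2"
  shows "(sderiv d \<psi> k \<longlongrightarrow> 0) at_top"
proof (rule tendstoI)
  fix e :: real assume "e > 0"
  have "\<exists>x>0. sderiv d \<psi> k x < e"
  proof (rule ccontr)
    assume "\<not> ?thesis"
    then have "e \<le> sderiv d \<psi> k x" if "0 < x" for x using that by (metis not_less)
    then have "\<forall>\<^sub>F x in at_top. e \<le> sderiv d \<psi> k x"
      using eventually_gt_at_top[of 0] by (rule eventually_mono[rotated])
    then have "bounded_away (sderiv d \<psi> k)"
      unfolding bounded_away_def using \<open>e > 0\<close> by (intro exI[of _ e]) simp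
    then show False using sderiv_not_bounded_away[OF assms] by contradiction
  qed
  then obtain x where x: "x > 0" "sderiv d \<psi> k x < e" by blast
  have "dist (sderiv d \<psi> k y) 0 < e" if "y \<ge> x" for y
  proof -
    have "sderiv d \<psi> k y \<le> sderiv d \<psi> k x"
      using sderiv_antimono[of k] assms x that by (auto simp: monotone_on_def)
    moreover have "0 \<le> sderiv d \<psi> k y" using sderiv_nonneg assms x that by auto
    ultimately show ?thesis using x by simp
  qed
  then show "\<forall>\<^sub>F y in at_top. dist (sderiv d \<psi> k y) 0 < e"
    unfolding eventually_at_top_linorder by blast
qed

lemma sderiv_isCont:
  assumes "k \<le> d - 2" "0 < x"
  shows "isCont (sderiv d \<psi> k) x"
  using convex_on_continuous[OF _ sderiv_convex[OF assms(1)]] assms(2)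
  by (auto simp: continuous_on_eq_continuous_at)

lemma isCont_sderiv_Suc:
  assumes "k \<le> d - 2" "0 < x"
  shows "isCont (sderiv d \<psi> (Suc k)) x \<longleftrightarrow> isCont (left_deriv (sderiv d \<psi> k)) x"
proof -
  have "\<forall>\<^sub>F y in nhds x. y \<in> {0<..}" using assms by (intro eventually_nhds_in_open) auto
  then have "\<forall>\<^sub>F y in nhds x. sderiv d \<psi> (Suc k) y = - left_deriv (sderiv d \<psi> k) y"
    by eventually_elim (use assms sderiv_Suc in auto)
  then have "isCont (sderiv d \<psi> (Suc k)) x \<longleftrightarrow> isCont (\<lambda>y. - left_deriv (sderiv d \<psi> k) y) x"
    by (rule isCont_cong)
  also have "\<dots> \<longleftrightarrow> isCont (left_deriv (sderiv d \<psi> k)) x"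
    by (rule isCont_minus_iff)
  finally show ?thesis .
qed

text \<open>Strictly beyond a zero there is room to the left of \<open>t\<close> on which the lower
  order already vanishes. At the zero itself the last order may fail:
  \<open>(1 - t) ^ (d - 1)\<close>, cut off at 1, has a nonzero left derivative of order
  \<open>d - 1\<close> there.\<close>

lemma sderiv_vanish:
  assumes "0 \<le> s" "\<psi> s = 0" "s < t" "k \<le> d - 1"
  shows "sderiv d \<psi> k t = 0"
  using assms(3,4)
proof (induction k arbitrary: t)
  case 0
  then show ?case
    using gen_le[OF d_monotone_gen, of s t] gen_nonneg[OF d_monotone_gen, of t] assms by auto
next
  case (Suc k)
  have "sderiv d \<psi> k t = 0" "sderiv d \<psi> k ((s + t) / 2) = 0"
    using Suc by (auto intro!: Suc.IH)
  then have "0 \<le> left_deriv (sderiv d \<psi> k) t * (t - (s + t) / 2)"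
    using left_deriv_bounds(2)[OF sderiv_convex, of k "(s + t) / 2" t] Suc assms(1) by auto
  then have "sderiv d \<psi> (Suc k) t \<le> 0"
    using Suc.prems assms(1) by (auto simp: sderiv_Suc zero_le_mult_iff)
  then show ?case using sderiv_nonneg[of "Suc k" t] Suc.prems assms(1) by auto
qed

lemma sderiv_1_pos:
  assumes "0 < t" "0 < \<psi> t"
  shows "0 < sderiv d \<psi> 1 t"
proof -
  have "left_deriv \<psi> t \<le> (\<psi> (t + 1) - \<psi> t) / (t + 1 - t)"
    using left_deriv_le_slope[OF sderiv_convex, of 0 t "t + 1"] assms d by simp
  also have "\<dots> < 0" using gen_less[OF d_monotone_gen, of t "t + 1"] assms by simp
  finally show ?thesis using sderiv_Suc[of 0 t] assms by simp
qed

lemma gen_DERIV: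
  assumes "0 < x"
  shows "(\<psi> has_real_derivative - sderiv d \<psi> 1 x) (at x)"
  using sderiv_DERIV[of 0 x] d assms by simp

lemma nth_deriv_eq_sderiv: "m \<le> d - 2 \<Longrightarrow> nth_deriv m \<psi> x = (- 1) ^ m * sderiv d \<psi> m x"
  by (simp add: sderiv_def mult.assoc[symmetric] power_add[symmetric] flip: mult_2)

lemma left_deriv_nth_deriv:
  assumes "0 < x"
  shows "left_deriv (nth_deriv (d - 2) \<psi>) x = - ((- 1) ^ (d - 2) * sderiv d \<psi> (d - 1) x)"
proof -
  let ?g = "sderiv d \<psi> (d - 2)" and ?c = "(- 1) ^ (d - 2) :: real"
  have "((\<lambda>y. ?c * ((?g y - ?g x) / (y - x))) \<longlongrightarrow> ?c * left_deriv ?g x) (at_left x)"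
    using assms by (intro tendsto_intros tendsto_left_deriv sderiv_convex) auto
  moreover have "(\<lambda>y. ?c * ((?g y - ?g x) / (y - x)))
      = (\<lambda>y. (nth_deriv (d - 2) \<psi> y - nth_deriv (d - 2) \<psi> x) / (y - x))"
    by (auto simp: nth_deriv_eq_sderiv algebra_simps diff_divide_distrib)
  ultimately have "left_deriv (nth_deriv (d - 2) \<psi>) x = ?c * left_deriv ?g x"
    unfolding left_deriv_def[of "nth_deriv (d - 2) \<psi>"] by (intro tendsto_Lim) auto
  moreover have "Suc (d - 2) = d - 1" using d by simp
  ultimately show ?thesis using sderiv_Suc[of "d - 2" x] assms by simp
qed

lemma isCont_left_deriv_nth_deriv:
  assumes "0 < x"
  shows "isCont (left_deriv (nth_deriv (d - 2) \<psi>)) x \<longleftrightarrow> isCont (sderiv d \<psi> (d - 1)) x"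
proof -
  let ?c = "(- 1) ^ (d - 2) :: real"
  have ev: "\<forall>\<^sub>F y in nhds x. y \<in> {0<..}" using assms by (intro eventually_nhds_in_open) auto
  have "\<forall>\<^sub>F y in nhds x. left_deriv (nth_deriv (d - 2) \<psi>) y = - (?c * sderiv d \<psi> (d - 1) y)"
    using ev by eventually_elim (simp add: left_deriv_nth_deriv)
  then have "isCont (left_deriv (nth_deriv (d - 2) \<psi>)) x \<longleftrightarrow> isCont (\<lambda>y. - (?c * sderiv d \<psi> (d - 1) y)) x"
    by (rule isCont_cong)
  also have "\<dots> \<longleftrightarrow> isCont (sderiv d \<psi> (d - 1)) x"
    by (cases "even (d - 2)") (simp_all add: isCont_minus_iff)
  finally show ?thesis .
qed

end

section \<open>Convergence of the derivatives\<close>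

context
  fixes d :: nat and \<psi> :: "real \<Rightarrow> real" and \<psi>s :: "nat \<Rightarrow> real \<Rightarrow> real"
  assumes d: "3 \<le> d" and mon: "d_monotone d \<psi>" and mons: "\<And>n. d_monotone d (\<psi>s n)"
begin

text \<open>Induction on the order, each step being \<open>tendsto_left_deriv_convex\<close>. All
  orders up to \<open>d - 2\<close> are continuous, so the continuity condition restricts only the
  last one.\<close>

lemma sderiv_tendsto:
  assumes lim: "\<And>x. 0 \<le> x \<Longrightarrow> (\<lambda>n. \<psi>s n x) \<longlonglongrightarrow> \<psi> x"
    and "k \<le> d - 1" "0 < x" "isCont (sderiv d \<psi> k) x"
  shows "(\<lambda>n. sderiv d (\<psi>s n) k x) \<longlonglongrightarrow> sderiv d \<psi> k x"
  using assms(2-)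
proof (induction k arbitrary: x)
  case 0
  then show ?case using lim sderiv_0[OF d mon] sderiv_0[OF d mons] by simp
next
  case (Suc k)
  have k: "k \<le> d - 2" using Suc by simp
  have "(\<lambda>n. left_deriv (sderiv d (\<psi>s n) k) x) \<longlonglongrightarrow> left_deriv (sderiv d \<psi> k) x"
  proof (rule tendsto_left_deriv_convex)
    show "(\<lambda>n. sderiv d (\<psi>s n) k y) \<longlonglongrightarrow> sderiv d \<psi> k y" if "0 < y" for y
      using Suc k that sderiv_isCont[OF d mon] by (intro Suc.IH) auto
    show "isCont (left_deriv (sderiv d \<psi> k)) x"
      using isCont_sderiv_Suc[OF d mon k] Suc by auto
  qed (use Suc k sderiv_convex[OF d mon] sderiv_convex[OF d mons] in auto)
  then show ?case
    using Suc k by (simp add: sderiv_Suc[OF d mon] sderiv_Suc[OF d mons] tendsto_minus)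
qed

lemma sderiv_tendsto_moving:
  assumes lim: "\<And>x. 0 \<le> x \<Longrightarrow> (\<lambda>n. \<psi>s n x) \<longlonglongrightarrow> \<psi> x"
    and "k \<le> d - 1" "0 < x" "isCont (sderiv d \<psi> k) x" "xs \<longlonglongrightarrow> x"
  shows "(\<lambda>n. sderiv d (\<psi>s n) k (xs n)) \<longlonglongrightarrow> sderiv d \<psi> k x"
  by (rule tendsto_antimono_moving[OF sderiv_antimono[OF d mons] sderiv_antimono[OF d mon] sderiv_tendsto])
     (use assms in simp_all)

text \<open>The point 1, where all generators agree, serves as anchor. The monotone signed
  derivatives converge uniformly between \<open>x\<close> and 1, since their limit is continuous
  there, and the mean value inequality carries this over to the generators.\<close>

lemma gen_tendsto_if_deriv_tendsto:
  assumes lim: "\<And>x. 0 < x \<Longrightarrow> (\<lambda>n. sderiv d (\<psi>s n) 1 x) \<longlonglongrightarrow> sderiv d \<psi> 1 x"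
    and one: "\<And>n. \<psi>s n 1 = \<psi> 1" and x: "0 \<le> x"
  shows "(\<lambda>n. \<psi>s n x) \<longlonglongrightarrow> \<psi> x"
proof (cases "x = 0")
  case True
  then show ?thesis
    using gen_0[OF d_monotone_gen[OF d mon]] gen_0[OF d_monotone_gen[OF d mons]] by simp
next
  case False
  with x have x: "0 < x" by simp
  define I where "I = {min x 1..max x 1}"
  have I: "y > 0" if "y \<in> I" for y using that x by (auto simp: I_def)
  have unif: "uniform_limit I (\<lambda>n. sderiv d (\<psi>s n) 1) (sderiv d \<psi> 1) sequentially"
    unfolding I_def
  proof (rule uniform_limit_antimono_Icc)
    show "antimono_on {min x 1..max x 1} (sderiv d (\<psi>s n) 1)" for n
      using x d by (intro monotone_on_subset[OF sderiv_antimono[OF d mons]]) auto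
    show "continuous_on {min x 1..max x 1} (sderiv d \<psi> 1)"
      using x d sderiv_isCont[OF d mon, of 1] by (auto intro!: continuous_at_imp_continuous_on)
  qed (use lim x in auto)
  show ?thesis
  proof (rule tendstoI)
    fix e :: real assume "e > 0"
    define r where "r = e / (\<bar>x - 1\<bar> + 1)"
    have r: "r > 0" "r * \<bar>x - 1\<bar> < e"
      using \<open>e > 0\<close> by (auto simp: r_def field_simps intro: add_pos_nonneg)
    have "\<forall>\<^sub>F n in sequentially. \<forall>y\<in>I. dist (sderiv d (\<psi>s n) 1 y) (sderiv d \<psi> 1 y) < r"
      using unif r(1) by (rule uniform_limitD)
    then show "\<forall>\<^sub>F n in sequentially. dist (\<psi>s n x) (\<psi> x) < e"
    proof eventually_elim
      case (elim n)
      have "norm ((\<psi>s n x - \<psi> x) - (\<psi>s n 1 - \<psi> 1)) \<le> r * norm (x - 1)"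
      proof (rule field_differentiable_bound)
        show "convex I" by (simp add: I_def)
        fix y assume y: "y \<in> I"
        show "((\<lambda>x. \<psi>s n x - \<psi> x) has_real_derivative - sderiv d (\<psi>s n) 1 y - - sderiv d \<psi> 1 y) (at y within I)"
          by (rule has_field_derivative_at_within, rule DERIV_diff)
             (rule gen_DERIV[OF d mons I[OF y]], rule gen_DERIV[OF d mon I[OF y]])
        show "norm (- sderiv d (\<psi>s n) 1 y - - sderiv d \<psi> 1 y) \<le> r"
          using bspec[OF elim y] by (simp add: dist_real_def abs_minus_commute)
      qed (auto simp: I_def)
      then show ?case using r(2) one by (simp add: dist_real_def)
    qed
  qed
qed

end

section \<open>Densities of the marginals\<close>

text \<open>The absolute derivative of \<open>gen_inv \<psi>\<close> by the inverse function rule.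
  The value 0 off \<open>(0,1)\<close> confines the densities to the open cube.\<close>

definition gen_inv_dens :: "nat \<Rightarrow> (real \<Rightarrow> real) \<Rightarrow> real \<Rightarrow> real" where
  "gen_inv_dens d \<psi> x = (if x \<in> {0<..<1} then inverse (sderiv d \<psi> 1 (gen_inv \<psi> x)) else 0)"

text \<open>A Borel version of \<open>sderiv\<close>; the value \<open>1 = \<psi> 0\<close> off the positive half line makes the empty sum
  a valid base case in \<open>nn_integral_arch_dens\<close>.\<close>

definition sderiv0 :: "nat \<Rightarrow> (real \<Rightarrow> real) \<Rightarrow> nat \<Rightarrow> real \<Rightarrow> real" where
  "sderiv0 d \<psi> k t = (if 0 < t then sderiv d \<psi> k t else 1)"

definition arch_dens :: "nat \<Rightarrow> (real \<Rightarrow> real) \<Rightarrow> nat set \<Rightarrow> (nat \<Rightarrow> real) \<Rightarrow> real" where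
  "arch_dens d \<psi> I x = sderiv0 d \<psi> (card I) (\<Sum>i\<in>I. gen_inv \<psi> (x i)) * (\<Prod>i\<in>I. gen_inv_dens d \<psi> (x i))"

interpretation lborel_PiM: product_sigma_finite "\<lambda>_ :: nat. lborel :: real measure"
  by standard

lemma SUP_eq_if_eventually:
  fixes f :: "nat \<Rightarrow> ennreal"
  assumes "incseq f" "\<forall>\<^sub>F n in sequentially. f n = c"
  shows "(SUP n. f n) = c"
  using LIMSEQ_unique[OF LIMSEQ_SUP[OF assms(1)] tendsto_eventually[OF assms(2)]] .

context
  fixes d :: nat and \<psi> :: "real \<Rightarrow> real"
  assumes d: "3 \<le> d" and mon: "d_monotone d \<psi>"
begin

private lemmas gen = d_monotone_gen[OF d mon]

text \<open>Continuity covers \<open>(0,1]\<close>, and 0 is a single point. Outside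
  \<open>[0,1]\<close> the level set is empty, so \<open>pinv\<close> is infinite and
  \<open>gen_inv\<close> is 0.\<close>

lemma gen_inv_measurable: "gen_inv \<psi> \<in> borel_measurable borel"
proof -
  have zero: "gen_inv \<psi> y = 0" if "y \<notin> {0..1}" for y
  proof -
    have "{z. 0 \<le> z \<and> psi_ext \<psi> z = y} = {}" using that psi_ext_nonneg_le_1[OF gen] by auto
    then have "pinv \<psi> y = \<infinity>" unfolding pinv_def by (simp only: Inf_empty top_ereal_def)
    then show ?thesis by (simp add: gen_inv_def)
  qed
  have "(\<lambda>y. indicator {0<..1} y *\<^sub>R gen_inv \<psi> y) \<in> borel_measurable borel"
    by (intro borel_measurable_continuous_on_indicator continuous_gen_inv[OF gen]) auto
  moreover have "(\<lambda>y. indicator {0::real} y * gen_inv \<psi> 0) \<in> borel_measurable borel" by simp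
  ultimately have "(\<lambda>y. indicator {0<..1} y *\<^sub>R gen_inv \<psi> y + indicator {0::real} y * gen_inv \<psi> 0)
      \<in> borel_measurable borel" by (rule borel_measurable_add)
  moreover have "(\<lambda>y. indicator {0<..1} y *\<^sub>R gen_inv \<psi> y + indicator {0::real} y * gen_inv \<psi> 0) = gen_inv \<psi>"
  proof
    fix y show "indicator {0<..1} y *\<^sub>R gen_inv \<psi> y + indicator {0::real} y * gen_inv \<psi> 0 = gen_inv \<psi> y"
      by (cases "y \<in> {0..1}"; cases "y = 0") (auto simp: indicator_def zero)
  qed
  ultimately show ?thesis by simp
qed

lemma sderiv0_measurable:
  assumes "k \<le> d - 1"
  shows "sderiv0 d \<psi> k \<in> borel_measurable borel"
proof -
  have "(\<lambda>x. if 0 < x then indicator {0<..} x * sderiv d \<psi> k x else (1::real)) \<in> borel_measurable borel"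
    by (rule measurable_If) (use borel_measurable_antimono_Ioi[OF sderiv_antimono[OF d mon assms]] in auto)
  also have "(\<lambda>x. if 0 < x then indicator {0<..} x * sderiv d \<psi> k x else 1) = sderiv0 d \<psi> k"
    by (auto simp: sderiv0_def fun_eq_iff)
  finally show ?thesis .
qed

lemma gen_inv_dens_measurable: "gen_inv_dens d \<psi> \<in> borel_measurable borel"
proof -
  have "1 \<le> d - 1" using d by simp
  note [measurable] = gen_inv_measurable sderiv0_measurable[OF this]
  have "(\<lambda>x. if x \<in> {0<..<1} then inverse (sderiv0 d \<psi> 1 (gen_inv \<psi> x)) else 0) \<in> borel_measurable borel"
    by measurable
  also have "(\<lambda>x. if x \<in> {0<..<1} then inverse (sderiv0 d \<psi> 1 (gen_inv \<psi> x)) else 0) = gen_inv_dens d \<psi>"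
    using gen_inv_pos[OF gen] by (auto simp: gen_inv_dens_def sderiv0_def fun_eq_iff)
  finally show ?thesis .
qed

lemma arch_dens_measurable:
  assumes "finite I" "card I \<le> d - 1"
  shows "arch_dens d \<psi> I \<in> borel_measurable (PiM I (\<lambda>_. lborel))"
proof -
  note [measurable] = gen_inv_measurable gen_inv_dens_measurable sderiv0_measurable[OF assms(2)]
  have "(\<lambda>x. gen_inv \<psi> (x i)) \<in> borel_measurable (PiM I (\<lambda>_. lborel))"
    "(\<lambda>x. gen_inv_dens d \<psi> (x i)) \<in> borel_measurable (PiM I (\<lambda>_. lborel))" if "i \<in> I" for i
    using that by measurable
  then show ?thesis unfolding arch_dens_def
    by (intro borel_measurable_times borel_measurable_prod measurable_compose[OF borel_measurable_sum sderiv0_measurable[OF assms(2)]]) auto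
qed

lemma sderiv_gen_inv_pos: "0 < x \<Longrightarrow> x < 1 \<Longrightarrow> 0 < sderiv d \<psi> 1 (gen_inv \<psi> x)"
  using gen_inv_pos[OF gen] gen_gen_inv[OF gen] by (intro sderiv_1_pos[OF d mon]) auto

lemma gen_inv_dens_nonneg: "0 \<le> gen_inv_dens d \<psi> x"
  using sderiv_gen_inv_pos[of x] by (auto simp: gen_inv_dens_def)

lemma sderiv0_nonneg: "k \<le> d - 1 \<Longrightarrow> 0 \<le> sderiv0 d \<psi> k t"
  using sderiv_nonneg[OF d mon] by (auto simp: sderiv0_def)

lemma gen_inv_DERIV:
  assumes "0 < x" "x < 1"
  shows "(gen_inv \<psi> has_real_derivative - gen_inv_dens d \<psi> x) (at x)"
proof -
  have "(gen_inv \<psi> has_real_derivative inverse (- sderiv d \<psi> 1 (gen_inv \<psi> x))) (at x)"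
  proof (rule DERIV_inverse_function[where f = \<psi> and a = 0 and b = 1])
    show "(\<psi> has_real_derivative - sderiv d \<psi> 1 (gen_inv \<psi> x)) (at (gen_inv \<psi> x))"
      using gen_inv_pos[OF gen assms] by (rule gen_DERIV[OF d mon])
    show "- sderiv d \<psi> 1 (gen_inv \<psi> x) \<noteq> 0" using sderiv_gen_inv_pos[OF assms] by simp
    show "isCont (gen_inv \<psi>) x"
      using continuous_on_interior[OF continuous_gen_inv[OF gen], of x] assms by simp
  qed (use assms gen_gen_inv[OF gen] in auto)
  then show ?thesis using assms by (simp add: gen_inv_dens_def)
qed

lemma continuous_gen_inv_dens: "continuous_on {0<..<1} (gen_inv_dens d \<psi>)"
proof -
  have "continuous_on {0<..<1} (\<lambda>x. inverse (sderiv d \<psi> 1 (gen_inv \<psi> x)))"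
  proof (rule continuous_on_inverse)
    have "continuous_on {0<..} (sderiv d \<psi> 1)"
      using d by (intro convex_on_continuous sderiv_convex[OF d mon]) auto
    moreover have "continuous_on {0<..<1} (gen_inv \<psi>)"
      by (intro continuous_on_subset[OF continuous_gen_inv[OF gen]]) auto
    ultimately show "continuous_on {0<..<1} (\<lambda>x. sderiv d \<psi> 1 (gen_inv \<psi> x))"
      by (rule continuous_on_compose2) (use gen_inv_pos[OF gen] in auto)
    show "\<forall>x\<in>{0<..<1}. sderiv d \<psi> 1 (gen_inv \<psi> x) \<noteq> 0" using sderiv_gen_inv_pos by force
  qed
  then show ?thesis by (rule continuous_on_eq) (simp add: gen_inv_dens_def)
qed

lemma nn_integral_gen_inv_Icc:
  fixes G :: "real \<Rightarrow> real"
  assumes G: "G \<in> borel_measurable borel" and uv: "0 < u" "u \<le> v" "v < 1"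
  shows "(\<integral>\<^sup>+x. ennreal (G (gen_inv \<psi> x) * gen_inv_dens d \<psi> x) * indicator {u..v} x \<partial>lborel)
    = (\<integral>\<^sup>+t. ennreal (G t) * indicator {gen_inv \<psi> v..gen_inv \<psi> u} t \<partial>lborel)"
proof -
  \<comment> \<open>Negation turns the decreasing inverse into an increasing substitution with
    derivative \<open>gen_inv_dens d \<psi>\<close>.\<close>
  let ?g = "\<lambda>x. - gen_inv \<psi> x"
  note [measurable] = G
  have "(\<integral>\<^sup>+t. ennreal (G t) * indicator {gen_inv \<psi> v..gen_inv \<psi> u} t \<partial>lborel)
      = (\<integral>\<^sup>+t. ennreal (G (- t) * indicator {?g u..?g v} t) \<partial>lborel)"
    by (subst nn_integral_real_affine[where t = 0 and c = "-1"])
       (auto intro!: nn_integral_cong simp: indicator_def)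
  also have "\<dots> = (\<integral>\<^sup>+x. ennreal (G (- ?g x) * gen_inv_dens d \<psi> x * indicator {u..v} x) \<partial>lborel)"
  proof (rule nn_integral_substitution)
    show "set_borel_measurable borel {?g u..?g v} (\<lambda>t. G (- t))"
      unfolding set_borel_measurable_def by measurable
    show "((\<lambda>x. - gen_inv \<psi> x) has_real_derivative gen_inv_dens d \<psi> x) (at x)" if "x \<in> {u..v}" for x
      using DERIV_minus[OF gen_inv_DERIV[of x]] that uv by simp
    show "continuous_on {u..v} (gen_inv_dens d \<psi>)"
      using uv by (intro continuous_on_subset[OF continuous_gen_inv_dens]) auto
  qed (use uv gen_inv_dens_nonneg in auto)
  also have "\<dots> = (\<integral>\<^sup>+x. ennreal (G (gen_inv \<psi> x) * gen_inv_dens d \<psi> x) * indicator {u..v} x \<partial>lborel)"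
    by (intro nn_integral_cong) (auto simp: indicator_def)
  finally show ?thesis by simp
qed

text \<open>Positive levels correspond to arguments before the first zero, hence the set on the
  right. The substitution holds on compact subintervals of \<open>(0,1)\<close>; they exhaust
  \<open>(0,a)\<close> from inside, because \<open>a = 1\<close> is allowed.\<close>

lemma nn_integral_gen_inv:
  fixes G :: "real \<Rightarrow> real"
  assumes G: "G \<in> borel_measurable borel" and a: "0 < a" "a \<le> 1"
  shows "(\<integral>\<^sup>+x. ennreal (G (gen_inv \<psi> x) * gen_inv_dens d \<psi> x) * indicator {..a} x \<partial>lborel)
    = (\<integral>\<^sup>+t. ennreal (G t) * indicator {t. gen_inv \<psi> a < t \<and> 0 < \<psi> t} t \<partial>lborel)"
proof -
  define q where "q n = inverse (real (Suc (Suc n)))" for n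
  define u where "u n = a * q n" for n
  define v where "v n = a * (1 - q n)" for n
  have q_dec: "q (Suc n) \<le> q n" for n by (simp add: q_def field_simps)
  have q_pos: "0 < q n" "q n \<le> 1/2" for n by (simp_all add: q_def field_simps)
  have q_lim: "q \<longlonglongrightarrow> 0"
    unfolding q_def using LIMSEQ_Suc[OF LIMSEQ_inverse_real_of_nat] by simp
  have u: "0 < u n" "u n \<le> v n" "u (Suc n) \<le> u n" "v n \<le> v (Suc n)" "v n < a" for n
    using a q_pos[of n] q_dec[of n] by (auto simp: u_def v_def)
  have u_lim: "u \<longlonglongrightarrow> 0" unfolding u_def using tendsto_mult_right_zero[OF q_lim] .
  have v_lim: "v \<longlonglongrightarrow> a"
    unfolding v_def using tendsto_mult[OF tendsto_const tendsto_diff[OF tendsto_const q_lim], of a 1] by simp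
  have v1: "v n < 1" for n using u(5)[of n] a by linarith
  define F where "F n x = ennreal (G (gen_inv \<psi> x) * gen_inv_dens d \<psi> x) * indicator {u n..v n} x" for n x
  define H where "H n t = ennreal (G t) * indicator {gen_inv \<psi> (v n)..gen_inv \<psi> (u n)} t" for n t
  have uv_inc: "gen_inv \<psi> (u n) \<le> gen_inv \<psi> (u (Suc n))" "gen_inv \<psi> (v (Suc n)) \<le> gen_inv \<psi> (v n)" for n
    using u[of n] u[of "Suc n"] v1[of n] v1[of "Suc n"] by (auto intro!: gen_inv_antimono[OF gen])
  have F_inc: "incseq F"
  proof (rule incseq_SucI, rule le_funI)
    fix n x show "F n x \<le> F (Suc n) x" using u[of n] by (auto simp: F_def indicator_def)
  qed
  have H_inc: "incseq H"
  proof (rule incseq_SucI, rule le_funI)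
    fix n t show "H n t \<le> H (Suc n) t" using uv_inc[of n] by (auto simp: H_def indicator_def)
  qed
  have F_meas: "F n \<in> borel_measurable lborel" for n
    unfolding F_def using G gen_inv_measurable gen_inv_dens_measurable by measurable
  have H_meas: "H n \<in> borel_measurable lborel" for n
    unfolding H_def using G by measurable
  have F_sup: "(SUP n. F n x) = ennreal (G (gen_inv \<psi> x) * gen_inv_dens d \<psi> x) * indicator {..<a} x" for x
  proof (rule SUP_eq_if_eventually)
    show "incseq (\<lambda>n. F n x)" using F_inc by (auto simp: incseq_def le_fun_def)
    show "\<forall>\<^sub>F n in sequentially. F n x = ennreal (G (gen_inv \<psi> x) * gen_inv_dens d \<psi> x) * indicator {..<a} x"
    proof (cases "0 < x \<and> x < a")
      case True
      then have "\<forall>\<^sub>F n in sequentially. u n < x" "\<forall>\<^sub>F n in sequentially. x < v n"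
        using u_lim v_lim by (auto intro: order_tendstoD)
      then show ?thesis by eventually_elim (use True in \<open>auto simp: F_def\<close>)
    next
      case False
      then have "x \<notin> {u n..v n}" for n using u[of n] by auto
      moreover have "gen_inv_dens d \<psi> x = 0 \<or> x \<notin> {..<a}" using False by (auto simp: gen_inv_dens_def)
      ultimately show ?thesis by (auto simp: F_def)
    qed
  qed
  have H_sup: "(SUP n. H n t) = ennreal (G t) * indicator {t. gen_inv \<psi> a < t \<and> 0 < \<psi> t} t" for t
  proof (rule SUP_eq_if_eventually)
    show "incseq (\<lambda>n. H n t)" using H_inc by (auto simp: incseq_def le_fun_def)
    have ge: "gen_inv \<psi> a < gen_inv \<psi> (v n)" for n
      using gen_inv_less_iff[OF gen a, of "gen_inv \<psi> (v n)"] u[of n] v1[of n]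
        gen_gen_inv[OF gen, of "v n"] gen_inv_nonneg[OF gen, of "v n"] by auto
    show "\<forall>\<^sub>F n in sequentially. H n t = ennreal (G t) * indicator {t. gen_inv \<psi> a < t \<and> 0 < \<psi> t} t"
    proof (cases "gen_inv \<psi> a < t \<and> 0 < \<psi> t")
      case True
      then have t: "0 \<le> t" using gen_inv_nonneg[OF gen a] by linarith
      have "\<psi> t < a" using True gen_inv_less_iff[OF gen a t] by simp
      then have "\<forall>\<^sub>F n in sequentially. u n < \<psi> t" "\<forall>\<^sub>F n in sequentially. \<psi> t < v n"
        using u_lim v_lim True by (auto intro: order_tendstoD)
      then show ?thesis
      proof eventually_elim
        case (elim n)
        have "t \<le> gen_inv \<psi> (u n)"
          using elim u[of n] v1[of n] t gen_inv_less_iff[OF gen, of "u n" t] by force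
        moreover have "gen_inv \<psi> (v n) \<le> t"
          using elim u[of n] v1[of n] t gen_inv_le_iff[OF gen, of "v n" t] by force
        ultimately show ?case using True by (simp add: H_def)
      qed
    next
      case False
      have "t \<notin> {gen_inv \<psi> (v n)..gen_inv \<psi> (u n)}" for n
      proof
        assume t: "t \<in> {gen_inv \<psi> (v n)..gen_inv \<psi> (u n)}"
        then have "gen_inv \<psi> a < t" using ge[of n] by auto
        moreover from this have "0 \<le> t" using gen_inv_nonneg[OF gen a] by linarith
        moreover have "u n \<le> \<psi> t"
          using t \<open>0 \<le> t\<close> u[of n] v1[of n] gen_inv_less_iff[OF gen, of "u n" t] by force
        ultimately show False using False u(1)[of n] by auto
      qed
      then show ?thesis using False by (auto simp: H_def)
    qed
  qed
  have "AE x in lborel. x \<noteq> a" by (rule AE_lborel_singleton)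
  then have "(\<integral>\<^sup>+x. ennreal (G (gen_inv \<psi> x) * gen_inv_dens d \<psi> x) * indicator {..a} x \<partial>lborel)
      = (\<integral>\<^sup>+x. (SUP n. F n x) \<partial>lborel)"
    unfolding F_sup by (intro nn_integral_cong_AE) (auto elim!: eventually_mono simp: indicator_def)
  also have "\<dots> = (SUP n. integral\<^sup>N lborel (F n))"
    using F_inc F_meas by (rule nn_integral_monotone_convergence_SUP)
  also have "\<dots> = (SUP n. integral\<^sup>N lborel (H n))"
    unfolding F_def H_def using u v1 by (subst nn_integral_gen_inv_Icc[OF G]) auto
  also have "\<dots> = (\<integral>\<^sup>+t. (SUP n. H n t) \<partial>lborel)"
    using H_inc H_meas by (rule nn_integral_monotone_convergence_SUP[symmetric])
  finally show ?thesis unfolding H_sup .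
qed

text \<open>Removes the restriction \<open>0 < \<psi> t\<close> left by
  \<open>nn_integral_gen_inv\<close>: beyond the first zero \<open>sderiv_vanish\<close> applies,
  and the first zero itself is a null set.\<close>

lemma sderiv_add_eq_0_AE:
  assumes "k \<le> d - 1" "0 \<le> c"
  shows "AE t in lborel. 0 < t \<longrightarrow> \<not> 0 < \<psi> t \<longrightarrow> sderiv d \<psi> k (c + t) = 0"
proof (cases "\<exists>z\<ge>0. \<psi> z = 0")
  case True
  then obtain z0 where z0: "0 \<le> z0" "\<psi> z0 = 0" by blast
  then have "pinv \<psi> 0 \<le> ereal z0" using pinv_0_le_iff[OF gen] by simp
  then obtain z where z: "pinv \<psi> 0 = ereal z" "0 \<le> z"
    using pinv_nonneg[of \<psi> 0] by (cases "pinv \<psi> 0") auto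
  have \<psi>z: "\<psi> z = 0" using pinv_0_le_iff[OF gen z(2)] z by simp
  have "AE t in lborel. t \<noteq> z" by (rule AE_lborel_singleton)
  then show ?thesis
  proof eventually_elim
    case (elim t)
    show ?case
    proof (intro impI)
      assume t: "0 < t" "\<not> 0 < \<psi> t"
      then have "\<psi> t = 0" using gen_nonneg[OF gen, of t] by simp
      then have "z \<le> t" using pinv_0_le_iff[OF gen, of t] t z by simp
      then show "sderiv d \<psi> k (c + t) = 0"
        using elim assms z \<psi>z by (intro sderiv_vanish[OF d mon z(2) \<psi>z]) auto
    qed
  qed
next
  case False
  then have "0 < \<psi> t" if "0 < t" for t using gen_nonneg[OF gen, of t] that
    by (metis less_eq_real_def)
  then show ?thesis by simp
qed

text \<open>Integrating out one coordinate lowers the order by one: substitute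
  \<open>t = gen_inv \<psi> x\<close>, then integrate the derivative from
  \<open>c + gen_inv \<psi> a\<close> to infinity. For \<open>c = 0\<close> and \<open>a = 1\<close>
  the lower limit is 0, where a finite limit is known for \<open>\<psi>\<close> itself but not for
  its derivatives; hence \<open>0 < c \<or> k = 0\<close>.\<close>

lemma nn_integral_sderiv0_gen_inv:
  assumes k: "k \<le> d - 2" and c: "0 \<le> c" and a: "0 < a" "a \<le> 1" and pos: "0 < c \<or> k = 0"
  shows "(\<integral>\<^sup>+x. ennreal (sderiv0 d \<psi> (Suc k) (c + gen_inv \<psi> x) * gen_inv_dens d \<psi> x) * indicator {..a} x \<partial>lborel)
    = ennreal (sderiv0 d \<psi> k (c + gen_inv \<psi> a))"
proof -
  define b where "b = gen_inv \<psi> a"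
  have b: "0 \<le> b" using gen_inv_nonneg[OF gen a] by (simp add: b_def)
  have k1: "Suc k \<le> d - 1" using k d by simp
  note [measurable] = sderiv0_measurable[OF k1]
  have "(\<integral>\<^sup>+x. ennreal (sderiv0 d \<psi> (Suc k) (c + gen_inv \<psi> x) * gen_inv_dens d \<psi> x) * indicator {..a} x \<partial>lborel)
      = (\<integral>\<^sup>+t. ennreal (sderiv0 d \<psi> (Suc k) (c + t)) * indicator {t. b < t \<and> 0 < \<psi> t} t \<partial>lborel)"
    unfolding b_def by (rule nn_integral_gen_inv[OF _ a]) measurable
  also have "\<dots> = (\<integral>\<^sup>+t. ennreal (sderiv0 d \<psi> (Suc k) (c + t)) * indicator {c + b<..} (c + t) \<partial>lborel)"
    using sderiv_add_eq_0_AE[OF k1 c]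
  proof (intro nn_integral_cong_AE, eventually_elim)
    case (elim t)
    then show ?case using b c by (auto simp: indicator_def sderiv0_def)
  qed
  also have "\<dots> = (\<integral>\<^sup>+t. ennreal (sderiv0 d \<psi> (Suc k) t) * indicator {c + b<..} t \<partial>lborel)"
    by (subst (2) nn_integral_real_affine[where t = c and c = 1]) auto
  also have "\<dots> = (\<integral>\<^sup>+t. ennreal (- left_deriv (sderiv d \<psi> k) t) * indicator {c + b<..} t \<partial>lborel)"
    using b c sderiv_Suc[OF d mon k]
    by (intro nn_integral_cong) (auto simp: sderiv0_def indicator_def)
  also have "\<dots> = ennreal (sderiv d \<psi> k (c + b))"
  proof (rule nn_integral_left_deriv_Ioi)
    show "convex_on {0<..} (sderiv d \<psi> k)" "(sderiv d \<psi> k \<longlongrightarrow> 0) at_top"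
      using k sderiv_convex[OF d mon] sderiv_tendsto_0[OF d mon] by auto
    show "antimono_on {0<..} (sderiv d \<psi> k)" using k d by (intro sderiv_antimono[OF d mon]) auto
    show "0 \<le> c + b" using b c by simp
    show "(sderiv d \<psi> k \<longlongrightarrow> sderiv d \<psi> k (c + b)) (at_right (c + b))"
    proof (cases "0 < c + b")
      case True
      then have "isCont (sderiv d \<psi> k) (c + b)" using sderiv_isCont[OF d mon k] by simp
      then show ?thesis unfolding isCont_def by (rule tendsto_within_subset) auto
    next
      case False
      then have "c + b = 0" "k = 0" using pos b c by auto
      moreover have "(\<psi> \<longlongrightarrow> \<psi> 0) (at_right 0)"
      proof -
        have "(\<psi> \<longlongrightarrow> \<psi> 0) (at 0 within {0..})"
          using gen_continuous[OF gen] by (auto simp: continuous_on_def)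
        then show ?thesis by (rule tendsto_within_subset) auto
      qed
      ultimately show ?thesis using sderiv_0[OF d mon] by simp
    qed
  qed
  also have "sderiv d \<psi> k (c + b) = sderiv0 d \<psi> k (c + b)"
    using b c pos sderiv_0[OF d mon] gen_0[OF gen] by (auto simp: sderiv0_def order.order_iff_strict)
  finally show ?thesis by (simp add: b_def)
qed

text \<open>Offset \<open>c\<close> and order \<open>k\<close> account for coordinates already
  fixed: for a value \<open>y\<close> of the new coordinate the induction hypothesis is used with
  \<open>c + gen_inv \<psi> y\<close> and \<open>Suc k\<close>, and
  \<open>nn_integral_sderiv0_gen_inv\<close> then integrates over \<open>y\<close>.\<close>

lemma nn_integral_arch_dens:
  fixes I :: "nat set" and a :: "nat \<Rightarrow> real"
  assumes "finite I" "k + card I \<le> d - 1" "0 \<le> c" "0 < c \<or> k = 0" "\<And>i. i \<in> I \<Longrightarrow> 0 < a i \<and> a i \<le> 1"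
  shows "(\<integral>\<^sup>+x. ennreal (sderiv0 d \<psi> (k + card I) (c + (\<Sum>i\<in>I. gen_inv \<psi> (x i)))) *
        (\<Prod>i\<in>I. ennreal (gen_inv_dens d \<psi> (x i)) * indicator {..a i} (x i)) \<partial>PiM I (\<lambda>_. lborel))
    = ennreal (sderiv0 d \<psi> k (c + (\<Sum>i\<in>I. gen_inv \<psi> (a i))))"
  using assms
proof (induction I arbitrary: c k rule: finite_induct)
  case empty
  then show ?case by (simp add: lborel_PiM.nn_integral_empty PiM_empty)
next
  case (insert i I)
  define W where "W j x = ennreal (gen_inv_dens d \<psi> (x j)) * indicator {..a j} (x j)"
    for j and x :: "nat \<Rightarrow> real"
  define S where "S = (\<Sum>j\<in>I. gen_inv \<psi> (a j))"
  have S: "0 \<le> S" unfolding S_def using insert.prems by (intro sum_nonneg gen_inv_nonneg[OF gen]) auto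
  have card: "card (insert i I) = Suc (card I)" using insert.hyps by simp
  have k1: "Suc k + card I \<le> d - 1" using insert.prems card by simp
  note [measurable] = gen_inv_measurable gen_inv_dens_measurable sderiv0_measurable[OF k1]
  have comp [measurable]: "(\<lambda>x. gen_inv \<psi> (x j)) \<in> borel_measurable (PiM J (\<lambda>_. lborel))"
    "W j \<in> borel_measurable (PiM J (\<lambda>_. lborel))" if "j \<in> J" for j J
    unfolding W_def using that by measurable
  have meas: "(\<lambda>x. ennreal (sderiv0 d \<psi> (Suc k + card I) (c' + (\<Sum>j\<in>J. gen_inv \<psi> (x j)))) * (\<Prod>j\<in>J. W j x))
      \<in> borel_measurable (PiM J (\<lambda>_. lborel))" if "finite J" for J c'
    by (intro borel_measurable_times_ennreal borel_measurable_prod_ennreal measurable_compose[OF _ measurable_ennreal]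
        measurable_compose[OF _ sderiv0_measurable[OF k1]] borel_measurable_add borel_measurable_sum) (auto intro: comp)
  have upd: "(\<Sum>j\<in>I. gen_inv \<psi> ((x(i := y)) j)) = (\<Sum>j\<in>I. gen_inv \<psi> (x j))"
    "(\<Prod>j\<in>I. W j (x(i := y))) = (\<Prod>j\<in>I. W j x)"
    "W i (x(i := y)) = W i (\<lambda>_. y)" "gen_inv \<psi> ((x(i := y)) i) = gen_inv \<psi> y" for x y
    using insert.hyps by (auto intro!: sum.cong prod.cong simp: W_def)
  have "(\<integral>\<^sup>+x. ennreal (sderiv0 d \<psi> (Suc k + card I) (c + (\<Sum>j\<in>insert i I. gen_inv \<psi> (x j)))) *
        (\<Prod>j\<in>insert i I. W j x) \<partial>PiM (insert i I) (\<lambda>_. lborel))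
      = (\<integral>\<^sup>+y. (\<integral>\<^sup>+x. ennreal (sderiv0 d \<psi> (Suc k + card I) (c + gen_inv \<psi> y + (\<Sum>j\<in>I. gen_inv \<psi> (x j)))) *
          (\<Prod>j\<in>I. W j x) * W i (\<lambda>_. y) \<partial>PiM I (\<lambda>_. lborel)) \<partial>lborel)"
    using insert.hyps
    by (subst lborel_PiM.product_nn_integral_insert_rev[OF _ _ meas])
       (auto intro!: nn_integral_cong simp: upd ac_simps simp del: fun_upd_apply)
  also have "\<dots> = (\<integral>\<^sup>+y. ennreal (sderiv0 d \<psi> (Suc k) (c + S + gen_inv \<psi> y) * gen_inv_dens d \<psi> y) * indicator {..a i} y \<partial>lborel)"
  proof (rule nn_integral_cong)
    fix y :: real
    have "(\<integral>\<^sup>+x. ennreal (sderiv0 d \<psi> (Suc k + card I) (c + gen_inv \<psi> y + (\<Sum>j\<in>I. gen_inv \<psi> (x j)))) *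
          (\<Prod>j\<in>I. W j x) * W i (\<lambda>_. y) \<partial>PiM I (\<lambda>_. lborel))
        = (\<integral>\<^sup>+x. ennreal (sderiv0 d \<psi> (Suc k + card I) (c + gen_inv \<psi> y + (\<Sum>j\<in>I. gen_inv \<psi> (x j)))) *
          (\<Prod>j\<in>I. W j x) \<partial>PiM I (\<lambda>_. lborel)) * W i (\<lambda>_. y)"
      using insert.hyps by (intro nn_integral_multc meas)
    also have "\<dots> = ennreal (sderiv0 d \<psi> (Suc k) (c + S + gen_inv \<psi> y) * gen_inv_dens d \<psi> y) * indicator {..a i} y"
    \<comment> \<open>At order \<open>Suc k\<close> the induction hypothesis demands a positive
      offset, which \<open>0 < y < 1\<close> provides; for other \<open>y\<close> the weight is
      0.\<close>
    proof (cases "0 < y \<and> y < 1")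
      case True
      then have "0 < gen_inv \<psi> y" using gen_inv_pos[OF gen] by blast
      then have "(\<integral>\<^sup>+x. ennreal (sderiv0 d \<psi> (Suc k + card I) (c + gen_inv \<psi> y + (\<Sum>j\<in>I. gen_inv \<psi> (x j)))) *
          (\<Prod>j\<in>I. W j x) \<partial>PiM I (\<lambda>_. lborel)) = ennreal (sderiv0 d \<psi> (Suc k) (c + gen_inv \<psi> y + S))"
        unfolding W_def S_def using insert.prems k1 by (intro insert.IH) auto
      moreover have "0 \<le> sderiv0 d \<psi> (Suc k) (c + gen_inv \<psi> y + S)"
        using k1 by (intro sderiv0_nonneg) auto
      ultimately show ?thesis
        by (simp add: W_def ennreal_mult' mult.assoc add_ac)
    next
      case False
      then show ?thesis by (auto simp: W_def gen_inv_dens_def)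
    qed
    finally show "(\<integral>\<^sup>+x. ennreal (sderiv0 d \<psi> (Suc k + card I) (c + gen_inv \<psi> y + (\<Sum>j\<in>I. gen_inv \<psi> (x j)))) *
          (\<Prod>j\<in>I. W j x) * W i (\<lambda>_. y) \<partial>PiM I (\<lambda>_. lborel)) = \<dots>" .
  qed
  also have "\<dots> = ennreal (sderiv0 d \<psi> k (c + S + gen_inv \<psi> (a i)))"
    using insert.prems S k1 by (intro nn_integral_sderiv0_gen_inv) auto
  also have "c + S + gen_inv \<psi> (a i) = c + (\<Sum>j\<in>insert i I. gen_inv \<psi> (a j))"
    using insert.hyps by (simp add: S_def)
  finally show ?case using card by (simp add: W_def)
qed

end

section \<open>The marginal measures\<close>

text \<open>Lower orthants form an intersection-stable generator of the product sigma
  algebra.\<close>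

lemma PiM_eqI_atMost:
  fixes M N :: "(nat \<Rightarrow> real) measure"
  assumes I: "finite I" and sets: "sets M = sets (PiM I (\<lambda>_. lborel))" "sets N = sets (PiM I (\<lambda>_. lborel))"
    and fin: "finite_measure M"
    and eq: "\<And>a. emeasure M (PiE I (\<lambda>i. {..a i})) = emeasure N (PiE I (\<lambda>i. {..a i}))"
  shows "M = N"
proof -
  define \<Omega> :: "(nat \<Rightarrow> real) set" where "\<Omega> = PiE I (\<lambda>_. UNIV)"
  define E where "E = range (\<lambda>a :: nat \<Rightarrow> real. PiE I (\<lambda>i. {..a i}))"
  have E_sub: "E \<subseteq> Pow \<Omega>" by (auto simp: E_def \<Omega>_def PiE_iff)
  have bound: "\<exists>n :: nat. \<forall>i\<in>I. f i \<le> real n" for f :: "nat \<Rightarrow> real"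
  proof -
    obtain n :: nat where n: "(\<Sum>i\<in>I. \<bar>f i\<bar>) \<le> real n" using real_arch_simple by blast
    have "f i \<le> real n" if "i \<in> I" for i
      using member_le_sum[OF that, of "\<lambda>i. \<bar>f i\<bar>"] I n by force
    then show ?thesis by blast
  qed
  have sets_E: "sets (PiM I (\<lambda>_. lborel :: real measure)) = sigma_sets \<Omega> E"
  proof
    have sp: "space (sigma \<Omega> E) = \<Omega>" "sets (sigma \<Omega> E) = sigma_sets \<Omega> E"
      using E_sub by simp_all
    have "sets (PiM I (\<lambda>_. lborel :: real measure)) \<subseteq> sets (sigma \<Omega> E)"
    proof (rule sets_PiM_in_sets)
      fix i and A :: "real set" assume i: "i \<in> I" and A: "A \<in> sets lborel"
      have "(\<lambda>x. x i) \<in> borel_measurable (sigma \<Omega> E)"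
      proof (rule borel_measurableI_le)
        fix y :: real
        \<comment> \<open>A half space is exhausted by orthants whose remaining bounds grow through
          the naturals.\<close>
        have "{x \<in> \<Omega>. x i \<le> y} = (\<Union>n::nat. PiE I (\<lambda>j. {..if j = i then y else real n}))"
        proof (intro set_eqI iffI)
          fix x assume x: "x \<in> {x \<in> \<Omega>. x i \<le> y}"
          obtain n where "\<forall>j\<in>I. x j \<le> real n" using bound by blast
          then have "x \<in> PiE I (\<lambda>j. {..if j = i then y else real n})"
            using x by (auto simp: \<Omega>_def PiE_iff)
          then show "x \<in> (\<Union>n::nat. PiE I (\<lambda>j. {..if j = i then y else real n}))" by blast
        next
          fix x assume "x \<in> (\<Union>n::nat. PiE I (\<lambda>j. {..if j = i then y else real n}))"
          then obtain n :: nat where "x \<in> PiE I (\<lambda>j. {..if j = i then y else real n})" by blast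
          then show "x \<in> {x \<in> \<Omega>. x i \<le> y}" using i by (auto simp: \<Omega>_def PiE_iff split: if_splits)
        qed
        also have "\<dots> \<in> sets (sigma \<Omega> E)"
        proof (rule sets.countable_UN, safe)
          fix n :: nat
          show "PiE I (\<lambda>j. {..if j = i then y else real n}) \<in> sets (sigma \<Omega> E)"
            unfolding sp by (rule sigma_sets.Basic) (auto simp: E_def)
        qed
        finally show "{x \<in> space (sigma \<Omega> E). x i \<le> y} \<in> sets (sigma \<Omega> E)" unfolding sp(1) .
      qed
      then have "(\<lambda>x. x i) -` A \<inter> space (sigma \<Omega> E) \<in> sets (sigma \<Omega> E)"
        using A by (intro measurable_sets) auto
      then show "{x \<in> space (sigma \<Omega> E). x i \<in> A} \<in> sets (sigma \<Omega> E)"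
        by (simp add: vimage_def Int_def conj_commute)
    qed (simp only: sp(1), simp add: \<Omega>_def)
    then show "sets (PiM I (\<lambda>_. lborel :: real measure)) \<subseteq> sigma_sets \<Omega> E" unfolding sp .
    have "E \<subseteq> sets (PiM I (\<lambda>_. lborel :: real measure))"
      using I by (auto simp: E_def intro!: sets_PiM_I_finite)
    moreover have "space (PiM I (\<lambda>_. lborel :: real measure)) = \<Omega>" by (simp add: space_PiM \<Omega>_def)
    ultimately show "sigma_sets \<Omega> E \<subseteq> sets (PiM I (\<lambda>_. lborel :: real measure))"
      using sets.sigma_sets_subset by metis
  qed
  show ?thesis
  proof (rule measure_eqI_generator_eq[where A = "\<lambda>n :: nat. PiE I (\<lambda>_. {..real n})"])
    show "Int_stable E"
    proof (rule Int_stableI)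
      fix X Y assume "X \<in> E" "Y \<in> E"
      then obtain a b where "X = PiE I (\<lambda>i. {..a i})" "Y = PiE I (\<lambda>i. {..b i})" by (auto simp: E_def)
      then have "X \<inter> Y = PiE I (\<lambda>i. {..min (a i) (b i)})" by (auto simp: PiE_iff)
      then show "X \<inter> Y \<in> E" by (auto simp: E_def)
    qed
    show "(\<Union>n::nat. PiE I (\<lambda>_. {..real n})) = \<Omega>"
      using bound by (auto simp: \<Omega>_def PiE_iff)
    show "emeasure M (PiE I (\<lambda>_. {..real n})) \<noteq> \<infinity>" for n
      using finite_measure.emeasure_finite[OF fin] by simp
  qed (use E_sub eq sets sets_E in \<open>auto simp: E_def\<close>)
qed

lemma indicator_PiE:
  assumes "x \<in> extensional I" "finite I"
  shows "(indicator (PiE I A) x :: ennreal) = (\<Prod>i\<in>I. indicator (A i) (x i))"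
proof (cases "x \<in> PiE I A")
  case True
  then have "(\<Prod>i\<in>I. indicator (A i) (x i) :: ennreal) = 1" by (intro prod.neutral) (auto simp: PiE_iff)
  then show ?thesis using True by simp
next
  case False
  then obtain i where "i \<in> I" "x i \<notin> A i" using assms by (auto simp: PiE_iff)
  then have "(\<Prod>i\<in>I. indicator (A i) (x i) :: ennreal) = 0" using assms by (intro prod_zero) (auto simp: indicator_def)
  then show ?thesis using False by simp
qed

lemma (in prob_space) prob_Int_eq:
  assumes "A \<in> events" "B \<in> events" "prob B = 1"
  shows "prob (A \<inter> B) = prob A"
proof -
  have "prob (A - B) \<le> prob (space M - B)"
    using assms sets.sets_into_space by (intro finite_measure_mono) auto
  then have "prob (A - B) = 0" using assms prob_compl[of B] measure_nonneg[of M "A - B"] by simp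
  moreover have "prob A = prob (A \<inter> B) + prob (A - B)"
    using assms finite_measure_Union[of "A \<inter> B" "A - B"] by (simp add: Int_Diff_Un Int_Diff_disjoint)
  ultimately show ?thesis by simp
qed

text \<open>\<open>copula_measure\<close> constrains only orthants with corner in the cube. Mass 1
  below the corner with all coordinates 1 lets any corner be capped at 1; mass 0 below corners with
  a zero coordinate settles those with a negative one.\<close>

lemma cdf_measure_unique:
  assumes sets: "sets M = sets (PiM {..<m} (\<lambda>_. lborel))" "sets N = sets (PiM {..<m} (\<lambda>_. lborel))"
    and prob: "prob_space M" "prob_space N"
    and eq: "\<And>x. x \<in> cube m \<Longrightarrow> measure M (PiE {..<m} (\<lambda>i. {..x i})) = F x"
      "\<And>x. x \<in> cube m \<Longrightarrow> measure N (PiE {..<m} (\<lambda>i. {..x i})) = F x"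
    and top: "F (restrict (\<lambda>_. 1) {..<m}) = 1"
    and bot: "\<And>x i. x \<in> cube m \<Longrightarrow> i < m \<Longrightarrow> x i = 0 \<Longrightarrow> F x = 0"
  shows "M = N"
proof (rule PiM_eqI_atMost[OF _ sets])
  show "finite_measure M" using prob(1) by (rule prob_space.finite_measure)
  define R where "R a = PiE {..<m} (\<lambda>i. {..a i :: real})" for a
  have R_sets: "R a \<in> sets P" if "sets P = sets (PiM {..<m} (\<lambda>_. lborel))" for a P
    unfolding R_def that by (intro sets_PiM_I_finite) auto
  define p where "p a = restrict (\<lambda>i. max 0 (min 1 (a i))) {..<m}" for a :: "nat \<Rightarrow> real"
  have p: "p a \<in> cube m" for a by (auto simp: p_def cube_def)
  have measure_R: "measure P (R a) = (if \<exists>i<m. a i < 0 then 0 else F (p a))"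
    if P: "sets P = sets (PiM {..<m} (\<lambda>_. lborel))" "prob_space P"
      and F: "\<And>x. x \<in> cube m \<Longrightarrow> measure P (R x) = F x" for P a
  proof -
    interpret prob_space P by fact
    define o1 :: "nat \<Rightarrow> real" where "o1 = restrict (\<lambda>_. 1) {..<m}"
    have o1: "o1 \<in> cube m" by (simp add: o1_def cube_def)
    have "measure P (R o1) = 1" using F[OF o1] top by (simp add: o1_def)
    then have "measure P (R a \<inter> R o1) = measure P (R a)"
      by (intro prob_Int_eq R_sets P)
    moreover have R_Int: "R a \<inter> R o1 = R (\<lambda>i. min 1 (a i))"
      unfolding R_def PiE_Int by (intro PiE_cong) (auto simp: o1_def)
    ultimately have eq_min: "measure P (R a) = measure P (R (\<lambda>i. min 1 (a i)))" by simp
    show ?thesis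
    proof (cases "\<exists>i<m. a i < 0")
      case True
      then obtain i where i: "i < m" "a i < 0" by blast
      have "p a i = 0" using i by (simp add: p_def)
      then have "measure P (R (p a)) = 0" using F[OF p] bot[OF p i(1)] by simp
      moreover have "R (\<lambda>i. min 1 (a i)) \<subseteq> R (p a)"
        unfolding R_def by (intro PiE_mono) (auto simp: p_def)
      then have "measure P (R (\<lambda>i. min 1 (a i))) \<le> measure P (R (p a))"
        by (rule finite_measure_mono) (rule R_sets[OF P(1)])
      ultimately show ?thesis using True eq_min measure_nonneg[of P "R (\<lambda>i. min 1 (a i))"] by simp
    next
      case False
      then have nonneg: "0 \<le> a i" if "i < m" for i using that by (meson not_less)
      have "R (\<lambda>i. min 1 (a i)) = R (p a)"
        unfolding R_def by (intro PiE_cong) (simp add: p_def nonneg max_absorb2)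
      then have "measure P (R a) = F (p a)" using F[OF p] eq_min by simp
      with False show ?thesis by (simp only: if_False)
    qed
  qed
  interpret M: prob_space M by fact
  interpret N: prob_space N by fact
  fix a
  have "measure M (R a) = measure N (R a)"
    using measure_R[OF sets(1) prob(1)] measure_R[OF sets(2) prob(2)] eq unfolding R_def by simp
  then show "emeasure M (PiE {..<m} (\<lambda>i. {..a i})) = emeasure N (PiE {..<m} (\<lambda>i. {..a i}))"
    unfolding R_def by (simp add: M.emeasure_eq_measure N.emeasure_eq_measure)
qed simp

section \<open>The measure with density \<open>arch_dens\<close>\<close>

lemma arch_dens_eq_0:
  assumes "finite I" "i \<in> I" "x i \<notin> {0<..<1}"
  shows "arch_dens d \<psi> I x = 0"
proof -
  have "gen_inv_dens d \<psi> (x i) = 0" using assms(3) by (simp only: gen_inv_dens_def if_False)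
  then have "(\<Prod>i\<in>I. gen_inv_dens d \<psi> (x i)) = 0" using assms(1,2) by (intro prod_zero) auto
  then show ?thesis by (simp add: arch_dens_def)
qed

definition arch_measure :: "nat \<Rightarrow> (real \<Rightarrow> real) \<Rightarrow> nat \<Rightarrow> (nat \<Rightarrow> real) measure" where
  "arch_measure d \<psi> m = density (PiM {..<m} (\<lambda>_. lborel)) (\<lambda>x. ennreal (arch_dens d \<psi> {..<m} x))"

lemma sets_arch_measure [simp]: "sets (arch_measure d \<psi> m) = sets (PiM {..<m} (\<lambda>_. lborel))"
  by (simp add: arch_measure_def)

context
  fixes d m :: nat and \<psi> :: "real \<Rightarrow> real"
  assumes d: "3 \<le> d" and mon: "d_monotone d \<psi>" and m: "m \<le> d - 1"
begin

private lemmas gen_m = d_monotone_gen[OF d mon]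

lemma arch_dens_nonneg: "0 \<le> arch_dens d \<psi> {..<m} x"
  unfolding arch_dens_def using m
  by (intro mult_nonneg_nonneg prod_nonneg sderiv0_nonneg[OF d mon] gen_inv_dens_nonneg[OF d mon] ballI) simp_all

lemma ennreal_arch_dens:
  "ennreal (arch_dens d \<psi> {..<m} x) = ennreal (sderiv0 d \<psi> m (\<Sum>i<m. gen_inv \<psi> (x i))) *
    (\<Prod>i<m. ennreal (gen_inv_dens d \<psi> (x i)))"
  unfolding arch_dens_def
  using sderiv0_nonneg[OF d mon m] gen_inv_dens_nonneg[OF d mon]
  by (simp add: ennreal_mult' prod_ennreal)

lemma arch_dens_borel [measurable]:
  "arch_dens d \<psi> {..<m} \<in> borel_measurable (PiM {..<m} (\<lambda>_. lborel))"
  using m by (intro arch_dens_measurable[OF d mon]) auto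

lemma emeasure_arch_measure:
  assumes a: "a \<in> cube m"
  shows "emeasure (arch_measure d \<psi> m) (PiE {..<m} (\<lambda>i. {..a i})) = ennreal (arch_copula m \<psi> a)"
proof -
  let ?P = "PiM {..<m} (\<lambda>_. lborel :: real measure)"
  have "emeasure (arch_measure d \<psi> m) (PiE {..<m} (\<lambda>i. {..a i}))
      = (\<integral>\<^sup>+x. ennreal (arch_dens d \<psi> {..<m} x) * indicator (PiE {..<m} (\<lambda>i. {..a i})) x \<partial>?P)"
    unfolding arch_measure_def by (intro emeasure_density) (auto intro!: sets_PiM_I_finite)
  also have "\<dots> = (\<integral>\<^sup>+x. ennreal (sderiv0 d \<psi> (0 + card {..<m}) (0 + (\<Sum>i<m. gen_inv \<psi> (x i)))) *
        (\<Prod>i<m. ennreal (gen_inv_dens d \<psi> (x i)) * indicator {..a i} (x i)) \<partial>?P)"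
    by (intro nn_integral_cong)
       (auto simp: ennreal_arch_dens space_PiM PiE_iff indicator_PiE prod.distrib mult.assoc)
  also have "\<dots> = ennreal (arch_copula m \<psi> a)"
  \<comment> \<open>\<open>nn_integral_arch_dens\<close> takes positive corners. With a zero
    coordinate both sides vanish, the integral because \<open>gen_inv_dens\<close> is 0 for
    \<open>x i \<le> 0\<close>.\<close>
  proof (cases "\<exists>i<m. a i = 0")
    case True
    then obtain i where i: "i < m" "a i = 0" by blast
    have "(\<Prod>i<m. ennreal (gen_inv_dens d \<psi> (x i)) * indicator {..a i} (x i)) = 0" for x
      using i by (intro prod_zero) (auto intro!: bexI[of _ i] simp: gen_inv_dens_def indicator_def)
    then show ?thesis unfolding arch_copula_zero[OF gen_m, of i m a, OF i] by (simp only: mult_zero_right) simp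
  next
    case False
    then have a': "0 < a i \<and> a i \<le> 1" if "i < m" for i using a that by (force simp: cube_def PiE_iff)
    have S: "0 \<le> (\<Sum>i<m. gen_inv \<psi> (a i))" using a' gen_inv_nonneg[OF gen_m] by (intro sum_nonneg) auto
    have "(\<integral>\<^sup>+x. ennreal (sderiv0 d \<psi> (0 + card {..<m}) (0 + (\<Sum>i<m. gen_inv \<psi> (x i)))) *
        (\<Prod>i<m. ennreal (gen_inv_dens d \<psi> (x i)) * indicator {..a i} (x i)) \<partial>?P)
      = ennreal (sderiv0 d \<psi> 0 (0 + (\<Sum>i<m. gen_inv \<psi> (a i))))"
      using m a' by (intro nn_integral_arch_dens[OF d mon]) auto
    also have "sderiv0 d \<psi> 0 (0 + (\<Sum>i<m. gen_inv \<psi> (a i))) = arch_copula m \<psi> a"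
      using S gen_0[OF gen_m] sderiv_0[OF d mon] arch_copula_pos[OF gen_m a']
      by (auto simp: sderiv0_def order.order_iff_strict)
    finally show ?thesis .
  qed
  finally show ?thesis .
qed

lemma arch_copula_top: "arch_copula m \<psi> (restrict (\<lambda>_. 1) {..<m}) = 1"
  using gen_0[OF gen_m] gen_inv_1[OF gen_m] by (subst arch_copula_pos[OF gen_m]) auto

lemma prob_space_arch_measure: "prob_space (arch_measure d \<psi> m)"
proof
  let ?P = "PiM {..<m} (\<lambda>_. lborel :: real measure)"
  define o1 :: "nat \<Rightarrow> real" where "o1 = restrict (\<lambda>_. 1) {..<m}"
  have "emeasure (arch_measure d \<psi> m) (space (arch_measure d \<psi> m))
      = (\<integral>\<^sup>+x. ennreal (arch_dens d \<psi> {..<m} x) \<partial>?P)"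
    unfolding arch_measure_def by (subst emeasure_density) (auto intro!: nn_integral_cong)
  also have "\<dots> = (\<integral>\<^sup>+x. ennreal (arch_dens d \<psi> {..<m} x) * indicator (PiE {..<m} (\<lambda>i. {..o1 i})) x \<partial>?P)"
  proof (rule nn_integral_cong)
    fix x assume x: "x \<in> space ?P"
    show "ennreal (arch_dens d \<psi> {..<m} x)
        = ennreal (arch_dens d \<psi> {..<m} x) * indicator (PiE {..<m} (\<lambda>i. {..o1 i})) x"
    proof (cases "\<exists>i<m. 1 < x i")
      case True
      then obtain i where "i < m" "1 < x i" by blast
      then have "arch_dens d \<psi> {..<m} x = 0" by (intro arch_dens_eq_0[of _ i]) auto
      then show ?thesis by simp
    next
      case False
      then have "x i \<le> o1 i" if "i < m" for i using that by (simp add: o1_def) (meson not_less)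
      then have "x \<in> PiE {..<m} (\<lambda>i. {..o1 i})" using x by (auto simp: space_PiM PiE_iff)
      then show ?thesis by simp
    qed
  qed
  also have "\<dots> = emeasure (arch_measure d \<psi> m) (PiE {..<m} (\<lambda>i. {..o1 i}))"
    unfolding arch_measure_def by (intro emeasure_density[symmetric]) (auto intro!: sets_PiM_I_finite)
  also have "\<dots> = 1" using emeasure_arch_measure[of o1] arch_copula_top by (simp add: o1_def cube_def)
  finally show "emeasure (arch_measure d \<psi> m) (space (arch_measure d \<psi> m)) = 1" .
qed

lemma measure_arch_measure:
  assumes "a \<in> cube m"
  shows "measure (arch_measure d \<psi> m) (PiE {..<m} (\<lambda>i. {..a i})) = arch_copula m \<psi> a"
  using emeasure_arch_measure[OF assms] arch_copula_nonneg[OF gen_m] by (simp add: measure_def)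

text \<open>\<open>copula_measure\<close> is a Hilbert choice: \<open>arch_measure\<close> shows
  that a candidate exists, \<open>cdf_measure_unique\<close> that there is no other.\<close>

lemma copula_measure_eq: "copula_measure m (marg (arch_copula d \<psi>) m) = arch_measure d \<psi> m"
proof -
  have marg: "marg (arch_copula d \<psi>) m = arch_copula m \<psi>"
    using marg_arch_copula[OF gen_m] m by auto
  define Q where "Q M \<longleftrightarrow> sets M = sets (PiM {..<m} (\<lambda>_. lborel)) \<and> prob_space M \<and>
      (\<forall>x \<in> cube m. measure M (PiE {..<m} (\<lambda>i. {..x i})) = arch_copula m \<psi> x)" for M
  have Q: "Q (arch_measure d \<psi> m)"
    using prob_space_arch_measure measure_arch_measure by (simp add: Q_def)
  then have "Q (SOME M. Q M)" by (rule someI)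
  then have "(SOME M. Q M) = arch_measure d \<psi> m"
    using Q arch_copula_top arch_copula_zero[OF gen_m] unfolding Q_def
    by (intro cdf_measure_unique[where F = "arch_copula m \<psi>"]) auto
  then show ?thesis unfolding copula_measure_def marg Q_def .
qed

lemma marg_density_AE:
  "AE x in PiM {..<m} (\<lambda>_. lborel). marg_density m (arch_copula d \<psi>) x = ennreal (arch_dens d \<psi> {..<m} x)"
proof -
  interpret sigma_finite_measure "PiM {..<m} (\<lambda>_. lborel :: real measure)"
    by (rule lborel_PiM.sigma_finite) simp
  have "AE x in PiM {..<m} (\<lambda>_. lborel). ennreal (arch_dens d \<psi> {..<m} x)
      = RN_deriv (PiM {..<m} (\<lambda>_. lborel)) (arch_measure d \<psi> m) x"
    by (intro RN_deriv_unique) (auto simp: arch_measure_def)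
  then show ?thesis unfolding marg_density_def copula_measure_eq by eventually_elim simp
qed

text \<open>The level sets of \<open>\<Sum>i. gen_inv \<psi> (x i)\<close> in the open cube are graphs over any \<open>m - 1\<close> coordinates.\<close>

lemma AE_sum_gen_inv_neq:
  assumes "0 < m"
  shows "AE x in PiM {..<m} (\<lambda>_. lborel). (\<forall>i<m. x i \<in> {0<..<1}) \<longrightarrow> (\<Sum>i<m. gen_inv \<psi> (x i)) \<noteq> t"
proof -
  let ?P = "\<lambda>I. PiM I (\<lambda>_ :: nat. lborel :: real measure)"
  define k where "k = m - 1"
  have mk: "{..<m} = insert k {..<k}" "k \<notin> {..<k}" using assms by (auto simp: k_def)
  note [measurable] = gen_inv_measurable[OF d mon]
  define A where "A = {x \<in> space (?P {..<m}). (\<forall>i<m. x i \<in> {0<..<1}) \<and> (\<Sum>i<m. gen_inv \<psi> (x i)) = t}"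
  have comp [measurable]: "(\<lambda>x. gen_inv \<psi> (x i)) \<in> borel_measurable (?P {..<m})" if "i \<in> {..<m}" for i
    using that by measurable
  have A: "A \<in> sets (?P {..<m})" unfolding A_def by measurable
  have "emeasure (?P {..<m}) A = (\<integral>\<^sup>+x. indicator A x \<partial>?P (insert k {..<k}))"
    using A mk(1) by simp
  also have "\<dots> = (\<integral>\<^sup>+x. (\<integral>\<^sup>+y. indicator A (x(k := y)) \<partial>lborel) \<partial>?P {..<k})"
    using A mk by (intro lborel_PiM.product_nn_integral_insert) auto
  also have "\<dots> = (\<integral>\<^sup>+x. 0 \<partial>?P {..<k})"
  proof (rule nn_integral_cong)
    fix x :: "nat \<Rightarrow> real"
    \<comment> \<open>Given the first \<open>k\<close> coordinates, the level set determines
      \<open>gen_inv \<psi> y\<close>, so \<open>c\<close> is the only possible last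
      coordinate.\<close>
    define c where "c = \<psi> (t - (\<Sum>i<k. gen_inv \<psi> (x i)))"
    have "x(k := y) \<notin> A" if "y \<noteq> c" for y
    proof
      assume "x(k := y) \<in> A"
      then have y: "0 < y" "y < 1" "(\<Sum>i<m. gen_inv \<psi> ((x(k := y)) i)) = t"
        using mk by (auto simp: A_def dest: spec[of _ k])
      have "(\<Sum>i<m. gen_inv \<psi> ((x(k := y)) i)) = gen_inv \<psi> y + (\<Sum>i<k. gen_inv \<psi> (x i))"
        unfolding mk(1) by (subst sum.insert) auto
      then have "gen_inv \<psi> y = t - (\<Sum>i<k. gen_inv \<psi> (x i))" using y by simp
      then have "c = \<psi> (gen_inv \<psi> y)" by (simp add: c_def)
      then show False using that gen_gen_inv[OF gen_m, of y] y by simp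
    qed
    then have "AE y in lborel. indicator A (x(k := y)) = (0 :: ennreal)"
      using AE_lborel_singleton[of c] by (auto elim!: eventually_mono)
    then show "(\<integral>\<^sup>+y. indicator A (x(k := y)) \<partial>lborel) = 0"
      by (subst nn_integral_cong_AE[where v = "\<lambda>_. 0"]) auto
  qed
  finally have "A \<in> null_sets (?P {..<m})" using A by auto
  then show ?thesis by (rule AE_I') (auto simp: A_def)
qed

lemma AE_sum_gen_inv_notin:
  assumes "0 < m" "countable D"
  shows "AE x in PiM {..<m} (\<lambda>_. lborel). (\<forall>i<m. x i \<in> {0<..<1}) \<longrightarrow> (\<Sum>i<m. gen_inv \<psi> (x i)) \<notin> D"
proof -
  have "AE x in PiM {..<m} (\<lambda>_. lborel). \<forall>t\<in>D. (\<forall>i<m. x i \<in> {0<..<1}) \<longrightarrow> (\<Sum>i<m. gen_inv \<psi> (x i)) \<noteq> t"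
    using AE_sum_gen_inv_neq[OF assms(1)] assms(2) by (subst AE_ball_countable) auto
  then show ?thesis by eventually_elim auto
qed

lemma sum_gen_inv_pos:
  assumes "0 < m" "\<And>i. i < m \<Longrightarrow> x i \<in> {0<..<1}"
  shows "0 < (\<Sum>i<m. gen_inv \<psi> (x i))"
  using assms gen_inv_pos[OF gen_m] by (intro sum_pos) auto

end

section \<open>Convergence of densities and of distribution functions\<close>

text \<open>Fatou bounds the masses of every set asymptotically from below; applied to the
  complement, with all total masses 1, it bounds those of \<open>A\<close> from above.\<close>

lemma measure_density_tendsto:
  fixes f :: "'a \<Rightarrow> ennreal" and fs :: "nat \<Rightarrow> 'a \<Rightarrow> ennreal"
  assumes meas [measurable]: "\<And>n. fs n \<in> borel_measurable M" "f \<in> borel_measurable M"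
    and prob: "\<And>n. prob_space (density M (fs n))" "prob_space (density M f)"
    and lim: "AE x in M. (\<lambda>n. fs n x) \<longlonglongrightarrow> f x" and A: "A \<in> sets M"
  shows "(\<lambda>n. measure (density M (fs n)) A) \<longlonglongrightarrow> measure (density M f) A"
proof -
  interpret N: prob_space "density M f" by fact
  interpret Ns: prob_space "density M (fs n)" for n by fact
  have low: "\<forall>\<^sub>F n in sequentially. c < measure (density M (fs n)) B"
    if B [measurable]: "B \<in> sets M" and c: "c < measure (density M f) B" for B c
  proof (cases "c < 0")
    case True
    then show ?thesis by (intro always_eventually allI) (rule less_le_trans[OF _ measure_nonneg])
  next
    case False
    have "emeasure (density M f) B = (\<integral>\<^sup>+x. liminf (\<lambda>n. fs n x * indicator B x) \<partial>M)"
      unfolding emeasure_density[OF meas(2) B]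
    proof (rule nn_integral_cong_AE, use lim in eventually_elim)
      case (elim x)
      have "(\<lambda>n. fs n x * indicator B x) \<longlonglongrightarrow> f x * indicator B x"
        using elim by (cases "x \<in> B") auto
      then show ?case by (intro lim_imp_Liminf[symmetric]) auto
    qed
    also have "\<dots> \<le> liminf (\<lambda>n. \<integral>\<^sup>+x. fs n x * indicator B x \<partial>M)"
      by (rule nn_integral_liminf) measurable
    also have "\<dots> = liminf (\<lambda>n. emeasure (density M (fs n)) B)"
      using B by (simp add: emeasure_density)
    finally have "emeasure (density M f) B \<le> liminf (\<lambda>n. emeasure (density M (fs n)) B)" .
    moreover have "ennreal c < emeasure (density M f) B"
      using c False by (simp add: N.emeasure_eq_measure ennreal_less_iff)
    ultimately have "\<forall>\<^sub>F n in sequentially. ennreal c < emeasure (density M (fs n)) B"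
      by (simp add: le_Liminf_iff)
    then show ?thesis
      using False by (simp add: Ns.emeasure_eq_measure ennreal_less_iff)
  qed
  show ?thesis
  proof (rule order_tendstoI)
    fix c assume "c < measure (density M f) A"
    then show "\<forall>\<^sub>F n in sequentially. c < measure (density M (fs n)) A" by (rule low[OF A])
  next
    fix c assume c: "measure (density M f) A < c"
    have "measure (density M f) (space M - A) = 1 - measure (density M f) A"
      using N.prob_compl[of A] A by simp
    then have "\<forall>\<^sub>F n in sequentially. 1 - c < measure (density M (fs n)) (space M - A)"
      using c A by (intro low) auto
    moreover have "measure (density M (fs n)) (space M - A) = 1 - measure (density M (fs n)) A" for n
      using Ns.prob_compl[of A n] A by simp
    ultimately show "\<forall>\<^sub>F n in sequentially. measure (density M (fs n)) A < c" by simp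
  qed
qed

context
  fixes d m :: nat and \<psi> :: "real \<Rightarrow> real" and \<psi>s :: "nat \<Rightarrow> real \<Rightarrow> real"
  assumes d: "3 \<le> d" and mon: "d_monotone d \<psi>" and mons: "\<And>n. d_monotone d (\<psi>s n)"
    and m: "0 < m" "m \<le> d - 1"
begin

private lemmas genl = d_monotone_gen[OF d mon]
private lemmas gensl = d_monotone_gen[OF d mons]

text \<open>Function and argument both vary with \<open>n\<close>, hence
  \<open>sderiv_tendsto_moving\<close>. The factors of the product involve order 1, which is
  continuous as \<open>d \<ge> 3\<close>; the continuity condition concerns order \<open>m\<close>,
  which may be the last.\<close>

lemma arch_dens_tendsto:
  assumes lim: "\<And>x. 0 \<le> x \<Longrightarrow> (\<lambda>n. \<psi>s n x) \<longlonglongrightarrow> \<psi> x"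
    and x: "(\<forall>i<m. x i \<in> {0<..<1}) \<longrightarrow> isCont (sderiv d \<psi> m) (\<Sum>i<m. gen_inv \<psi> (x i))"
  shows "(\<lambda>n. arch_dens d (\<psi>s n) {..<m} x) \<longlonglongrightarrow> arch_dens d \<psi> {..<m} x"
proof (cases "\<forall>i<m. x i \<in> {0<..<1}")
  case False
  then obtain i where "i < m" "x i \<notin> {0<..<1}" by blast
  then have "arch_dens d \<phi> {..<m} x = 0" for \<phi> by (intro arch_dens_eq_0[of _ i]) auto
  then show ?thesis by simp
next
  case True
  have inv: "(\<lambda>n. gen_inv (\<psi>s n) (x i)) \<longlonglongrightarrow> gen_inv \<psi> (x i)" if "i < m" for i
    using True that by (intro tendsto_gen_inv[OF genl gensl lim]) (auto simp: less_imp_le)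
  have S: "(\<lambda>n. \<Sum>i<m. gen_inv (\<psi>s n) (x i)) \<longlonglongrightarrow> (\<Sum>i<m. gen_inv \<psi> (x i))"
    using inv by (intro tendsto_sum) auto
  have pos: "0 < (\<Sum>i<m. gen_inv \<psi> (x i))" "0 < (\<Sum>i<m. gen_inv (\<psi>s n) (x i))" for n
    using sum_gen_inv_pos[OF d mon m(2,1)] sum_gen_inv_pos[OF d mons m(2,1)] True by auto
  have "(\<lambda>n. sderiv d (\<psi>s n) m (\<Sum>i<m. gen_inv (\<psi>s n) (x i))) \<longlonglongrightarrow> sderiv d \<psi> m (\<Sum>i<m. gen_inv \<psi> (x i))"
    by (rule sderiv_tendsto_moving[OF d mon mons lim]) (use m x True S pos in auto)
  moreover have "(\<lambda>n. gen_inv_dens d (\<psi>s n) (x i)) \<longlonglongrightarrow> gen_inv_dens d \<psi> (x i)" if i: "i < m" for i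
  proof -
    have xi: "0 < x i" "x i < 1" using True i by auto
    have "(\<lambda>n. sderiv d (\<psi>s n) 1 (gen_inv (\<psi>s n) (x i))) \<longlonglongrightarrow> sderiv d \<psi> 1 (gen_inv \<psi> (x i))"
      by (rule sderiv_tendsto_moving[OF d mon mons lim])
         (use d inv[OF i] gen_inv_pos[OF genl xi] sderiv_isCont[OF d mon] in auto)
    then have "(\<lambda>n. inverse (sderiv d (\<psi>s n) 1 (gen_inv (\<psi>s n) (x i)))) \<longlonglongrightarrow> inverse (sderiv d \<psi> 1 (gen_inv \<psi> (x i)))"
      by (rule tendsto_inverse) (use sderiv_gen_inv_pos[OF d mon xi] in simp)
    then show ?thesis using xi by (simp add: gen_inv_dens_def)
  qed
  ultimately show ?thesis
    unfolding arch_dens_def sderiv0_def using pos by (simp) (intro tendsto_mult tendsto_prod; simp)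
qed

lemma AE_arch_dens_tendsto:
  assumes lim: "\<And>x. 0 \<le> x \<Longrightarrow> (\<lambda>n. \<psi>s n x) \<longlonglongrightarrow> \<psi> x"
  shows "AE x in PiM {..<m} (\<lambda>_. lborel). (\<lambda>n. arch_dens d (\<psi>s n) {..<m} x) \<longlonglongrightarrow> arch_dens d \<psi> {..<m} x"
  using AE_sum_gen_inv_notin[OF d mon m(2,1) countable_discont_antimono[OF sderiv_antimono[OF d mon m(2)]]]
proof eventually_elim
  case (elim x)
  have "isCont (sderiv d \<psi> m) (\<Sum>i<m. gen_inv \<psi> (x i))" if x: "\<forall>i<m. x i \<in> {0<..<1}"
  proof -
    have "0 < (\<Sum>i<m. gen_inv \<psi> (x i))" using x by (intro sum_gen_inv_pos[OF d mon m(2,1)]) auto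
    then show ?thesis using elim x by auto
  qed
  then show ?case by (intro arch_dens_tendsto impI lim)
qed

text \<open>Off the cube \<open>arch_dens\<close> vanishes for every generator, so the restriction
  to the cube disappears; the null sets of the countably many Radon-Nikodym versions are merged
  first.\<close>

lemma AE_marg_density_tendsto_iff:
  "(AE x in PiM {..<m} (\<lambda>_. lborel). x \<in> cube m \<longrightarrow>
      (\<lambda>n. marg_density m (arch_copula d (\<psi>s n)) x) \<longlonglongrightarrow> marg_density m (arch_copula d \<psi>) x)
    \<longleftrightarrow> (AE x in PiM {..<m} (\<lambda>_. lborel). (\<lambda>n. arch_dens d (\<psi>s n) {..<m} x) \<longlonglongrightarrow> arch_dens d \<psi> {..<m} x)"
proof -
  have "AE x in PiM {..<m} (\<lambda>_. lborel). \<forall>n.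
      marg_density m (arch_copula d (\<psi>s n)) x = ennreal (arch_dens d (\<psi>s n) {..<m} x)"
    unfolding AE_all_countable using marg_density_AE[OF d mons m(2)] by blast
  with marg_density_AE[OF d mon m(2)]
  have "AE x in PiM {..<m} (\<lambda>_. lborel).
      (x \<in> cube m \<longrightarrow> (\<lambda>n. marg_density m (arch_copula d (\<psi>s n)) x) \<longlonglongrightarrow> marg_density m (arch_copula d \<psi>) x)
      \<longleftrightarrow> (\<lambda>n. arch_dens d (\<psi>s n) {..<m} x) \<longlonglongrightarrow> arch_dens d \<psi> {..<m} x"
    using AE_space
  proof eventually_elim
    case (elim x)
    have "(\<lambda>n. ennreal (arch_dens d (\<psi>s n) {..<m} x)) \<longlonglongrightarrow> ennreal (arch_dens d \<psi> {..<m} x)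
        \<longleftrightarrow> (\<lambda>n. arch_dens d (\<psi>s n) {..<m} x) \<longlonglongrightarrow> arch_dens d \<psi> {..<m} x"
      using arch_dens_nonneg[OF d mon m(2)] arch_dens_nonneg[OF d mons m(2)]
      by (intro tendsto_ennreal_iff) auto
    moreover have "(\<lambda>n. arch_dens d (\<psi>s n) {..<m} x) \<longlonglongrightarrow> arch_dens d \<psi> {..<m} x" if "x \<notin> cube m"
    proof -
      have "\<exists>i<m. x i \<notin> {0<..<1}"
      proof (rule ccontr)
        assume "\<not> ?thesis"
        then have "\<forall>i<m. x i \<in> {0<..<1}" by blast
        then have "x \<in> cube m" using elim(3) by (auto simp: cube_def space_PiM PiE_iff less_imp_le)
        then show False using that by simp
      qed
      then obtain i where "i < m" "x i \<notin> {0<..<1}" by blast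
      then have "arch_dens d \<phi> {..<m} x = 0" for \<phi> by (intro arch_dens_eq_0[of _ i]) auto
      then show ?thesis by simp
    qed
    ultimately show ?case using elim by auto
  qed
  then show ?thesis by (intro iffI; elim AE_mp) (auto elim: eventually_mono)
qed

lemma arch_copula_tendsto_if_dens:
  assumes "AE x in PiM {..<m} (\<lambda>_. lborel). (\<lambda>n. arch_dens d (\<psi>s n) {..<m} x) \<longlonglongrightarrow> arch_dens d \<psi> {..<m} x"
    and a: "a \<in> cube m"
  shows "(\<lambda>n. arch_copula m (\<psi>s n) a) \<longlonglongrightarrow> arch_copula m \<psi> a"
proof -
  have "(\<lambda>n. measure (arch_measure d (\<psi>s n) m) (PiE {..<m} (\<lambda>i. {..a i})))
      \<longlonglongrightarrow> measure (arch_measure d \<psi> m) (PiE {..<m} (\<lambda>i. {..a i}))"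
    unfolding arch_measure_def
  proof (rule measure_density_tendsto)
    show "AE x in PiM {..<m} (\<lambda>_. lborel). (\<lambda>n. ennreal (arch_dens d (\<psi>s n) {..<m} x)) \<longlonglongrightarrow> ennreal (arch_dens d \<psi> {..<m} x)"
      using assms(1) by eventually_elim (rule tendsto_ennrealI)
  qed (use prob_space_arch_measure[OF d mon m(2)] prob_space_arch_measure[OF d mons m(2)]
        arch_dens_borel[OF d mon m(2)] arch_dens_borel[OF d mons m(2)]
        in \<open>auto simp: arch_measure_def intro!: sets_PiM_I_finite\<close>)
  then show ?thesis using measure_arch_measure[OF d mon m(2) a] measure_arch_measure[OF d mons m(2) a] by simp
qed

end

section \<open>Weak conditional convergence\<close>

context
  fixes d :: nat and \<psi> :: "real \<Rightarrow> real" and x :: "nat \<Rightarrow> real"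
  assumes d: "3 \<le> d" and mon: "d_monotone d \<psi>"
    and x: "\<And>i. i < d - 1 \<Longrightarrow> x i \<in> {0<..<1}"
    and pos: "0 < \<psi> (\<Sum>i<d-1. gen_inv \<psi> (x i))"
begin

private lemmas gen_k = d_monotone_gen[OF d mon]

private definition "S = (\<Sum>i<d-1. gen_inv \<psi> (x i))"

lemma sum_pinv_eq: "(\<Sum>i<d-1. pinv \<psi> (x i)) = ereal S"
  unfolding S_def by (rule sum_pinv[OF gen_k]) (use x in \<open>auto simp: less_imp_le\<close>)

lemma sum_gen_inv_S_pos: "0 < S"
  unfolding S_def using d x by (intro sum_gen_inv_pos[OF d mon]) auto

lemma Min_image_neq_1: "Min (x ` {..<d-1}) \<noteq> 1"
proof -
  have "x 0 \<in> x ` {..<d-1}" "x 0 < 1" using d x[of 0] by auto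
  then have "Min (x ` {..<d-1}) \<le> x 0" by (intro Min_le) auto
  then show ?thesis using \<open>x 0 < 1\<close> by simp
qed

lemma not_pinv_0_le: "\<not> pinv \<psi> 0 \<le> ereal S"
  using pinv_0_le_iff[OF gen_k, of S] sum_gen_inv_S_pos pos by (simp add: S_def)

text \<open>If the first zero \<open>z\<close> is finite, then \<open>0 < S < z\<close> gives
  \<open>\<psi> (z - S) > 0\<close>, and the clause with value 0 applies. If there is none, the
  quotient has numerator 0 by the convention at infinity.\<close>

lemma kernel_cdf_0: "kernel_cdf d \<psi> x 0 = 0"
proof (cases "pinv \<psi> 0")
  case (real z)
  then have z: "S < z" using not_pinv_0_le by simp
  then have "\<psi> (z - S) \<noteq> 0"
    using pinv_0_le_iff[OF gen_k, of "z - S"] sum_gen_inv_S_pos real by auto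
  then have "0 < \<psi> (z - S)" using gen_nonneg[OF gen_k, of "z - S"] z by simp
  then have "0 < psi_ext \<psi> (pinv \<psi> 0 - ereal S)" using real z by (simp add: psi_ext_def)
  then show ?thesis
    using Min_image_neq_1 not_pinv_0_le unfolding kernel_cdf_def Let_def sum_pinv_eq by simp
next
  case PInf
  then show ?thesis
    using Min_image_neq_1 not_pinv_0_le unfolding kernel_cdf_def Let_def sum_pinv_eq
    by (simp add: psi_ext_def ld_ext_def)
qed (use pinv_nonneg[of \<psi> 0] in auto)

text \<open>The clause with value 0 is absorbed by the quotient: \<open>y < \<psi> (z - S)\<close>,
  with \<open>z\<close> the first zero, means \<open>S + gen_inv \<psi> y > z\<close>, where the
  last derivative vanishes. The signs cancel in the quotient.\<close>

lemma kernel_cdf_eq: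
  assumes y: "0 < y" "y < 1"
  shows "kernel_cdf d \<psi> x y
    = sderiv d \<psi> (d - 1) (S + gen_inv \<psi> y) / sderiv d \<psi> (d - 1) S"
proof -
  have inv: "0 < gen_inv \<psi> y" "pinv \<psi> y = ereal (gen_inv \<psi> y)"
    using gen_inv_pos[OF gen_k] pinv_eq[OF gen_k] y by auto
  have ld: "ld_ext d \<psi> (ereal t) = - ((- 1) ^ (d - 2) * sderiv d \<psi> (d - 1) t)" if "0 < t" for t
    using left_deriv_nth_deriv[OF d mon that] by (simp add: ld_ext_def)
  have ratio: "ld_ext d \<psi> (ereal S + pinv \<psi> y) / ld_ext d \<psi> (ereal S)
      = sderiv d \<psi> (d - 1) (S + gen_inv \<psi> y) / sderiv d \<psi> (d - 1) S"
    using ld[of "S + gen_inv \<psi> y"] ld[of S] inv sum_gen_inv_S_pos by simp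
  show ?thesis
  proof (cases "y < psi_ext \<psi> (pinv \<psi> 0 - ereal S)")
    case True
    then obtain z where z: "pinv \<psi> 0 = ereal z"
      using pinv_nonneg[of \<psi> 0] y by (cases "pinv \<psi> 0") (auto simp: psi_ext_def)
    then have zS: "S < z" using not_pinv_0_le by simp
    then have "y < \<psi> (z - S)" using True z by (simp add: psi_ext_def)
    then have "z - S < gen_inv \<psi> y" using gen_inv_le_iff[OF gen_k, of y "z - S"] y zS by auto
    moreover have "\<psi> z = 0" using pinv_0_le_iff[OF gen_k, of z] z zS sum_gen_inv_S_pos by simp
    ultimately have "sderiv d \<psi> (d - 1) (S + gen_inv \<psi> y) = 0"
      using zS sum_gen_inv_S_pos by (intro sderiv_vanish[OF d mon, of z]) auto
    then show ?thesis
      using True y Min_image_neq_1 not_pinv_0_le unfolding kernel_cdf_def Let_def sum_pinv_eq by simp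
  next
    case False
    then show ?thesis
      using y Min_image_neq_1 not_pinv_0_le ratio unfolding kernel_cdf_def Let_def sum_pinv_eq by simp
  qed
qed

text \<open>The substitution \<open>t = S + gen_inv \<psi> y\<close>, that is \<open>y = \<psi> (t - S)\<close>, carries continuity of the kernel at
  \<open>y\<close> over to the last derivative.\<close>

lemma isCont_sderiv_if_isCont_kernel:
  assumes y: "0 < y" "y < 1" and cont: "isCont (kernel_cdf d \<psi> x) y" and nz: "sderiv d \<psi> (d - 1) S \<noteq> 0"
  shows "isCont (sderiv d \<psi> (d - 1)) (S + gen_inv \<psi> y)"
proof -
  define t0 where "t0 = S + gen_inv \<psi> y"
  have inv: "0 < gen_inv \<psi> y" "\<psi> (gen_inv \<psi> y) = y"
    using gen_inv_pos[OF gen_k] gen_gen_inv[OF gen_k] y by auto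
  have cont': "isCont (\<lambda>t. \<psi> (t - S)) t0"
    using isCont_o2[of t0 "\<lambda>t. t - S" \<psi>] gen_isCont[OF gen_k inv(1)] by (simp add: t0_def)
  then have "((\<lambda>t. \<psi> (t - S)) \<longlongrightarrow> \<psi> (t0 - S)) (nhds t0)"
    using tendsto_at_iff_tendsto_nhds[of "\<lambda>t. \<psi> (t - S)" t0] unfolding isCont_def by blast
  then have "((\<lambda>t. \<psi> (t - S)) \<longlongrightarrow> y) (nhds t0)"
    using inv by (simp add: t0_def)
  then have "\<forall>\<^sub>F t in nhds t0. 0 < \<psi> (t - S)" "\<forall>\<^sub>F t in nhds t0. \<psi> (t - S) < 1"
    using y by (auto intro: order_tendstoD)
  moreover have "\<forall>\<^sub>F t in nhds t0. t \<in> {S<..}"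
    using inv by (intro eventually_nhds_in_open) (auto simp: t0_def)
  ultimately have "\<forall>\<^sub>F t in nhds t0.
      sderiv d \<psi> (d - 1) t = kernel_cdf d \<psi> x (\<psi> (t - S)) * sderiv d \<psi> (d - 1) S"
  proof eventually_elim
    case (elim t)
    then have "gen_inv \<psi> (\<psi> (t - S)) = t - S" by (intro gen_inv_gen[OF gen_k]) auto
    then show ?case using kernel_cdf_eq[of "\<psi> (t - S)"] elim nz by simp
  qed
  then have "isCont (sderiv d \<psi> (d - 1)) t0
      \<longleftrightarrow> isCont (\<lambda>t. kernel_cdf d \<psi> x (\<psi> (t - S)) * sderiv d \<psi> (d - 1) S) t0"
    by (rule isCont_cong)
  also have "\<dots>"
    using isCont_o2[OF cont', of "kernel_cdf d \<psi> x"] cont inv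
    by (intro continuous_intros) (simp add: t0_def)
  finally show ?thesis by (simp add: t0_def)
qed

lemmas kernel_cdf_eq_sderiv = kernel_cdf_eq[unfolded S_def]
  and isCont_sderiv_if_isCont_kernel_cdf = isCont_sderiv_if_isCont_kernel[unfolded S_def]

end

context
  fixes d :: nat and \<psi> :: "real \<Rightarrow> real" and \<psi>s :: "nat \<Rightarrow> real \<Rightarrow> real"
  assumes d: "3 \<le> d" and mon: "d_monotone d \<psi>" and mons: "\<And>n. d_monotone d (\<psi>s n)"
    and lim: "\<And>x. 0 \<le> x \<Longrightarrow> (\<lambda>n. \<psi>s n x) \<longlonglongrightarrow> \<psi> x"
begin

private lemmas gen_w = d_monotone_gen[OF d mon]
private lemmas gens_w = d_monotone_gen[OF d mons]

text \<open>Numerator and denominator of the kernel converge separately at moving arguments: the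
  denominator by \<open>cont\<close>, the numerator because continuity of the kernel at
  \<open>y\<close> forces that of the last derivative at the corresponding point.\<close>

lemma kernel_cdf_weak_conv:
  assumes x: "\<And>i. i < d - 1 \<Longrightarrow> x i \<in> {0<..<1}"
    and pos: "0 < \<psi> (\<Sum>i<d-1. gen_inv \<psi> (x i))"
    and nz: "sderiv d \<psi> (d - 1) (\<Sum>i<d-1. gen_inv \<psi> (x i)) \<noteq> 0"
    and cont: "isCont (sderiv d \<psi> (d - 1)) (\<Sum>i<d-1. gen_inv \<psi> (x i))"
  shows "weak_conv (\<lambda>n. kernel_cdf d (\<psi>s n) x) (kernel_cdf d \<psi> x)"
  unfolding weak_conv_def
proof (intro allI impI)
  fix y assume y: "isCont (kernel_cdf d \<psi> x) y"
  define S where "S = (\<Sum>i<d-1. gen_inv \<psi> (x i))"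
  define Sn where "Sn n = (\<Sum>i<d-1. gen_inv (\<psi>s n) (x i))" for n
  have inv: "(\<lambda>n. gen_inv (\<psi>s n) z) \<longlonglongrightarrow> gen_inv \<psi> z" if "z \<in> {0<..<1}" for z
    using that by (intro tendsto_gen_inv[OF gen_w gens_w lim]) auto
  have S_lim: "Sn \<longlonglongrightarrow> S"
    unfolding S_def Sn_def using inv x by (intro tendsto_sum) auto
  have S_pos: "0 < S" unfolding S_def using d x by (intro sum_gen_inv_pos[OF d mon]) auto
  \<comment> \<open>The kernel formulas for \<open>\<psi>s n\<close> presuppose a positive value at
    \<open>Sn n\<close>; for large \<open>n\<close> it is inherited from the limit.\<close>
  have "(\<lambda>n. sderiv d (\<psi>s n) 0 (Sn n)) \<longlonglongrightarrow> sderiv d \<psi> 0 S"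
    by (rule sderiv_tendsto_moving[OF d mon mons lim]) (use S_pos S_lim sderiv_isCont[OF d mon, of 0] in auto)
  then have "(\<lambda>n. \<psi>s n (Sn n)) \<longlonglongrightarrow> \<psi> S"
    using sderiv_0[OF d mon] sderiv_0[OF d mons] by simp
  then have ev: "\<forall>\<^sub>F n in sequentially. 0 < \<psi>s n (Sn n)"
    using pos by (intro order_tendstoD) (simp_all add: S_def)
  consider "y < 0" | "1 \<le> y" | "y = 0" | "0 < y" "y < 1" by linarith
  then show "(\<lambda>n. kernel_cdf d (\<psi>s n) x y) \<longlonglongrightarrow> kernel_cdf d \<psi> x y"
  proof cases
    \<comment> \<open>The level 0 need not have a finite inverse, so the quotient formula is
      replaced by \<open>kernel_cdf_0\<close>.\<close>
    case 3
    have "\<forall>\<^sub>F n in sequentially. kernel_cdf d (\<psi>s n) x y = kernel_cdf d \<psi> x y"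
      using ev by eventually_elim
        (use 3 kernel_cdf_0[OF d mon x pos] kernel_cdf_0[OF d mons x] in \<open>simp add: Sn_def\<close>)
    then show ?thesis by (rule tendsto_eventually)
  next
    case 4
    have y_pos: "0 < gen_inv \<psi> y" using gen_inv_pos[OF gen_w 4] .
    have "(\<lambda>n. sderiv d (\<psi>s n) (d - 1) (Sn n)) \<longlonglongrightarrow> sderiv d \<psi> (d - 1) S"
      by (rule sderiv_tendsto_moving[OF d mon mons lim]) (use S_pos S_lim cont in \<open>auto simp: S_def\<close>)
    moreover have "(\<lambda>n. sderiv d (\<psi>s n) (d - 1) (Sn n + gen_inv (\<psi>s n) y)) \<longlonglongrightarrow> sderiv d \<psi> (d - 1) (S + gen_inv \<psi> y)"
    proof (rule sderiv_tendsto_moving[OF d mon mons lim])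
      show "isCont (sderiv d \<psi> (d - 1)) (S + gen_inv \<psi> y)"
        unfolding S_def by (rule isCont_sderiv_if_isCont_kernel_cdf[OF d mon x pos 4 y nz])
      show "(\<lambda>n. Sn n + gen_inv (\<psi>s n) y) \<longlonglongrightarrow> S + gen_inv \<psi> y"
        using S_lim inv[of y] 4 by (intro tendsto_add) auto
    qed (use S_pos y_pos in auto)
    ultimately have "(\<lambda>n. sderiv d (\<psi>s n) (d - 1) (Sn n + gen_inv (\<psi>s n) y) / sderiv d (\<psi>s n) (d - 1) (Sn n))
        \<longlonglongrightarrow> sderiv d \<psi> (d - 1) (S + gen_inv \<psi> y) / sderiv d \<psi> (d - 1) S"
      using nz by (intro tendsto_divide) (auto simp: S_def)
    also have "sderiv d \<psi> (d - 1) (S + gen_inv \<psi> y) / sderiv d \<psi> (d - 1) S = kernel_cdf d \<psi> x y"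
      unfolding S_def by (rule kernel_cdf_eq_sderiv[OF d mon x pos 4, symmetric])
    finally have quot: "(\<lambda>n. sderiv d (\<psi>s n) (d - 1) (Sn n + gen_inv (\<psi>s n) y) / sderiv d (\<psi>s n) (d - 1) (Sn n))
        \<longlonglongrightarrow> kernel_cdf d \<psi> x y" .
    have "\<forall>\<^sub>F n in sequentially. sderiv d (\<psi>s n) (d - 1) (Sn n + gen_inv (\<psi>s n) y) / sderiv d (\<psi>s n) (d - 1) (Sn n)
        = kernel_cdf d (\<psi>s n) x y"
      using ev
    proof eventually_elim
      case (elim n)
      then show ?case
        unfolding Sn_def by (intro kernel_cdf_eq_sderiv[OF d mons x _ 4, symmetric])
    qed
    with quot show ?thesis by (rule Lim_transform_eventually)
  qed (simp_all add: kernel_cdf_def Let_def)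
qed

lemma weak_cond_conv_if_tendsto: "weak_cond_conv d \<psi>s \<psi>"
proof -
  define m where "m = d - 1"
  have m: "m \<le> d - 1" "0 < m" using d by (auto simp: m_def)
  let ?P = "PiM {..<m} (\<lambda>_. lborel :: real measure)"
  define S where "S x = (\<Sum>i<m. gen_inv \<psi> (x i))" for x
  \<comment> \<open>The first zero is added so that \<open>S x \<notin> D\<close> and a nonzero last
    derivative force \<open>\<psi> (S x) > 0\<close>, by \<open>sderiv_vanish\<close>. If there is
    no zero, \<open>real_of_ereal\<close> merely adds the point 0.\<close>
  define D where "D = insert (real_of_ereal (pinv \<psi> 0)) {t. 0 < t \<and> \<not> isCont (sderiv d \<psi> m) t}"
  define \<Lambda> where "\<Lambda> = {x \<in> space ?P. (\<forall>i<m. x i \<in> {0<..<1}) \<and> S x \<notin> D \<and> 0 < sderiv0 d \<psi> m (S x)}"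
  have D: "countable D"
    unfolding D_def using countable_discont_antimono[OF sderiv_antimono[OF d mon m(1)]] by simp
  note [measurable] = gen_inv_measurable[OF d mon] sderiv0_measurable[OF d mon m(1)]
  have [measurable]: "D \<in> sets borel" using D by (rule sets.countable[rotated]) simp
  have [measurable]: "(\<lambda>x. gen_inv \<psi> (x i)) \<in> borel_measurable ?P" if "i \<in> {..<m}" for i
    using that by measurable
  have S_meas [measurable]: "S \<in> borel_measurable ?P" unfolding S_def by measurable
  have \<Lambda>: "\<Lambda> \<in> sets ?P" unfolding \<Lambda>_def by measurable
  interpret prob_space "arch_measure d \<psi> m" by (rule prob_space_arch_measure[OF d mon m(1)])
  have "AE x in arch_measure d \<psi> m. x \<in> \<Lambda>"
    unfolding arch_measure_def
  proof (subst AE_density)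
    \<comment> \<open>Only points of positive density count; there the coordinates lie in
      \<open>(0,1)\<close> and the derivative factor is nonzero.\<close>
    show "AE x in ?P. 0 < ennreal (arch_dens d \<psi> {..<m} x) \<longrightarrow> x \<in> \<Lambda>"
      using AE_sum_gen_inv_notin[OF d mon m D] AE_space
    proof eventually_elim
      case (elim x)
      show ?case
      proof
        assume "0 < ennreal (arch_dens d \<psi> {..<m} x)"
        then have dens: "0 < arch_dens d \<psi> {..<m} x" by (simp add: ennreal_less_zero_iff)
        then have xi: "x i \<in> {0<..<1}" if "i < m" for i
          using arch_dens_eq_0[of "{..<m}" i x d \<psi>] that by force
        have "sderiv0 d \<psi> m (S x) \<noteq> 0" using dens by (auto simp: arch_dens_def S_def)
        then have "0 < sderiv0 d \<psi> m (S x)"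
          using sderiv0_nonneg[OF d mon m(1), of "S x"] by simp
        then show "x \<in> \<Lambda>" using elim xi by (auto simp: \<Lambda>_def S_def)
      qed
    qed
  qed (use arch_dens_borel[OF d mon m(1)] in measurable)
  then have "prob \<Lambda> = 1" using \<Lambda> by (subst prob_eq_1) auto
  moreover have "weak_conv (\<lambda>n. kernel_cdf d (\<psi>s n) x) (kernel_cdf d \<psi> x)" if "x \<in> \<Lambda>" for x
  proof (rule kernel_cdf_weak_conv)
    have xi: "x i \<in> {0<..<1}" if "i < m" for i using that \<open>x \<in> \<Lambda>\<close> by (auto simp: \<Lambda>_def)
    then show "x i \<in> {0<..<1}" if "i < d - 1" for i using that by (simp add: m_def)
    have S_pos: "0 < S x" unfolding S_def using xi by (rule sum_gen_inv_pos[OF d mon m])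
    have sd: "0 < sderiv d \<psi> m (S x)" "S x \<notin> D" using that S_pos by (auto simp: \<Lambda>_def sderiv0_def)
    then show "sderiv d \<psi> (d - 1) (\<Sum>i<d-1. gen_inv \<psi> (x i)) \<noteq> 0"
      "isCont (sderiv d \<psi> (d - 1)) (\<Sum>i<d-1. gen_inv \<psi> (x i))"
      using S_pos by (auto simp: S_def m_def D_def)
    have "0 < \<psi> (S x)"
    proof (rule ccontr)
      assume "\<not> 0 < \<psi> (S x)"
      then have "\<psi> (S x) = 0" using gen_nonneg[OF gen_w, of "S x"] S_pos by simp
      then have "pinv \<psi> 0 \<le> ereal (S x)" using pinv_0_le_iff[OF gen_w, of "S x"] S_pos by simp
      then obtain z where z: "pinv \<psi> 0 = ereal z" "0 \<le> z" "z \<le> S x"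
        using pinv_nonneg[of \<psi> 0] by (cases "pinv \<psi> 0") auto
      then have "z < S x" "\<psi> z = 0"
        using sd(2) pinv_0_le_iff[OF gen_w z(2)] by (auto simp: D_def)
      then have "sderiv d \<psi> m (S x) = 0" using z m by (intro sderiv_vanish[OF d mon, of z]) auto
      then show False using sd by simp
    qed
    then show "0 < \<psi> (\<Sum>i<d-1. gen_inv \<psi> (x i))" by (simp add: S_def m_def)
  qed
  moreover have "\<Lambda> \<subseteq> cube m"
  proof
    fix x assume "x \<in> \<Lambda>"
    then have "x \<in> extensional {..<m}" "\<forall>i<m. x i \<in> {0<..<1}"
      by (simp_all add: \<Lambda>_def space_PiM PiE_iff)
    then show "x \<in> cube m" by (simp add: cube_def PiE_iff less_imp_le)
  qed
  ultimately show ?thesis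
    unfolding weak_cond_conv_def m_def[symmetric] copula_measure_eq[OF d mon m(1)]
    using \<Lambda> by (intro bexI[of _ \<Lambda>]) simp_all
qed

end

section \<open>The equivalences\<close>

theorem theorem4p1:
  fixes d :: nat and \<psi> :: "real \<Rightarrow> real" and \<psi>s :: "nat \<Rightarrow> real \<Rightarrow> real"
  assumes "d \<ge> 3"
    and "ar_generator d \<psi>"
    and "\<And>n. ar_generator d (\<psi>s n)"
  defines "C \<equiv> arch_copula d \<psi>" and "Cs \<equiv> (\<lambda>n. arch_copula d (\<psi>s n))"
  shows
   "(uniform_limit (cube d) Cs C sequentially
       \<longleftrightarrow> (\<forall>i<d. \<forall>j<d. i \<noteq> j \<longrightarrow>
              uniform_limit ({0..1} \<times> {0..1}) (\<lambda>n. marg2 (Cs n) i j) (marg2 C i j) sequentially))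
    \<and> (uniform_limit (cube d) Cs C sequentially
       \<longleftrightarrow> (\<forall>y\<in>{0<..1}. (\<lambda>n. pinv (\<psi>s n) y) \<longlonglongrightarrow> pinv \<psi> y))
    \<and> (uniform_limit (cube d) Cs C sequentially
       \<longleftrightarrow> uniform_limit {0..} \<psi>s \<psi> sequentially)
    \<and> (uniform_limit (cube d) Cs C sequentially
       \<longleftrightarrow> ((\<forall>m\<in>{1..d-2}. \<forall>x>0. (\<lambda>n. nth_deriv m (\<psi>s n) x) \<longlonglongrightarrow> nth_deriv m \<psi> x) \<and>
            (\<forall>x>0. isCont (left_deriv (nth_deriv (d-2) \<psi>)) x \<longrightarrow>
               (\<lambda>n. left_deriv (nth_deriv (d-2) (\<psi>s n)) x) \<longlonglongrightarrow> left_deriv (nth_deriv (d-2) \<psi>) x)))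
    \<and> (uniform_limit (cube d) Cs C sequentially
       \<longleftrightarrow> (\<forall>m\<in>{2..d-1}. AE x in PiM {..<m} (\<lambda>_. lborel).
              x \<in> cube m \<longrightarrow> (\<lambda>n. marg_density m (Cs n) x) \<longlonglongrightarrow> marg_density m C x))
    \<and> (uniform_limit (cube d) Cs C sequentially \<longrightarrow> weak_cond_conv d \<psi>s \<psi>)"
    (is "(?copula \<longleftrightarrow> ?marg2) \<and> (_ \<longleftrightarrow> ?pinv) \<and> (_ \<longleftrightarrow> ?gen) \<and> (_ \<longleftrightarrow> ?deriv) \<and> (_ \<longleftrightarrow> ?dens) \<and> (_ \<longrightarrow> ?weak)")
proof -
  note d = assms(1)
  have mon: "d_monotone d \<psi>" and mons: "\<And>n. d_monotone d (\<psi>s n)"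
    and half: "\<psi> 1 = 1/2" "\<And>n. \<psi>s n 1 = 1/2"
    using assms(2,3) by (auto simp: ar_generator_def)
  note gen = d_monotone_gen[OF d mon] and gens = d_monotone_gen[OF d mons]
  \<comment> \<open>The hub: each of the six assertions is equivalent to this one.\<close>
  define ptw where "ptw \<longleftrightarrow> (\<forall>x\<ge>0. (\<lambda>n. \<psi>s n x) \<longlonglongrightarrow> \<psi> x)"
  have lim: "(\<lambda>n. \<psi>s n x) \<longlonglongrightarrow> \<psi> x" if ptw "0 \<le> x" for x using that by (simp add: ptw_def)
  have biv: ptw if b: "\<And>x y. x \<in> {0<..1} \<Longrightarrow> y \<in> {0<..1} \<Longrightarrow>
      (\<lambda>n. \<psi>s n (gen_inv (\<psi>s n) x + gen_inv (\<psi>s n) y)) \<longlonglongrightarrow> \<psi> (gen_inv \<psi> x + gen_inv \<psi> y)"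
    using gen_tendsto_if_bivariate[OF gen gens half b] by (simp add: ptw_def)
  have copula: ?copula if ptw
    unfolding C_def Cs_def by (rule uniform_limit_arch_copula[OF gen gens lim[OF that]])
  have marg2: ?marg2 if ?copula
    using that unfolding C_def Cs_def by (blast intro: uniform_limit_marg2)
  have ptw_if_marg2: ptw if ?marg2
  proof (rule biv)
    fix x y :: real assume xy: "x \<in> {0<..1}" "y \<in> {0<..1}"
    have "uniform_limit ({0..1} \<times> {0..1}) (\<lambda>n. marg2 (Cs n) 0 1) (marg2 C 0 1) sequentially"
      using that d by simp
    then have "(\<lambda>n. marg2 (Cs n) 0 1 (x, y)) \<longlonglongrightarrow> marg2 C 0 1 (x, y)"
      using xy by (intro tendsto_uniform_limitI) auto
    moreover have "marg2 (arch_copula d \<phi>) 0 1 (x, y) = \<phi> (gen_inv \<phi> x + gen_inv \<phi> y)"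
      if "arch_generator \<phi>" for \<phi>
    proof -
      have "0 \<le> gen_inv \<phi> x + gen_inv \<phi> y"
        using xy by (intro add_nonneg_nonneg gen_inv_nonneg[OF that]) auto
      then show ?thesis
        using marg2_arch_copula[OF that, of 0 d 1] d xy pinv_eq[OF that] by (simp add: psi_ext_def)
    qed
    ultimately show "(\<lambda>n. \<psi>s n (gen_inv (\<psi>s n) x + gen_inv (\<psi>s n) y)) \<longlonglongrightarrow> \<psi> (gen_inv \<psi> x + gen_inv \<psi> y)"
      using gen gens by (simp add: C_def Cs_def)
  qed
  have deriv: "(\<lambda>n. sderiv d (\<psi>s n) k x) \<longlonglongrightarrow> sderiv d \<psi> k x"
    if ptw "k \<le> d - 1" "0 < x" "isCont (sderiv d \<psi> k) x" for k x
    using sderiv_tendsto[OF d mon mons lim[OF that(1)] that(2-)] .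
  have ?deriv if ptw
  proof (intro conjI ballI allI impI)
    fix m x assume m: "m \<in> {1..d-2}" and x: "0 < (x :: real)"
    then have "(\<lambda>n. sderiv d (\<psi>s n) m x) \<longlonglongrightarrow> sderiv d \<psi> m x"
      using sderiv_isCont[OF d mon, of m x] d by (intro deriv[OF that]) auto
    then show "(\<lambda>n. nth_deriv m (\<psi>s n) x) \<longlonglongrightarrow> nth_deriv m \<psi> x"
      using m by (simp add: nth_deriv_eq_sderiv[OF d mon] nth_deriv_eq_sderiv[OF d mons] tendsto_mult_left)
  next
    fix x :: real assume x: "0 < x" and "isCont (left_deriv (nth_deriv (d-2) \<psi>)) x"
    then have "(\<lambda>n. sderiv d (\<psi>s n) (d - 1) x) \<longlonglongrightarrow> sderiv d \<psi> (d - 1) x"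
      using isCont_left_deriv_nth_deriv[OF d mon x] by (intro deriv[OF that]) auto
    then show "(\<lambda>n. left_deriv (nth_deriv (d-2) (\<psi>s n)) x) \<longlonglongrightarrow> left_deriv (nth_deriv (d-2) \<psi>) x"
      using x by (simp add: left_deriv_nth_deriv[OF d mon] left_deriv_nth_deriv[OF d mons] tendsto_mult_left tendsto_minus)
  qed
  moreover have ptw if ?deriv
    unfolding ptw_def
  proof (intro allI impI, rule gen_tendsto_if_deriv_tendsto[OF d mon mons])
    fix x :: real assume "0 < x"
    \<comment> \<open>Order 1 is in range because \<open>d \<ge> 3\<close>; from the common value at
      1, the first derivatives rebuild the generators.\<close>
    then have "(\<lambda>n. nth_deriv 1 (\<psi>s n) x) \<longlonglongrightarrow> nth_deriv 1 \<psi> x" using that d by auto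
    then have "(\<lambda>n. - nth_deriv 1 (\<psi>s n) x) \<longlonglongrightarrow> - nth_deriv 1 \<psi> x" by (rule tendsto_minus)
    moreover have "1 \<le> d - 2" using d by simp
    then have "sderiv d \<phi> 1 x = - nth_deriv 1 \<phi> x" for \<phi> by (simp add: sderiv_def)
    ultimately show "(\<lambda>n. sderiv d (\<psi>s n) 1 x) \<longlonglongrightarrow> sderiv d \<psi> 1 x" by simp
  qed (simp_all only: half)
  moreover have dens_iff: "?dens \<longleftrightarrow> (\<forall>m\<in>{2..d-1}. AE x in PiM {..<m} (\<lambda>_. lborel).
      (\<lambda>n. arch_dens d (\<psi>s n) {..<m} x) \<longlonglongrightarrow> arch_dens d \<psi> {..<m} x)"
    unfolding C_def Cs_def
    by (intro ball_cong refl AE_marg_density_tendsto_iff[OF d mon mons]) auto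
  have ?dens if ptw
    unfolding dens_iff using AE_arch_dens_tendsto[OF d mon mons _ _ lim[OF that]] by auto
  moreover have ptw if ?dens
  proof (rule biv)
    fix x y :: real assume xy: "x \<in> {0<..1}" "y \<in> {0<..1}"
    \<comment> \<open>Order 2 lies in \<open>{2..d-1}\<close> because \<open>d \<ge> 3\<close>; its
      densities give the bivariate distribution functions that \<open>biv\<close> asks for.\<close>
    define a where "a = restrict (\<lambda>i. if i = 0 then x else y) {..<2 :: nat}"
    have a: "a \<in> cube 2" using xy by (auto simp: a_def cube_def)
    have "(\<lambda>n. arch_copula 2 (\<psi>s n) a) \<longlonglongrightarrow> arch_copula 2 \<psi> a"
      using that d unfolding dens_iff
      by (intro arch_copula_tendsto_if_dens[OF d mon mons _ _ _ a]) auto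
    moreover have "arch_copula 2 \<phi> a = \<phi> (gen_inv \<phi> x + gen_inv \<phi> y)" if "arch_generator \<phi>" for \<phi>
      using xy by (subst arch_copula_pos[OF that]) (auto simp: a_def numeral_2_eq_2)
    ultimately show "(\<lambda>n. \<psi>s n (gen_inv (\<psi>s n) x + gen_inv (\<psi>s n) y)) \<longlonglongrightarrow> \<psi> (gen_inv \<psi> x + gen_inv \<psi> y)"
      using gen gens by simp
  qed
  moreover have ?weak if ptw using weak_cond_conv_if_tendsto[OF d mon mons lim[OF that]] .
  moreover have "?gen \<longleftrightarrow> ptw" unfolding ptw_def by (rule gen_uniform_limit_iff[OF gen gens])
  moreover have "?pinv \<longleftrightarrow> ptw" unfolding ptw_def by (rule gen_tendsto_iff_pinv[OF gen gens, symmetric])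
  ultimately show ?thesis using copula marg2 ptw_if_marg2 by argo
qed

end
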